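(* Let $X=\mathbb{Z}\setminus\{0\}$ and let $C^*(X)\subset B(\ell^2(X))$ be the partial translation algebra arising from the inclusion of $X$ in $\mathbb{Z}$. Then $C^*(X)$ is a trivial extension of $C(S^1)$ by the compact operators: there is a short exact sequence $$0\to\mathcal{K}(\ell^2(X))\to C^*(X)\to C^*_\rho(\mathbb{Z})\cong C(S^1)\to 0,$$ in which, for every $n\in\mathbb{Z}$, the quotient map takes the operator of partial translation by $n$ on $X$ to the operator of translation by $n$ on $\mathbb{Z}$, and this extension represents the trivial element in $K$-homology. Consequently it is not equivalent, in the sense of $K$-homology, to the Toeplitz extension.
   Context: For a subset $X\subseteq\mathbb{Z}$ and $n\in\mathbb{Z}$, the partial translation by $n$ on $X$ is the map $s_n$ with domain $\{x\in X: x+n\in X\}$ given by $s_n(x)=x+n$. It is regarded as the partial isometry of $\ell^2(X)$ sending $\delta_x$ to $\delta_{x+n}$ if $x+n\in X$ and to $0$ otherwise. The partial translation algebra $C^*(X)\subset B(\ell^2(X))$ arising from the inclusion $X\subset\mathbb{Z}$ is the $C^*$-algebra generated by all the operators $s_n$, $n\in\mathbb{Z}$. For $X=\mathbb{Z}$ this is the (right) reduced group $C^*$-algebra $C^*_\rho(\mathbb{Z})\subset B(\ell^2(\mathbb{Z}))$, identified with $C(S^1)$ by sending translation by $1$ to the function $z$. $\mathcal{K}(\cdot)$ denotes the compact operators. The Toeplitz extension is $0\to\mathcal{K}(H_2)\to\mathcal{T}\to C(S^1)\to 0$, where $H_2\subset L^2(S^1)$ is the Hardy space (closed span of $\{z^n:n\ge0\}$),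 $\mathcal{T}$ is the $C^*$-algebra generated by the Toeplitz operator $T_z$, and the quotient map sends $T_z$ to $z$. Extensions of $C(S^1)$ by the compact operators define classes in the (odd) $K$-homology group of $C(S^1)$, i.e. in $\mathrm{Ext}(C(S^1))$; an extension is trivial if its class is zero, and two extensions are equivalent in the sense of $K$-homology if their classes agree. *)

theory Defs
  imports "HOL-Probability.Probability"
begin

section \<open>Complex Hilbert spaces\<close>

text \<open>The inner product \<open>cinner\<close> is conjugate-linear in its first and linear in its second argument.
  The real inner product is its real part, so norm and topology are the usual ones.\<close>

class complex_inner = real_inner +
  fixes scaleC :: "complex \<Rightarrow> 'a \<Rightarrow> 'a" (infixr "*\<^sub>C" 75)
    and cinner :: "'a \<Rightarrow> 'a \<Rightarrow> complex"
  assumes scaleC_add_right: "c *\<^sub>C (x + y) = c *\<^sub>C x + c *\<^sub>C y"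
    and scaleC_add_left: "(c + d) *\<^sub>C x = c *\<^sub>C x + d *\<^sub>C x"
    and scaleC_scaleC: "c *\<^sub>C d *\<^sub>C x = (c * d) *\<^sub>C x"
    and scaleC_of_real: "complex_of_real r *\<^sub>C x = r *\<^sub>R x"
    and cinner_add_right: "cinner x (y + z) = cinner x y + cinner x z"
    and cinner_scaleC_right: "cinner x (c *\<^sub>C y) = c * cinner x y"
    and cinner_commute: "cinner x y = cnj (cinner y x)"
    and inner_eq_Re_cinner: "inner x y = Re (cinner x y)"

class chilbert_space = complex_inner + complete_space

lemma scaleC_one: "1 *\<^sub>C x = (x::'a::complex_inner)"
  using scaleC_of_real[of 1 x] by simp

global_interpretation complex_vector: vector_space "scaleC :: complex \<Rightarrow> 'a \<Rightarrow> 'a::complex_inner"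
  by unfold_locales (simp_all add: scaleC_add_right scaleC_add_left scaleC_scaleC scaleC_one)

lemma cinner_self: "cinner x x = complex_of_real ((norm (x::'a::complex_inner))\<^sup>2)"
proof (rule complex_eqI)
  show "Re (cinner x x) = Re (complex_of_real ((norm x)\<^sup>2))"
    by (metis Re_complex_of_real inner_eq_Re_cinner power2_norm_eq_inner)
  show "Im (cinner x x) = Im (complex_of_real ((norm x)\<^sup>2))"
    using arg_cong[OF cinner_commute[of x x], of Im] by simp
qed

lemma norm_scaleC: "norm (c *\<^sub>C x) = cmod c * norm (x::'a::complex_inner)"
proof -
  have "complex_of_real ((norm (c *\<^sub>C x))\<^sup>2) = cinner (c *\<^sub>C x) (c *\<^sub>C x)"
    by (simp add: cinner_self)
  also have "\<dots> = c * cnj (cinner x (c *\<^sub>C x))"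
    by (metis cinner_commute cinner_scaleC_right)
  also have "\<dots> = (c * cnj c) * complex_of_real ((norm x)\<^sup>2)"
    by (simp add: cinner_scaleC_right cinner_self)
  also have "\<dots> = complex_of_real ((cmod c * norm x)\<^sup>2)"
    by (simp add: power_mult_distrib flip: complex_norm_square)
  finally have "(norm (c *\<^sub>C x))\<^sup>2 = (cmod c * norm x)\<^sup>2"
    using of_real_eq_iff by blast
  then show ?thesis by (simp add: power2_eq_iff_nonneg)
qed

instantiation prod :: (complex_inner, complex_inner) complex_inner
begin

definition scaleC_prod where "scaleC_prod c (p :: 'a \<times> 'b) = (c *\<^sub>C fst p, c *\<^sub>C snd p)"
definition cinner_prod where
  "cinner_prod (p :: 'a \<times> 'b) q = cinner (fst p) (fst q) + cinner (snd p) (snd q)"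

instance
proof
  fix x y z :: "'a \<times> 'b" and c d :: complex and r :: real
  show "c *\<^sub>C (x + y) = c *\<^sub>C x + c *\<^sub>C y" by (simp add: scaleC_prod_def scaleC_add_right)
  show "(c + d) *\<^sub>C x = c *\<^sub>C x + d *\<^sub>C x" by (simp add: scaleC_prod_def scaleC_add_left)
  show "c *\<^sub>C d *\<^sub>C x = (c * d) *\<^sub>C x" by (simp add: scaleC_prod_def scaleC_scaleC)
  show "complex_of_real r *\<^sub>C x = r *\<^sub>R x" by (simp add: scaleC_prod_def scaleC_of_real scaleR_prod_def)
  show "cinner x (y + z) = cinner x y + cinner x z" by (simp add: cinner_prod_def cinner_add_right)
  show "cinner x (c *\<^sub>C y) = c * cinner x y"
    by (simp add: cinner_prod_def scaleC_prod_def cinner_scaleC_right algebra_simps)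
  show "cinner x y = cnj (cinner y x)"
    unfolding cinner_prod_def complex_cnj_add by (metis cinner_commute)
  show "inner x y = Re (cinner x y)" by (simp add: cinner_prod_def inner_prod_def inner_eq_Re_cinner)
qed

end

instance prod :: (chilbert_space, chilbert_space) chilbert_space ..


section \<open>Square-summable families\<close>

lemma cmod_mult_le_squares: "cmod (a * b) \<le> (cmod a)\<^sup>2 + (cmod b)\<^sup>2"
proof -
  have "0 \<le> (cmod a - cmod b)\<^sup>2" "0 \<le> (cmod a)\<^sup>2 + (cmod b)\<^sup>2" by simp_all
  then show ?thesis unfolding norm_mult power2_diff by linarith
qed

lemma cmod_add_squared_le: "(cmod (a + b))\<^sup>2 \<le> 2 * (cmod a)\<^sup>2 + 2 * (cmod b)\<^sup>2"
proof -
  have "(cmod (a + b))\<^sup>2 \<le> (cmod a + cmod b)\<^sup>2" by (intro power_mono norm_triangle_ineq) simp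
  moreover have "0 \<le> (cmod a - cmod b)\<^sup>2" by simp
  ultimately show ?thesis by (simp add: power2_diff power2_sum)
qed

definition square_summable :: "('i \<Rightarrow> complex) \<Rightarrow> bool" where
  "square_summable f \<longleftrightarrow> (\<lambda>i. (cmod (f i))\<^sup>2) summable_on UNIV"

lemma square_summable_add:
  assumes "square_summable f" "square_summable g" shows "square_summable (\<lambda>i. f i + g i)"
  unfolding square_summable_def
proof (rule summable_on_comparison_test)
  show "(\<lambda>i. 2 * (cmod (f i))\<^sup>2 + 2 * (cmod (g i))\<^sup>2) summable_on UNIV"
    using assms unfolding square_summable_def by (intro summable_on_add summable_on_cmult_right)
qed (auto simp: cmod_add_squared_le)

lemma square_summable_scale:
  assumes "square_summable f" shows "square_summable (\<lambda>i. c * f i)"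
  using assms unfolding square_summable_def norm_mult power_mult_distrib
  by (intro summable_on_cmult_right)

lemma square_summable_mult:
  assumes "square_summable f" "square_summable g" shows "(\<lambda>i. cnj (f i) * g i) summable_on UNIV"
proof (rule abs_summable_summable, rule summable_on_comparison_test)
  show "(\<lambda>i. (cmod (f i))\<^sup>2 + (cmod (g i))\<^sup>2) summable_on UNIV"
    using assms unfolding square_summable_def by (intro summable_on_add)
  show "norm (cnj (f i) * g i) \<le> (cmod (f i))\<^sup>2 + (cmod (g i))\<^sup>2" for i
    using cmod_mult_le_squares[of "cnj (f i)" "g i"] by simp
qed auto

lemma square_summable_self:
  assumes "square_summable f"
  shows "(\<Sum>\<^sub>\<infinity>i. cnj (f i) * f i) = complex_of_real (\<Sum>\<^sub>\<infinity>i. (cmod (f i))\<^sup>2)"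
proof (rule infsumI)
  have "((\<lambda>i. (cmod (f i))\<^sup>2) has_sum (\<Sum>\<^sub>\<infinity>i. (cmod (f i))\<^sup>2)) UNIV"
    using assms unfolding square_summable_def by simp
  then have "((\<lambda>i. complex_of_real ((cmod (f i))\<^sup>2)) has_sum
      complex_of_real (\<Sum>\<^sub>\<infinity>i. (cmod (f i))\<^sup>2)) UNIV"
    by (rule has_sum_of_real)
  then show "((\<lambda>i. cnj (f i) * f i) has_sum complex_of_real (\<Sum>\<^sub>\<infinity>i. (cmod (f i))\<^sup>2)) UNIV"
    by (simp only: complex_norm_square mult.commute[of "cnj _"])
qed

typedef 'i ell2 = "{f :: 'i \<Rightarrow> complex. square_summable f}"
  morphisms coeff Abs_ell2
  by (rule exI[of _ "\<lambda>_. 0"]) (simp add: square_summable_def)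

setup_lifting type_definition_ell2

instantiation ell2 :: (type) complex_inner
begin

lift_definition zero_ell2 :: "'a ell2" is "\<lambda>_. 0" by (simp add: square_summable_def)
lift_definition plus_ell2 :: "'a ell2 \<Rightarrow> 'a ell2 \<Rightarrow> 'a ell2" is "\<lambda>f g i. f i + g i"
  by (rule square_summable_add)
lift_definition uminus_ell2 :: "'a ell2 \<Rightarrow> 'a ell2" is "\<lambda>f i. - f i"
  by (simp add: square_summable_def)
lift_definition minus_ell2 :: "'a ell2 \<Rightarrow> 'a ell2 \<Rightarrow> 'a ell2" is "\<lambda>f g i. f i - g i"
  using square_summable_add[of _ "\<lambda>i. - _ i"] by (simp add: square_summable_def)
lift_definition scaleC_ell2 :: "complex \<Rightarrow> 'a ell2 \<Rightarrow> 'a ell2" is "\<lambda>c f i. c * f i"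
  by (rule square_summable_scale)
lift_definition scaleR_ell2 :: "real \<Rightarrow> 'a ell2 \<Rightarrow> 'a ell2" is "\<lambda>r f i. complex_of_real r * f i"
  by (rule square_summable_scale)
lift_definition cinner_ell2 :: "'a ell2 \<Rightarrow> 'a ell2 \<Rightarrow> complex" is
  "\<lambda>f g. \<Sum>\<^sub>\<infinity>i. cnj (f i) * g i" .

definition inner_ell2 :: "'a ell2 \<Rightarrow> 'a ell2 \<Rightarrow> real" where "inner_ell2 x y = Re (cinner x y)"
definition norm_ell2 :: "'a ell2 \<Rightarrow> real" where "norm_ell2 x = sqrt (inner x x)"
definition dist_ell2 :: "'a ell2 \<Rightarrow> 'a ell2 \<Rightarrow> real" where "dist_ell2 x y = norm (x - y)"
definition sgn_ell2 :: "'a ell2 \<Rightarrow> 'a ell2" where "sgn_ell2 x = inverse (norm x) *\<^sub>R x"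
definition uniformity_ell2 :: "('a ell2 \<times> 'a ell2) filter" where
  "uniformity_ell2 = (INF e\<in>{0<..}. principal {(x, y). dist x y < e})"
definition open_ell2 :: "'a ell2 set \<Rightarrow> bool" where
  "open_ell2 U = (\<forall>x\<in>U. \<forall>\<^sub>F (x', y) in uniformity. x' = x \<longrightarrow> y \<in> U)"

instance
proof
  fix x y z :: "'a ell2" and a b :: real and c d :: complex
  show "x + y + z = x + (y + z)" "x + y = y + x" "0 + x = x" "- x + x = 0" "x - y = x + - y"
    by (transfer; simp add: algebra_simps)+
  show "a *\<^sub>R (x + y) = a *\<^sub>R x + a *\<^sub>R y" "(a + b) *\<^sub>R x = a *\<^sub>R x + b *\<^sub>R x"
    "a *\<^sub>R b *\<^sub>R x = (a * b) *\<^sub>R x" "1 *\<^sub>R x = x"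
    by (transfer; simp add: algebra_simps)+
  show "sgn x = inverse (norm x) *\<^sub>R x" by (rule sgn_ell2_def)
  show "dist x y = norm (x - y)" by (rule dist_ell2_def)
  show "uniformity = (INF e\<in>{0<..}. principal {(x, y :: 'a ell2). dist x y < e})"
    by (rule uniformity_ell2_def)
  show "open U = (\<forall>x\<in>U. \<forall>\<^sub>F (x', y) in uniformity. x' = x \<longrightarrow> y \<in> U)" for U :: "'a ell2 set"
    by (rule open_ell2_def)
  show "c *\<^sub>C (x + y) = c *\<^sub>C x + c *\<^sub>C y" "(c + d) *\<^sub>C x = c *\<^sub>C x + d *\<^sub>C x"
    "c *\<^sub>C d *\<^sub>C x = (c * d) *\<^sub>C x" "complex_of_real a *\<^sub>C x = a *\<^sub>R x"
    by (transfer; simp add: algebra_simps)+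
  show add: "cinner x (y + z) = cinner x y + cinner x z" for x y z :: "'a ell2"
    by transfer (simp add: distrib_left infsum_add square_summable_mult)
  show scale: "cinner x (c *\<^sub>C y) = c * cinner x y" for x y :: "'a ell2" and c
    by transfer (simp add: infsum_cmult_right' mult.left_commute)
  show comm: "cinner x y = cnj (cinner y x)" for x y :: "'a ell2"
    by transfer (simp add: mult.commute flip: infsum_cnj)
  show Re: "inner x y = Re (cinner x y)" for x y :: "'a ell2" by (rule inner_ell2_def)
  show inner_comm: "inner x y = inner y x" for x y :: "'a ell2"
    unfolding Re by (subst comm) simp
  have scaleRC: "a *\<^sub>R x = complex_of_real a *\<^sub>C x" for x :: "'a ell2" by transfer simp
  show "inner (x + y) z = inner x z + inner y z"
    unfolding inner_comm[of _ z] by (simp add: Re add)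
  show "inner (a *\<^sub>R x) y = a * inner x y"
    unfolding inner_comm[of _ y] by (simp add: Re scale scaleRC)
  have sq: "cinner x x = complex_of_real (\<Sum>\<^sub>\<infinity>i. (cmod (coeff x i))\<^sup>2)"
    by transfer (rule square_summable_self)
  show "0 \<le> inner x x" by (simp add: Re sq infsum_nonneg)
  show "inner x x = 0 \<longleftrightarrow> x = 0"
  proof
    assume "inner x x = 0"
    then have *: "(\<Sum>\<^sub>\<infinity>i. (cmod (coeff x i))\<^sup>2) = 0" by (simp add: Re sq)
    have "(cmod (coeff x i))\<^sup>2 = 0" for i
      by (rule nonneg_infsum_le_0D[where A = UNIV])
        (use * coeff[of x] in \<open>auto simp: square_summable_def\<close>)
    then show "x = 0" by (simp add: coeff_inject[symmetric] zero_ell2.rep_eq fun_eq_iff)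
  next
    assume "x = 0" then show "inner x x = 0" by (simp add: Re cinner_ell2.rep_eq zero_ell2.rep_eq)
  qed
  show "norm x = sqrt (inner x x)" by (rule norm_ell2_def)
qed

end

lemma norm_ell2_squared: "(norm x)\<^sup>2 = (\<Sum>\<^sub>\<infinity>i. (cmod (coeff x i))\<^sup>2)"
proof -
  have "complex_of_real ((norm x)\<^sup>2) = complex_of_real (\<Sum>\<^sub>\<infinity>i. (cmod (coeff x i))\<^sup>2)"
    unfolding cinner_self[symmetric] cinner_ell2.rep_eq
    by (rule square_summable_self) (use coeff[of x] in simp)
  then show ?thesis using of_real_eq_iff by blast
qed

lemma summable_coeff: "(\<lambda>i. (cmod (coeff x i))\<^sup>2) summable_on UNIV"
  using coeff[of x] by (simp add: square_summable_def)

lemma sum_coeff_le_norm: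
  assumes "finite F" shows "(\<Sum>i\<in>F. (cmod (coeff x i))\<^sup>2) \<le> (norm x)\<^sup>2"
  unfolding norm_ell2_squared by (rule finite_sum_le_infsum) (auto simp: assms summable_coeff)

lemma cmod_coeff_le_norm: "cmod (coeff x i) \<le> norm x"
  using sum_coeff_le_norm[of "{i}" x] by (simp add: power2_le_iff_abs_le)

instance ell2 :: (type) chilbert_space
proof
  fix X :: "nat \<Rightarrow> 'a ell2" assume X: "Cauchy X"
  have Cauchy: "Cauchy (\<lambda>n. coeff (X n) i)" for i
  proof (rule metric_CauchyI)
    fix e :: real assume "0 < e"
    then obtain N where N: "\<And>m n. m \<ge> N \<Longrightarrow> n \<ge> N \<Longrightarrow> dist (X m) (X n) < e"
      using metric_CauchyD[OF X] by blast
    have "dist (coeff (X m) i) (coeff (X n) i) \<le> dist (X m) (X n)" for m n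
      using cmod_coeff_le_norm[of "X m - X n" i] by (simp add: dist_norm minus_ell2.rep_eq)
    then show "\<exists>N. \<forall>m\<ge>N. \<forall>n\<ge>N. dist (coeff (X m) i) (coeff (X n) i) < e"
      using N by (meson le_less_trans)
  qed
  define l where "l i = lim (\<lambda>n. coeff (X n) i)" for i
  have l: "(\<lambda>n. coeff (X n) i) \<longlonglongrightarrow> l i" for i
    using Cauchy[of i] unfolding l_def by (simp add: Cauchy_convergent_iff convergent_LIMSEQ_iff)
  have bound: "(\<Sum>i\<in>F. (cmod (coeff (X n) i - l i))\<^sup>2) \<le> e\<^sup>2"
    if "finite F" "\<And>m. m \<ge> n \<Longrightarrow> dist (X n) (X m) < e" for F n e
  proof (rule tendsto_upperbound)
    show "(\<lambda>m. \<Sum>i\<in>F. (cmod (coeff (X n) i - coeff (X m) i))\<^sup>2)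
        \<longlonglongrightarrow> (\<Sum>i\<in>F. (cmod (coeff (X n) i - l i))\<^sup>2)"
      by (intro tendsto_sum tendsto_power tendsto_norm tendsto_diff tendsto_const l)
    have "(\<Sum>i\<in>F. (cmod (coeff (X n) i - coeff (X m) i))\<^sup>2) \<le> e\<^sup>2" if "m \<ge> n" for m
    proof -
      have "(\<Sum>i\<in>F. (cmod (coeff (X n) i - coeff (X m) i))\<^sup>2) \<le> (norm (X n - X m))\<^sup>2"
        using sum_coeff_le_norm[OF \<open>finite F\<close>, of "X n - X m"] by (simp add: minus_ell2.rep_eq)
      also have "\<dots> \<le> e\<^sup>2"
        using \<open>\<And>m. m \<ge> n \<Longrightarrow> dist (X n) (X m) < e\<close>[OF that]
        by (intro power_mono) (auto simp: dist_norm)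
      finally show ?thesis .
    qed
    then show "\<forall>\<^sub>F m in sequentially. (\<Sum>i\<in>F. (cmod (coeff (X n) i - coeff (X m) i))\<^sup>2) \<le> e\<^sup>2"
      unfolding eventually_sequentially by blast
  qed simp
  have diff: "square_summable (\<lambda>i. coeff (X n) i - l i)"
    if "\<And>m. m \<ge> n \<Longrightarrow> dist (X n) (X m) < e" for n e
    unfolding square_summable_def
    by (rule nonneg_bdd_above_summable_on) (use bound that in \<open>auto simp: bdd_above_def\<close>)
  obtain N where "\<And>m. m \<ge> N \<Longrightarrow> dist (X N) (X m) < 1"
    using metric_CauchyD[OF X zero_less_one] by blast
  then have "square_summable (\<lambda>i. coeff (X N) i - l i)" by (rule diff)
  then have "square_summable (\<lambda>i. (-1) * (coeff (X N) i - l i))" by (rule square_summable_scale)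
  with coeff[of "X N"] have "square_summable (\<lambda>i. coeff (X N) i + (-1) * (coeff (X N) i - l i))"
    by (intro square_summable_add) auto
  then have l_ss: "square_summable l" by simp
  define L where "L = Abs_ell2 l"
  have L: "coeff L = l" using l_ss by (simp add: L_def Abs_ell2_inverse)
  have "X \<longlonglongrightarrow> L"
  proof (rule metric_LIMSEQ_I)
    fix e :: real assume "0 < e"
    then have "0 < e / 2" by simp
    then obtain N where N: "\<And>m n. m \<ge> N \<Longrightarrow> n \<ge> N \<Longrightarrow> dist (X m) (X n) < e / 2"
      using metric_CauchyD[OF X] by blast
    have "dist (X n) L < e" if "n \<ge> N" for n
    proof -
      have near: "dist (X n) (X m) < e / 2" if "m \<ge> n" for m
        using N \<open>n \<ge> N\<close> that by simp
      have "(norm (X n - L))\<^sup>2 \<le> (e / 2)\<^sup>2"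
        unfolding norm_ell2_squared minus_ell2.rep_eq L
        by (rule infsum_le_finite_sums)
          (use diff[OF near] bound near in \<open>auto simp: square_summable_def\<close>)
      then have "norm (X n - L) \<le> e / 2" using \<open>0 < e\<close> by (simp add: power2_le_iff_abs_le)
      then show ?thesis using \<open>0 < e\<close> by (simp add: dist_norm)
    qed
    then show "\<exists>N. \<forall>n\<ge>N. dist (X n) L < e" by blast
  qed
  then show "convergent X" by (auto simp: convergent_def)
qed

lift_definition ket :: "'i \<Rightarrow> 'i ell2" is "\<lambda>i j. if j = i then 1 else 0"
  unfolding square_summable_def
  by (rule summable_on_cong_neutral[THEN iffD1, OF _ _ _ summable_on_finite[of "{_}"]]) auto


section \<open>Bounded operators\<close>

definition bounded_ops :: "('a::complex_inner \<Rightarrow>\<^sub>L 'b::complex_inner) set" where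
  "bounded_ops = {T :: 'a \<Rightarrow>\<^sub>L 'b. \<forall>c x. T (c *\<^sub>C x) = c *\<^sub>C T x}"

definition compact_ops :: "('a::complex_inner \<Rightarrow>\<^sub>L 'b::complex_inner) set" where
  "compact_ops = {T \<in> bounded_ops. compact (closure (T ` cball 0 1))}"

lift_definition scaleC_op ::
  "complex \<Rightarrow> ('a::complex_inner \<Rightarrow>\<^sub>L 'b::complex_inner) \<Rightarrow> ('a \<Rightarrow>\<^sub>L 'b)" is "\<lambda>c T x. c *\<^sub>C T x"
proof -
  fix c :: complex and T :: "'a \<Rightarrow> 'b" assume "bounded_linear T"
  then interpret bounded_linear T .
  obtain K where K: "\<And>x. norm (T x) \<le> norm x * K" using bounded by blast
  show "bounded_linear (\<lambda>x. c *\<^sub>C T x)"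
  proof (rule bounded_linear_intro)
    show "c *\<^sub>C T (x + y) = c *\<^sub>C T x + c *\<^sub>C T y" for x y by (simp add: add scaleC_add_right)
    show "c *\<^sub>C T (r *\<^sub>R x) = r *\<^sub>R c *\<^sub>C T x" for r x
      unfolding scaleR by (metis mult.commute scaleC_of_real scaleC_scaleC)
    show "norm (c *\<^sub>C T x) \<le> norm x * (cmod c * K)" for x
      using mult_left_mono[OF K, of "cmod c" x] by (simp add: norm_scaleC mult_ac)
  qed
qed

lemma riesz_real:
  fixes \<phi> :: "'a::{real_inner, complete_space} \<Rightarrow> real"
  assumes "bounded_linear \<phi>" shows "\<exists>v. \<forall>x. \<phi> x = inner v x"
proof -
  interpret bounded_linear \<phi> by fact
  obtain K where K: "\<And>x. \<bar>\<phi> x\<bar> \<le> norm x * K" using bounded by auto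
  define J where "J x = (norm x)\<^sup>2 - 2 * \<phi> x" for x
  have lower: "- K\<^sup>2 \<le> J x" for x
  proof -
    have "0 \<le> (norm x - K)\<^sup>2" by simp
    then have "2 * (norm x * K) \<le> (norm x)\<^sup>2 + K\<^sup>2" by (simp add: power2_diff)
    moreover have "\<phi> x \<le> norm x * K" using K[of x] by linarith
    ultimately show ?thesis unfolding J_def by linarith
  qed
  then have bdd: "bdd_below (range J)" by (auto simp: bdd_below_def)
  define m where "m = Inf (range J)"
  have m: "m \<le> J x" for x unfolding m_def by (rule cInf_lower) (auto intro: bdd)
  have "\<exists>x. J x < m + 1 / real (Suc n)" for n
    using cInf_lessD[of "range J" "m + 1 / real (Suc n)"] unfolding m_def by auto
  then obtain u where u: "\<And>n. J (u n) < m + 1 / real (Suc n)" by metis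
  have para: "(norm (x - y))\<^sup>2 \<le> 2 * (J x - m) + 2 * (J y - m)" for x y
  proof -
    define w where "w = (1/2) *\<^sub>R (x + y)"
    have "(norm (x - y))\<^sup>2 = 2 * J x + 2 * J y - 4 * J w"
      unfolding J_def w_def power2_norm_eq_inner inner_simps scaleR add
      by (simp add: algebra_simps inner_commute)
    then show ?thesis using m[of w] by simp
  qed
  have "Cauchy u"
  proof (rule metric_CauchyI)
    fix e :: real assume e: "0 < e"
    then obtain N where N: "4 / real (Suc N) < e\<^sup>2"
      using reals_Archimedean[of "e\<^sup>2 / 4"] by (auto simp: field_simps)
    have "dist (u i) (u j) < e" if "i \<ge> N" "j \<ge> N" for i j
    proof -
      have "1 / real (Suc i) \<le> 1 / real (Suc N)" "1 / real (Suc j) \<le> 1 / real (Suc N)"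
        using that by (auto intro: divide_left_mono)
      then have "(norm (u i - u j))\<^sup>2 < 4 * (1 / real (Suc N))"
        using para[of "u i" "u j"] u[of i] u[of j] by argo
      also have "\<dots> < e\<^sup>2" using N by simp
      finally have "(norm (u i - u j))\<^sup>2 < e\<^sup>2" .
      then show ?thesis using e by (simp add: dist_norm power2_less_imp_less)
    qed
    then show "\<exists>N. \<forall>i\<ge>N. \<forall>j\<ge>N. dist (u i) (u j) < e" by blast
  qed
  then obtain v where v: "u \<longlonglongrightarrow> v" by (auto simp: Cauchy_convergent_iff convergent_def)
  have "(\<lambda>n. J (u n)) \<longlonglongrightarrow> J v" unfolding J_def by (intro tendsto_intros tendsto v)
  moreover have "(\<lambda>n. m + 1 / real (Suc n)) \<longlonglongrightarrow> m + 0"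
    by (intro tendsto_add tendsto_const LIMSEQ_Suc[OF lim_1_over_n])
  ultimately have "J v \<le> m + 0" by (rule LIMSEQ_le) (use u less_imp_le in blast)
  then have min: "J v \<le> J x" for x using m[of x] by simp
  have "\<phi> x = inner v x" for x
  proof (cases "x = 0")
    case False
    define c where "c = inner v x - \<phi> x"
    have "J (v + t *\<^sub>R x) = J v + 2 * t * c + t\<^sup>2 * (norm x)\<^sup>2" for t
      unfolding J_def c_def power2_norm_eq_inner inner_simps scaleR add
      by (simp add: algebra_simps inner_commute power2_eq_square)
    with min[of "v + _ *\<^sub>R x"] have *: "0 \<le> 2 * t * c + t\<^sup>2 * (norm x)\<^sup>2" for t by simp
    have "0 \<le> 2 * (- c / (norm x)\<^sup>2) * c + (- c / (norm x)\<^sup>2)\<^sup>2 * (norm x)\<^sup>2" by (rule *)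
    also have "\<dots> = - (c\<^sup>2 / (norm x)\<^sup>2)" using False by (simp add: power2_eq_square field_simps)
    finally have "c\<^sup>2 / (norm x)\<^sup>2 \<le> 0" by simp
    then have "c = 0" using False by (simp add: divide_le_0_iff)
    then show ?thesis by (simp add: c_def)
  qed (simp add: zero)
  then show ?thesis by blast
qed

lemma inner_eqI: "(\<And>x. inner a x = inner b x) \<Longrightarrow> a = (b :: 'a::real_inner)"
  by (metis inner_diff_left inner_eq_zero_iff right_minus_eq)

lemma cinner_eq_inner:
  "cinner x y = Complex (inner x y) (- inner x (\<i> *\<^sub>C (y :: 'a::complex_inner)))"
  by (simp add: complex_eq_iff inner_eq_Re_cinner cinner_scaleC_right)

lemma ex_adj:
  fixes T :: "'a::chilbert_space \<Rightarrow>\<^sub>L 'b::chilbert_space"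
  assumes T: "T \<in> bounded_ops"
  shows "\<exists>!S. S \<in> bounded_ops \<and> (\<forall>x y. cinner (blinfun_apply S y) x = cinner y (T x))"
proof -
  have "\<exists>v. \<forall>x. inner y (T x) = inner v x" for y
    by (rule riesz_real) (intro bounded_linear_intros)
  then obtain s where s: "\<And>x y. inner (s y) x = inner y (T x)" by metis
  have cs: "cinner (s y) x = cinner y (T x)" for x y
    using T by (simp add: cinner_eq_inner s bounded_ops_def)
  have "bounded_linear s"
  proof (rule bounded_linear_intro)
    show "s (x + y) = s x + s y" for x y by (rule inner_eqI) (simp add: s inner_add_left)
    show "s (r *\<^sub>R x) = r *\<^sub>R s x" for r x by (rule inner_eqI) (simp add: s)
    show "norm (s y) \<le> norm y * norm T" for y
    proof (cases "s y = 0")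
      case False
      have "norm (s y) * norm (s y) = inner y (T (s y))"
        by (simp add: s[symmetric] power2_norm_eq_inner flip: power2_eq_square)
      also have "\<dots> \<le> norm y * norm (T (s y))" by (rule norm_cauchy_schwarz)
      also have "\<dots> \<le> norm y * (norm T * norm (s y))" by (intro mult_left_mono norm_blinfun) simp
      finally show ?thesis using False by (simp flip: mult.assoc)
    qed simp
  qed
  then have S: "blinfun_apply (Blinfun s) = s" by (rule bounded_linear_Blinfun_apply)
  have "s (c *\<^sub>C y) = c *\<^sub>C s y" for c y
  proof (rule inner_eqI)
    fix x
    have "cinner (s (c *\<^sub>C y)) x = cnj c * cinner y (T x)"
      by (metis cs cinner_commute cinner_scaleC_right complex_cnj_mult)
    also have "\<dots> = cinner (c *\<^sub>C s y) x"
      by (metis cs cinner_commute cinner_scaleC_right complex_cnj_mult)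
    finally show "inner (s (c *\<^sub>C y)) x = inner (c *\<^sub>C s y) x" by (simp add: inner_eq_Re_cinner)
  qed
  then have "Blinfun s \<in> bounded_ops" by (simp add: bounded_ops_def S)
  moreover have "S' = Blinfun s" if "\<And>x y. cinner (blinfun_apply S' y) x = cinner y (T x)" for S'
    by (rule blinfun_eqI, rule inner_eqI) (simp add: S that cs inner_eq_Re_cinner)
  ultimately show ?thesis by (intro ex1I[of _ "Blinfun s"]) (auto simp: cs S)
qed

definition adj :: "('a::chilbert_space \<Rightarrow>\<^sub>L 'b::chilbert_space) \<Rightarrow> ('b \<Rightarrow>\<^sub>L 'a)" where
  "adj T = (THE S. S \<in> bounded_ops \<and> (\<forall>x y. cinner (blinfun_apply S y) x = cinner y (T x)))"

lemma adj_bounded_ops: "T \<in> bounded_ops \<Longrightarrow> adj T \<in> bounded_ops"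
  and cinner_adj: "T \<in> bounded_ops \<Longrightarrow> cinner (adj T y) x = cinner y (T x)"
  using theI'[OF ex_adj, of T] unfolding adj_def by blast+

definition unitary_op :: "('a::chilbert_space \<Rightarrow>\<^sub>L 'b::chilbert_space) \<Rightarrow> bool" where
  "unitary_op U \<longleftrightarrow> U \<in> bounded_ops \<and> adj U o\<^sub>L U = id_blinfun \<and> U o\<^sub>L adj U = id_blinfun"

definition direct_sum_op ::
  "('a::real_normed_vector \<Rightarrow>\<^sub>L 'a) \<Rightarrow> ('b::real_normed_vector \<Rightarrow>\<^sub>L 'b) \<Rightarrow> (('a \<times> 'b) \<Rightarrow>\<^sub>L ('a \<times> 'b))" where
  "direct_sum_op S T = Blinfun (\<lambda>p. (S (fst p), T (snd p)))"

lemma direct_sum_op_apply: "direct_sum_op S T (x, y) = (S x, T y)"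
proof -
  have "bounded_linear (\<lambda>p. (blinfun_apply S (fst p), blinfun_apply T (snd p)))"
    by (intro bounded_linear_intros)
  then show ?thesis by (simp add: direct_sum_op_def bounded_linear_Blinfun_apply)
qed

definition cstar_subalgebra :: "('h::chilbert_space \<Rightarrow>\<^sub>L 'h) set \<Rightarrow> bool" where
  "cstar_subalgebra A \<longleftrightarrow> A \<subseteq> bounded_ops \<and> 0 \<in> A \<and>
     (\<forall>S\<in>A. \<forall>T\<in>A. S + T \<in> A \<and> S o\<^sub>L T \<in> A) \<and> (\<forall>c. \<forall>T\<in>A. scaleC_op c T \<in> A) \<and>
     (\<forall>T\<in>A. adj T \<in> A) \<and> closed A"

definition cstar_generated :: "('h::chilbert_space \<Rightarrow>\<^sub>L 'h) set \<Rightarrow> ('h \<Rightarrow>\<^sub>L 'h) set" where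
  "cstar_generated G = \<Inter>{A. cstar_subalgebra A \<and> G \<subseteq> A}"


section \<open>Partial translation algebras\<close>

text \<open>A type of this class stands for a subset of the integers, included by \<open>incl\<close>.\<close>

class int_subset =
  fixes incl :: "'a \<Rightarrow> int"
  assumes inj_incl: "inj incl"

instantiation int :: int_subset
begin
definition incl_int :: "int \<Rightarrow> int" where "incl_int x = x"
instance by standard (simp add: incl_int_def inj_on_def)
end

typedef nonzero_int = "UNIV - {0::int}"
  by (rule exI[of _ 1]) simp

instantiation nonzero_int :: int_subset
begin
definition incl_nonzero_int :: "nonzero_int \<Rightarrow> int" where "incl_nonzero_int = Rep_nonzero_int"
instance by standard (simp add: incl_nonzero_int_def inj_on_def Rep_nonzero_int_inject)
end

lift_definition translate :: "int \<Rightarrow> 'x::int_subset ell2 \<Rightarrow> 'x ell2" is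
  "\<lambda>n f y. if incl y - n \<in> range (incl :: 'x \<Rightarrow> int) then f (inv incl (incl y - n)) else 0"
proof -
  fix n :: int and f :: "'x \<Rightarrow> complex" assume f: "square_summable f"
  let ?D = "{y::'x. incl y - n \<in> range (incl :: 'x \<Rightarrow> int)}" and ?h = "\<lambda>y::'x. inv incl (incl y - n) :: 'x"
  have "inj_on ?h ?D"
    by (rule inj_onI) (metis (mono_tags, lifting) add_diff_cancel diff_add_cancel f_inv_into_f
        inj_incl injD mem_Collect_eq)
  moreover have "(\<lambda>x. (cmod (f x))\<^sup>2) summable_on (?h ` ?D)"
    using f summable_on_subset_banach unfolding square_summable_def by blast
  ultimately have "(\<lambda>y. (cmod (f (?h y)))\<^sup>2) summable_on ?D"
    by (simp add: summable_on_reindex o_def)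
  then show "square_summable (\<lambda>y. if incl y - n \<in> range (incl :: 'x \<Rightarrow> int) then f (?h y) else 0)"
    unfolding square_summable_def
    by (rule summable_on_cong_neutral[THEN iffD1, rotated -1]) auto
qed

lemma norm_translate_le: "norm (translate n (f :: 'x::int_subset ell2)) \<le> norm f"
proof -
  let ?D = "{y::'x. incl y - n \<in> range (incl :: 'x \<Rightarrow> int)}" and ?h = "\<lambda>y::'x. inv incl (incl y - n) :: 'x"
  have inj: "inj_on ?h ?D"
    by (rule inj_onI) (metis (mono_tags, lifting) add_diff_cancel diff_add_cancel f_inv_into_f
        inj_incl injD mem_Collect_eq)
  have "(norm (translate n f))\<^sup>2 = (\<Sum>\<^sub>\<infinity>y\<in>?D. (cmod (coeff f (?h y)))\<^sup>2)"
    unfolding norm_ell2_squared translate.rep_eq by (rule infsum_cong_neutral) auto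
  also have "\<dots> = (\<Sum>\<^sub>\<infinity>x\<in>?h ` ?D. (cmod (coeff f x))\<^sup>2)"
    by (simp add: infsum_reindex[OF inj] o_def)
  also have "\<dots> \<le> (\<Sum>\<^sub>\<infinity>x. (cmod (coeff f x))\<^sup>2)"
    by (rule infsum_mono2) (auto intro: summable_on_subset_banach summable_coeff)
  finally show ?thesis
    unfolding norm_ell2_squared[symmetric] by (simp add: power2_le_iff_abs_le)
qed

lift_definition partial_translation :: "int \<Rightarrow> ('x::int_subset ell2 \<Rightarrow>\<^sub>L 'x ell2)" is translate
proof
  fix n r and f g :: "'x ell2"
  show "translate n (f + g) = translate n f + translate n g"
    by (simp add: coeff_inject[symmetric] translate.rep_eq plus_ell2.rep_eq fun_eq_iff)
  show "translate n (r *\<^sub>R f) = r *\<^sub>R translate n f"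
    by (simp add: coeff_inject[symmetric] translate.rep_eq scaleR_ell2.rep_eq fun_eq_iff)
  show "\<exists>K. \<forall>f :: 'x ell2. norm (translate n f) \<le> norm f * K"
    using norm_translate_le by (intro exI[of _ 1]) auto
qed

lemma partial_translation_ket:
  "partial_translation n (ket x) =
    (if incl x + n \<in> range (incl :: 'x \<Rightarrow> int) then ket (inv incl (incl x + n)) else (0 :: 'x::int_subset ell2))"
proof (rule coeff_inject[THEN iffD1], rule ext)
  fix y :: 'x
  have inv: "inv incl (incl z) = z" for z :: 'x by (rule inv_f_f[OF inj_incl])
  have inj: "incl a = incl b \<longleftrightarrow> a = b" for a b :: 'x by (rule inj_eq[OF inj_incl])
  have l: "coeff (partial_translation n (ket x)) y = (if incl y = incl x + n then 1 else 0)"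
  proof (cases "incl y - n \<in> range (incl :: 'x \<Rightarrow> int)")
    case True
    then obtain w :: 'x where w: "incl y - n = incl w" by blast
    then have "incl y = incl x + n \<longleftrightarrow> incl w = incl x" by linarith
    then show ?thesis
      by (simp add: partial_translation.rep_eq translate.rep_eq ket.rep_eq w inv inj)
  next
    case False
    then have "incl y - n \<noteq> incl x" by auto
    then have "incl y \<noteq> incl x + n" by linarith
    with False show ?thesis
      by (simp add: partial_translation.rep_eq translate.rep_eq)
  qed
  show "coeff (partial_translation n (ket x)) y = coeff
    (if incl x + n \<in> range (incl :: 'x \<Rightarrow> int) then ket (inv incl (incl x + n)) else (0 :: 'x ell2)) y"
  proof (cases "incl x + n \<in> range (incl :: 'x \<Rightarrow> int)")
    case True
    then obtain z :: 'x where z: "incl x + n = incl z" by blast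
    show ?thesis by (simp add: l z inv inj ket.rep_eq)
  next
    case False
    then have "incl y \<noteq> incl x + n" by (metis rangeI)
    with False show ?thesis by (simp add: l zero_ell2.rep_eq)
  qed
qed

definition partial_translation_algebra :: "('x::int_subset ell2 \<Rightarrow>\<^sub>L 'x ell2) set" where
  "partial_translation_algebra = cstar_generated (range partial_translation)"


section \<open>Square-integrable functions on the circle\<close>

text \<open>Normalised arc length, as a Borel measure on the plane concentrated on the unit circle.\<close>

definition circle_measure :: "complex measure" where
  "circle_measure = distr (uniform_measure lborel {0..2 * pi}) borel cis"

lemma sets_circle_measure [simp, measurable_cong]: "sets circle_measure = sets borel"
  by (simp add: circle_measure_def)

lemma cis_measurable [measurable]: "cis \<in> borel_measurable borel"
  by (intro borel_measurable_continuous_onI continuous_intros)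

interpretation circle: prob_space circle_measure
proof -
  interpret U: prob_space "uniform_measure lborel {0..2 * pi}"
    by (rule prob_space_uniform_measure) auto
  show "prob_space circle_measure"
    unfolding circle_measure_def by (rule U.prob_space_distr) simp
qed

lemma AE_circle: "AE z in circle_measure. cmod z = 1"
  unfolding circle_measure_def by (subst AE_distr_iff) auto

definition square_integrable :: "(complex \<Rightarrow> complex) \<Rightarrow> bool" where
  "square_integrable f \<longleftrightarrow>
     f \<in> borel_measurable borel \<and> integrable circle_measure (\<lambda>z. (cmod (f z))\<^sup>2)"

lemma square_integrable_add:
  assumes "square_integrable f" "square_integrable g" shows "square_integrable (\<lambda>z. f z + g z)"
proof -
  have [measurable]: "f \<in> borel_measurable borel" "g \<in> borel_measurable borel"
    using assms by (auto simp: square_integrable_def)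
  have "integrable circle_measure (\<lambda>z. (cmod (f z + g z))\<^sup>2)"
  proof (rule Bochner_Integration.integrable_bound)
    show "integrable circle_measure (\<lambda>z. 2 * (cmod (f z))\<^sup>2 + 2 * (cmod (g z))\<^sup>2)"
      using assms by (auto simp: square_integrable_def)
  qed (auto simp: cmod_add_squared_le)
  then show ?thesis by (simp add: square_integrable_def)
qed

lemma square_integrable_mult_bounded:
  assumes "square_integrable f" and [measurable]: "b \<in> borel_measurable borel"
    and B: "\<And>z. cmod z = 1 \<Longrightarrow> cmod (b z) \<le> B"
  shows "square_integrable (\<lambda>z. b z * f z)"
proof -
  have [measurable]: "f \<in> borel_measurable borel" using assms by (auto simp: square_integrable_def)
  have "integrable circle_measure (\<lambda>z. (cmod (b z * f z))\<^sup>2)"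
  proof (rule Bochner_Integration.integrable_bound)
    show "integrable circle_measure (\<lambda>z. B\<^sup>2 * (cmod (f z))\<^sup>2)"
      using assms by (auto simp: square_integrable_def)
    show "AE z in circle_measure. norm ((cmod (b z * f z))\<^sup>2) \<le> norm (B\<^sup>2 * (cmod (f z))\<^sup>2)"
      using AE_circle
    proof eventually_elim
      case (elim z)
      have "(cmod (b z))\<^sup>2 \<le> B\<^sup>2" using B[OF elim] by (simp add: power_mono)
      then show ?case by (simp add: norm_mult power_mult_distrib mult_right_mono)
    qed
  qed auto
  then show ?thesis using assms by (simp add: square_integrable_def)
qed

lemma square_integrable_scale:
  assumes "square_integrable f" shows "square_integrable (\<lambda>z. c * f z)"
  using square_integrable_mult_bounded[OF assms, of "\<lambda>_. c" "cmod c"] by simp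

lemma integrable_cnj_mult:
  assumes "square_integrable f" "square_integrable g"
  shows "integrable circle_measure (\<lambda>z. cnj (f z) * g z)"
proof (rule Bochner_Integration.integrable_bound)
  have [measurable]: "f \<in> borel_measurable borel" "g \<in> borel_measurable borel"
    using assms by (auto simp: square_integrable_def)
  show "integrable circle_measure (\<lambda>z. (cmod (f z))\<^sup>2 + (cmod (g z))\<^sup>2)"
    using assms by (auto simp: square_integrable_def)
  have "cnj \<in> borel_measurable borel" by (intro borel_measurable_continuous_onI continuous_intros)
  then show "(\<lambda>z. cnj (f z) * g z) \<in> borel_measurable circle_measure" by measurable
  show "AE z in circle_measure. cmod (cnj (f z) * g z) \<le> norm ((cmod (f z))\<^sup>2 + (cmod (g z))\<^sup>2)"
    using cmod_mult_le_squares[of "cnj (f _)" "g _"] by simp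
qed

lemma integral_cnj_self:
  "(LINT z|circle_measure. cnj (f z) * f z) = complex_of_real (LINT z|circle_measure. (cmod (f z))\<^sup>2)"
  unfolding integral_complex_of_real[symmetric]
  by (rule Bochner_Integration.integral_cong) (simp_all only: complex_norm_square mult.commute[of "cnj _"])

definition L2_eq :: "(complex \<Rightarrow> complex) \<Rightarrow> (complex \<Rightarrow> complex) \<Rightarrow> bool" where
  "L2_eq f g \<longleftrightarrow> square_integrable f \<and> square_integrable g \<and> (AE z in circle_measure. f z = g z)"

quotient_type circle_L2 = "complex \<Rightarrow> complex" / partial: L2_eq
proof (rule part_equivpI)
  show "\<exists>f. L2_eq f f"
    by (rule exI[of _ "\<lambda>_. 0"]) (simp add: L2_eq_def square_integrable_def)
  show "symp L2_eq" by (auto simp: symp_def L2_eq_def)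
  show "transp L2_eq" unfolding transp_def L2_eq_def by auto
qed

instantiation circle_L2 :: complex_inner
begin

lift_definition zero_circle_L2 :: circle_L2 is "\<lambda>_. 0"
  by (simp add: L2_eq_def square_integrable_def)
lift_definition plus_circle_L2 :: "circle_L2 \<Rightarrow> circle_L2 \<Rightarrow> circle_L2" is "\<lambda>f g z. f z + g z"
  by (auto simp: L2_eq_def square_integrable_add)
lift_definition uminus_circle_L2 :: "circle_L2 \<Rightarrow> circle_L2" is "\<lambda>f z. - f z"
  by (auto simp: L2_eq_def square_integrable_def)
lift_definition minus_circle_L2 :: "circle_L2 \<Rightarrow> circle_L2 \<Rightarrow> circle_L2" is "\<lambda>f g z. f z - g z"
  using square_integrable_add[of _ "\<lambda>z. (-1) * _ z"] square_integrable_scale[of _ "-1"]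
  by (auto simp: L2_eq_def)
lift_definition scaleC_circle_L2 :: "complex \<Rightarrow> circle_L2 \<Rightarrow> circle_L2" is "\<lambda>c f z. c * f z"
  by (auto simp: L2_eq_def square_integrable_scale)
lift_definition scaleR_circle_L2 :: "real \<Rightarrow> circle_L2 \<Rightarrow> circle_L2" is
  "\<lambda>r f z. complex_of_real r * f z"
  by (auto simp: L2_eq_def square_integrable_scale)
lift_definition cinner_circle_L2 :: "circle_L2 \<Rightarrow> circle_L2 \<Rightarrow> complex" is
  "\<lambda>f g. LINT z|circle_measure. cnj (f z) * g z"
proof -
  fix f f' g g' assume *: "L2_eq f f'" "L2_eq g g'"
  then have "integrable circle_measure (\<lambda>z. cnj (f z) * g z)"
    "integrable circle_measure (\<lambda>z. cnj (f' z) * g' z)"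
    by (auto simp: L2_eq_def intro: integrable_cnj_mult)
  with * show "(LINT z|circle_measure. cnj (f z) * g z) = (LINT z|circle_measure. cnj (f' z) * g' z)"
    by (intro integral_cong_AE) (auto simp: L2_eq_def)
qed

definition inner_circle_L2 :: "circle_L2 \<Rightarrow> circle_L2 \<Rightarrow> real" where
  "inner_circle_L2 x y = Re (cinner x y)"
definition norm_circle_L2 :: "circle_L2 \<Rightarrow> real" where "norm_circle_L2 x = sqrt (inner x x)"
definition dist_circle_L2 :: "circle_L2 \<Rightarrow> circle_L2 \<Rightarrow> real" where
  "dist_circle_L2 x y = norm (x - y)"
definition sgn_circle_L2 :: "circle_L2 \<Rightarrow> circle_L2" where
  "sgn_circle_L2 x = inverse (norm x) *\<^sub>R x"
definition uniformity_circle_L2 :: "(circle_L2 \<times> circle_L2) filter" where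
  "uniformity_circle_L2 = (INF e\<in>{0<..}. principal {(x, y). dist x y < e})"
definition open_circle_L2 :: "circle_L2 set \<Rightarrow> bool" where
  "open_circle_L2 U = (\<forall>x\<in>U. \<forall>\<^sub>F (x', y) in uniformity. x' = x \<longrightarrow> y \<in> U)"

instance
proof
  fix x y z :: circle_L2 and a b :: real and c d :: complex
  have eqI: "L2_eq f g" if "square_integrable f" "f = g" for f g
    using that by (simp add: L2_eq_def)
  note closed_rules = square_integrable_add square_integrable_scale
    square_integrable_scale[of _ "-1", simplified]
  show "x + y + z = x + (y + z)" "x + y = y + x" "0 + x = x" "- x + x = 0"
    by (transfer; auto simp: L2_eq_def algebra_simps intro!: closed_rules; simp add: square_integrable_def)+
  show "x - y = x + - y"
    by transfer (use square_integrable_add[of _ "\<lambda>z. (-1) * _ z"] square_integrable_scale[of _ "-1"]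
      in \<open>auto simp: L2_eq_def\<close>)
  show "a *\<^sub>R (x + y) = a *\<^sub>R x + a *\<^sub>R y" "(a + b) *\<^sub>R x = a *\<^sub>R x + b *\<^sub>R x"
    "a *\<^sub>R b *\<^sub>R x = (a * b) *\<^sub>R x" "1 *\<^sub>R x = x"
    "c *\<^sub>C (x + y) = c *\<^sub>C x + c *\<^sub>C y" "(c + d) *\<^sub>C x = c *\<^sub>C x + d *\<^sub>C x"
    "c *\<^sub>C d *\<^sub>C x = (c * d) *\<^sub>C x" "complex_of_real a *\<^sub>C x = a *\<^sub>R x"
    by (transfer; intro eqI; (intro closed_rules)?; auto simp: L2_eq_def algebra_simps)+
  show "sgn x = inverse (norm x) *\<^sub>R x" by (rule sgn_circle_L2_def)
  show "dist x y = norm (x - y)" by (rule dist_circle_L2_def)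
  show "uniformity = (INF e\<in>{0<..}. principal {(x, y :: circle_L2). dist x y < e})"
    by (rule uniformity_circle_L2_def)
  show "open U = (\<forall>x\<in>U. \<forall>\<^sub>F (x', y) in uniformity. x' = x \<longrightarrow> y \<in> U)" for U :: "circle_L2 set"
    by (rule open_circle_L2_def)
  show add: "cinner x (y + z) = cinner x y + cinner x z" for x y z :: circle_L2
    by transfer (simp add: distrib_left integrable_cnj_mult L2_eq_def)
  show scale: "cinner x (c *\<^sub>C y) = c * cinner x y" for x y :: circle_L2 and c
    by transfer (simp add: mult.left_commute)
  show comm: "cinner x y = cnj (cinner y x)" for x y :: circle_L2
    proof transfer
    fix f g assume "L2_eq f f" "L2_eq g g"
    then have "integrable circle_measure (\<lambda>z. cnj (g z) * f z)"
      by (auto simp: L2_eq_def intro: integrable_cnj_mult)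
    from integral_bounded_linear[OF bounded_linear_cnj this]
    show "(LINT z|circle_measure. cnj (f z) * g z) = cnj (LINT z|circle_measure. cnj (g z) * f z)"
      by (simp add: mult.commute)
  qed
  show Re: "inner x y = Re (cinner x y)" for x y :: circle_L2 by (rule inner_circle_L2_def)
  show inner_comm: "inner x y = inner y x" for x y :: circle_L2
    unfolding Re by (subst comm) simp
  have scaleRC: "a *\<^sub>R x = complex_of_real a *\<^sub>C x" for x :: circle_L2
    by transfer (simp add: L2_eq_def square_integrable_scale)
  show "inner (x + y) z = inner x z + inner y z"
    unfolding inner_comm[of _ z] by (simp add: Re add)
  show "inner (a *\<^sub>R x) y = a * inner x y"
    unfolding inner_comm[of _ y] by (simp add: Re scale scaleRC)
  show "0 \<le> inner x x" unfolding Re by transfer (simp add: integral_cnj_self)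
  show "inner x x = 0 \<longleftrightarrow> x = 0"
    unfolding Re
  proof transfer
    fix f assume "L2_eq f f"
    then have f: "square_integrable f" and [measurable]: "f \<in> borel_measurable borel"
      by (auto simp: L2_eq_def square_integrable_def)
    have "Re (LINT z|circle_measure. cnj (f z) * f z) = 0 \<longleftrightarrow>
        (AE z in circle_measure. (cmod (f z))\<^sup>2 = 0)"
      unfolding integral_cnj_self Re_complex_of_real
      by (rule integral_nonneg_eq_0_iff_AE) (use f in \<open>auto simp: square_integrable_def\<close>)
    then show "Re (LINT z|circle_measure. cnj (f z) * f z) = 0 \<longleftrightarrow> L2_eq f (\<lambda>_. 0)"
      using f by (simp add: L2_eq_def square_integrable_def)
  qed
  show "norm x = sqrt (inner x x)" by (rule norm_circle_L2_def)
qed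

end

lemma norm_abs_circle_L2:
  assumes "square_integrable f"
  shows "(norm (abs_circle_L2 f))\<^sup>2 = (LINT z|circle_measure. (cmod (f z))\<^sup>2)"
proof -
  have "cinner (abs_circle_L2 f) (abs_circle_L2 f) = (LINT z|circle_measure. cnj (f z) * f z)"
    using assms by (intro cinner_circle_L2.abs_eq) (auto simp: eq_onp_def L2_eq_def)
  then have "complex_of_real ((norm (abs_circle_L2 f))\<^sup>2) =
      complex_of_real (LINT z|circle_measure. (cmod (f z))\<^sup>2)"
    by (simp only: cinner_self integral_cnj_self)
  then show ?thesis using of_real_eq_iff by blast
qed

lemma minus_abs_circle_L2:
  assumes "square_integrable f" "square_integrable g"
  shows "abs_circle_L2 f - abs_circle_L2 g = abs_circle_L2 (\<lambda>z. f z - g z)"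
  using assms by (intro minus_circle_L2.abs_eq) (auto simp: eq_onp_def L2_eq_def)

lemma square_integrable_diff:
  assumes "square_integrable f" "square_integrable g" shows "square_integrable (\<lambda>z. f z - g z)"
  using square_integrable_add[OF assms(1) square_integrable_scale[OF assms(2), of "-1"]] by simp

lemma nn_integral_diff_circle_L2:
  assumes "square_integrable f" "square_integrable g"
  shows "(\<integral>\<^sup>+z. ennreal ((cmod (f z - g z))\<^sup>2) \<partial>circle_measure) =
    ennreal ((dist (abs_circle_L2 f) (abs_circle_L2 g))\<^sup>2)"
  unfolding dist_norm minus_abs_circle_L2[OF assms] norm_abs_circle_L2[OF square_integrable_diff[OF assms]]
  by (rule nn_integral_eq_integral)
    (use square_integrable_diff[OF assms] in \<open>auto simp: square_integrable_def\<close>)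

lemma ex_rep_circle_L2: "\<exists>f. square_integrable f \<and> abs_circle_L2 f = x"
  using Quotient_rep_reflp[OF Quotient_circle_L2, of x] Quotient_abs_rep[OF Quotient_circle_L2, of x]
  by (auto simp: L2_eq_def)

instance circle_L2 :: chilbert_space
proof
  fix X :: "nat \<Rightarrow> circle_L2" assume X: "Cauchy X"
  have "\<exists>r :: nat \<Rightarrow> nat. \<forall>n. (\<forall>m\<ge>r n. dist (X (r n)) (X m) < (1/2) ^ n) \<and> r n < r (Suc n)"
  proof (rule dependent_nat_choice)
    have ex: "\<exists>N. \<forall>n\<ge>N. \<forall>m\<ge>n. dist (X n) (X m) < (1/2) ^ k" for k :: nat
      using metric_CauchyD[OF X, of "(1/2) ^ k"] by (metis le_trans zero_less_divide_1_iff
          zero_less_numeral zero_less_power)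
    show "\<exists>x. \<forall>m\<ge>x. dist (X x) (X m) < (1/2) ^ 0" using ex[of 0] by blast
    show "\<exists>y. (\<forall>m\<ge>y. dist (X y) (X m) < (1/2) ^ Suc n) \<and> x < y" for x n
    proof -
      obtain N where "\<forall>n'\<ge>N. \<forall>m\<ge>n'. dist (X n') (X m) < (1/2) ^ Suc n" using ex by blast
      then show ?thesis by (intro exI[of _ "max N (Suc x)"]) auto
    qed
  qed
  then obtain r where r: "\<And>n m. m \<ge> r n \<Longrightarrow> dist (X (r n)) (X m) < (1/2) ^ n"
    and r_Suc: "\<And>n. r n < r (Suc n)" by blast
  have mono: "strict_mono r" using r_Suc by (simp add: strict_mono_Suc_iff)
  have "\<forall>k. \<exists>f. square_integrable f \<and> abs_circle_L2 f = X (r k)" by (simp add: ex_rep_circle_L2)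
  then obtain f where f: "\<And>k. square_integrable (f k)" and f_abs: "\<And>k. abs_circle_L2 (f k) = X (r k)"
    by metis
  have [measurable]: "f k \<in> borel_measurable borel" for k
    using f by (simp add: square_integrable_def)
  have close: "dist (X (r k)) (X (r m)) < (1/2) ^ k" if "k \<le> m" for k m
    using r strict_mono_less_eq[OF mono] that by simp
  define d where "d k z = cmod (f (Suc k) z - f k z)" for k z
  have [measurable]: "d k \<in> borel_measurable borel" for k
    unfolding d_def by measurable
  have d_int: "(\<integral>\<^sup>+z. ennreal (d k z) \<partial>circle_measure) \<le> ennreal (2 * (1/2) ^ k)" for k
  proof -
    have pt: "d k z \<le> 2 ^ k * (d k z)\<^sup>2 + (1/2) ^ k" for z
    proof (cases "2 ^ k * d k z \<le> 1")
      case True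
      have "0 \<le> 2 ^ k * (d k z)\<^sup>2" by simp
      moreover have "d k z \<le> (1/2) ^ k"
        using True by (simp add: power_divide field_simps)
      ultimately show ?thesis by linarith
    next
      case False
      have "1 * d k z \<le> (2 ^ k * d k z) * d k z"
        using False by (intro mult_right_mono) (auto simp: d_def)
      moreover have "0 \<le> (1/2 :: real) ^ k" by simp
      ultimately show ?thesis unfolding power2_eq_square mult.assoc by linarith
    qed
    have "(\<integral>\<^sup>+z. ennreal (d k z) \<partial>circle_measure)
        \<le> (\<integral>\<^sup>+z. ennreal (2 ^ k) * ennreal ((d k z)\<^sup>2) + ennreal ((1/2) ^ k) \<partial>circle_measure)"
      using pt by (intro nn_integral_mono) (simp flip: ennreal_mult ennreal_plus)
    also have "\<dots> = ennreal (2 ^ k) * (\<integral>\<^sup>+z. ennreal ((d k z)\<^sup>2) \<partial>circle_measure) + ennreal ((1/2) ^ k)"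
      by (simp add: nn_integral_add nn_integral_cmult circle.emeasure_space_1)
    also have "(\<integral>\<^sup>+z. ennreal ((d k z)\<^sup>2) \<partial>circle_measure) = ennreal ((dist (X (r (Suc k))) (X (r k)))\<^sup>2)"
      unfolding d_def nn_integral_diff_circle_L2[OF f f] f_abs ..
    also have "ennreal (2 ^ k) * ennreal ((dist (X (r (Suc k))) (X (r k)))\<^sup>2) + ennreal ((1/2) ^ k)
        \<le> ennreal (2 * (1/2) ^ k)"
    proof -
      have "(dist (X (r (Suc k))) (X (r k)))\<^sup>2 \<le> ((1/2) ^ k)\<^sup>2"
        using close[of k "Suc k"] by (intro power_mono) (auto simp: dist_commute)
      then have "2 ^ k * (dist (X (r (Suc k))) (X (r k)))\<^sup>2 \<le> 2 ^ k * ((1/2) ^ k)\<^sup>2"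
        by (intro mult_left_mono) auto
      also have "\<dots> = (1/2 :: real) ^ k"
        by (simp add: power2_eq_square power_divide)
      finally have "2 ^ k * (dist (X (r (Suc k))) (X (r k)))\<^sup>2 + (1/2) ^ k \<le> 2 * (1/2) ^ k" by simp
      then show ?thesis by (simp add: ennreal_leI flip: ennreal_mult ennreal_plus)
    qed
    finally show ?thesis .
  qed
  have "(\<integral>\<^sup>+z. (\<Sum>k. ennreal (d k z)) \<partial>circle_measure) \<le> (\<Sum>k. ennreal (2 * (1/2) ^ k))"
    by (subst nn_integral_suminf) (auto intro!: suminf_le d_int)
  also have "(\<Sum>k. ennreal (2 * (1/2) ^ k)) = ennreal (\<Sum>k. 2 * (1/2) ^ k)"
    by (intro suminf_ennreal2 summable_mult summable_geometric) auto
  also have "\<dots> < \<infinity>" by simp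
  finally have "AE z in circle_measure. (\<Sum>k. ennreal (d k z)) \<noteq> \<infinity>"
    by (intro nn_integral_noteq_infinite) auto
  then have AE_conv: "AE z in circle_measure. (\<lambda>k. f k z) \<longlonglongrightarrow> lim (\<lambda>k. f k z)"
  proof eventually_elim
    case (elim z)
    have "summable (\<lambda>k. d k z)"
      by (rule summable_suminf_not_top) (use elim in \<open>auto simp: d_def\<close>)
    then have "summable (\<lambda>k. f (Suc k) z - f k z)"
      unfolding d_def by (rule summable_norm_cancel)
    then have "convergent (\<lambda>n. f 0 z + (\<Sum>k<n. f (Suc k) z - f k z))"
      by (intro convergent_add convergent_const) (simp add: summable_iff_convergent)
    then show ?case
      using sum_lessThan_telescope[of "\<lambda>k. f k z"] by (simp add: convergent_LIMSEQ_iff)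
  qed
  define g where "g z = lim (\<lambda>k. f k z)" for z
  have [measurable]: "g \<in> borel_measurable borel"
    unfolding g_def by (rule borel_measurable_lim_metric) simp
  have fatou: "(\<integral>\<^sup>+z. ennreal ((cmod (f k z - g z))\<^sup>2) \<partial>circle_measure) \<le> ennreal (((1/2) ^ k)\<^sup>2)" for k
  proof -
    have "(\<integral>\<^sup>+z. ennreal ((cmod (f k z - g z))\<^sup>2) \<partial>circle_measure)
        = (\<integral>\<^sup>+z. liminf (\<lambda>m. ennreal ((cmod (f k z - f m z))\<^sup>2)) \<partial>circle_measure)"
    proof (rule nn_integral_cong_AE)
      show "AE z in circle_measure. ennreal ((cmod (f k z - g z))\<^sup>2) =
          liminf (\<lambda>m. ennreal ((cmod (f k z - f m z))\<^sup>2))"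
        using AE_conv
      proof eventually_elim
        case (elim z)
        have "(\<lambda>m. ennreal ((cmod (f k z - f m z))\<^sup>2)) \<longlonglongrightarrow> ennreal ((cmod (f k z - g z))\<^sup>2)"
          using elim unfolding g_def
          by (intro tendsto_ennrealI tendsto_power tendsto_norm tendsto_diff tendsto_const)
        then show ?case by (rule lim_imp_Liminf[symmetric, rotated]) simp
      qed
    qed
    also have "\<dots> \<le> liminf (\<lambda>m. \<integral>\<^sup>+z. ennreal ((cmod (f k z - f m z))\<^sup>2) \<partial>circle_measure)"
      by (rule nn_integral_liminf) measurable
    also have "\<dots> \<le> ennreal (((1/2) ^ k)\<^sup>2)"
    proof (rule Liminf_le)
      show "\<forall>\<^sub>F m in sequentially.
          (\<integral>\<^sup>+z. ennreal ((cmod (f k z - f m z))\<^sup>2) \<partial>circle_measure) \<le> ennreal (((1/2) ^ k)\<^sup>2)"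
        unfolding nn_integral_diff_circle_L2[OF f f] f_abs eventually_sequentially
        using close by (intro exI[of _ k] allI impI ennreal_leI power_mono) (auto intro: less_imp_le)
    qed simp
    finally show ?thesis .
  qed
  have diff: "square_integrable (\<lambda>z. f k z - g z)" for k
  proof -
    have "integrable circle_measure (\<lambda>z. (cmod (f k z - g z))\<^sup>2)"
      by (rule integrableI_bounded) (use fatou[of k] in \<open>auto intro: le_less_trans\<close>)
    then show ?thesis by (simp add: square_integrable_def)
  qed
  have g: "square_integrable g"
    using square_integrable_diff[OF f[of 0] diff[of 0]] by simp
  have "dist (X (r k)) (abs_circle_L2 g) \<le> (1/2) ^ k" for k
  proof -
    have "ennreal ((dist (X (r k)) (abs_circle_L2 g))\<^sup>2) \<le> ennreal (((1/2) ^ k)\<^sup>2)"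
      using fatou[of k] nn_integral_diff_circle_L2[OF f g] by (simp add: f_abs)
    then have "(dist (X (r k)) (abs_circle_L2 g))\<^sup>2 \<le> ((1/2) ^ k)\<^sup>2" by (simp add: ennreal_le_iff)
    then show ?thesis by (rule power2_le_imp_le) simp
  qed
  then have "(\<lambda>k. dist (X (r k)) (abs_circle_L2 g)) \<longlonglongrightarrow> 0"
    by (intro tendsto_sandwich[OF _ _ tendsto_const LIMSEQ_power_zero[of "1/2 :: real"]])
      (auto intro: always_eventually)
  then have "(X \<circ> r) \<longlonglongrightarrow> abs_circle_L2 g" by (simp add: o_def tendsto_dist_iff[of _ "abs_circle_L2 g"])
  then have "X \<longlonglongrightarrow> abs_circle_L2 g" by (rule Cauchy_converges_subseq[OF X mono])
  then show "convergent X" by (auto simp: convergent_def)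
qed


section \<open>Toeplitz operators on the Hardy space\<close>

text \<open>Continuous functions on the unit circle are represented by their extension by zero.\<close>

definition circle_continuous :: "(complex \<Rightarrow> complex) set" where
  "circle_continuous = {f. continuous_on (sphere 0 1) f \<and> (\<forall>z. z \<notin> sphere 0 1 \<longrightarrow> f z = 0)}"

definition circle_id :: "complex \<Rightarrow> complex" where
  "circle_id z = (if z \<in> sphere 0 1 then z else 0)"

lemma circle_id_continuous: "circle_id \<in> circle_continuous"
proof -
  have "continuous_on (sphere 0 1) circle_id \<longleftrightarrow> continuous_on (sphere 0 1 :: complex set) (\<lambda>z. z)"
    by (rule continuous_on_cong) (auto simp: circle_id_def)
  then show ?thesis by (simp add: circle_continuous_def circle_id_def)
qed

lemma circle_continuous_measurable:
  assumes "f \<in> circle_continuous" shows "f \<in> borel_measurable borel"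
proof -
  have "(\<lambda>z. if z \<in> sphere 0 1 then f z else 0) \<in> borel_measurable borel"
    using assms by (intro borel_measurable_continuous_on_if) (auto simp: circle_continuous_def)
  moreover have "(\<lambda>z. if z \<in> sphere 0 1 then f z else 0) = f"
    using assms by (auto simp: circle_continuous_def fun_eq_iff)
  ultimately show ?thesis by simp
qed

lemma circle_continuous_bounded:
  assumes "f \<in> circle_continuous" obtains B where "\<And>z. cmod z = 1 \<Longrightarrow> cmod (f z) \<le> B"
proof -
  have "compact (f ` sphere 0 1)"
    using assms by (intro compact_continuous_image) (auto simp: circle_continuous_def)
  then have "bounded (f ` sphere 0 1)" by (rule compact_imp_bounded)
  then obtain B where B: "\<forall>z\<in>sphere 0 1. cmod (f z) \<le> B" by (auto simp: bounded_iff)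
  show ?thesis by (rule that[of B]) (use B in simp)
qed

lift_definition circle_mult :: "(complex \<Rightarrow> complex) \<Rightarrow> circle_L2 \<Rightarrow> circle_L2" is
  "\<lambda>f g. if f \<in> circle_continuous then (\<lambda>z. f z * g z) else (\<lambda>_. 0)"
proof -
  fix f g g' assume g: "L2_eq g g'"
  show "L2_eq (if f \<in> circle_continuous then \<lambda>z. f z * g z else (\<lambda>_. 0))
    (if f \<in> circle_continuous then \<lambda>z. f z * g' z else (\<lambda>_. 0))"
  proof (cases "f \<in> circle_continuous")
    case True
    then obtain B where B: "\<And>z. cmod z = 1 \<Longrightarrow> cmod (f z) \<le> B"
      using circle_continuous_bounded by blast
    have "square_integrable (\<lambda>z. f z * h z)" if "square_integrable h" for h
      using that circle_continuous_measurable[OF True] B by (rule square_integrable_mult_bounded)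
    with True g show ?thesis by (auto simp: L2_eq_def)
  qed (simp add: L2_eq_def square_integrable_def)
qed

lift_definition circle_monomial :: "nat \<Rightarrow> circle_L2" is "\<lambda>n z. z ^ n"
proof -
  fix n
  have "square_integrable (\<lambda>z. z ^ n * 1)"
    by (rule square_integrable_mult_bounded[of _ _ 1]) (auto simp: square_integrable_def norm_power)
  then show "L2_eq (\<lambda>z. z ^ n) (\<lambda>z. z ^ n)" by (simp add: L2_eq_def)
qed

lemma bounded_linear_scaleC: "bounded_linear (\<lambda>x :: 'a::complex_inner. c *\<^sub>C x)"
proof (rule bounded_linear_intro)
  show "c *\<^sub>C (x + y) = c *\<^sub>C x + c *\<^sub>C y" for x y :: 'a by (rule scaleC_add_right)
  show "c *\<^sub>C (r *\<^sub>R x) = r *\<^sub>R c *\<^sub>C x" for r and x :: 'a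
    by (metis mult.commute scaleC_of_real scaleC_scaleC)
  show "norm (c *\<^sub>C x) \<le> norm x * cmod c" for x :: 'a by (simp add: norm_scaleC)
qed

definition hardy_subspace :: "circle_L2 set" where
  "hardy_subspace = closure (complex_vector.span (range circle_monomial))"

lemma hardy_subspace_add:
  assumes "x \<in> hardy_subspace" "y \<in> hardy_subspace" shows "x + y \<in> hardy_subspace"
proof -
  obtain u v where "\<And>n. u n \<in> complex_vector.span (range circle_monomial)" "u \<longlonglongrightarrow> x"
    "\<And>n. v n \<in> complex_vector.span (range circle_monomial)" "v \<longlonglongrightarrow> y"
    using assms unfolding hardy_subspace_def closure_sequential by blast
  then show ?thesis unfolding hardy_subspace_def closure_sequential
    by (intro exI[of _ "\<lambda>n. u n + v n"]) (auto intro: tendsto_add complex_vector.span_add)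
qed

lemma hardy_subspace_scaleC:
  assumes "x \<in> hardy_subspace" shows "c *\<^sub>C x \<in> hardy_subspace"
proof -
  obtain u where "\<And>n. u n \<in> complex_vector.span (range circle_monomial)" "u \<longlonglongrightarrow> x"
    using assms unfolding hardy_subspace_def closure_sequential by blast
  then show ?thesis unfolding hardy_subspace_def closure_sequential
    by (intro exI[of _ "\<lambda>n. c *\<^sub>C u n"])
      (auto intro: bounded_linear.tendsto[OF bounded_linear_scaleC] complex_vector.span_scale)
qed

lemma hardy_subspace_zero: "0 \<in> hardy_subspace"
  unfolding hardy_subspace_def using closure_subset complex_vector.span_zero by blast

typedef hardy = hardy_subspace
  using hardy_subspace_zero by blast

setup_lifting type_definition_hardy

instantiation hardy :: complex_inner
begin

lift_definition zero_hardy :: hardy is 0 by (rule hardy_subspace_zero)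
lift_definition plus_hardy :: "hardy \<Rightarrow> hardy \<Rightarrow> hardy" is "(+)" by (rule hardy_subspace_add)
lift_definition uminus_hardy :: "hardy \<Rightarrow> hardy" is uminus
  using hardy_subspace_scaleC[of _ "-1"] by (simp add: scaleC_one)
lift_definition minus_hardy :: "hardy \<Rightarrow> hardy \<Rightarrow> hardy" is "(-)"
  using hardy_subspace_add[OF _ hardy_subspace_scaleC[of _ "-1"]] by (simp add: scaleC_one)
lift_definition scaleC_hardy :: "complex \<Rightarrow> hardy \<Rightarrow> hardy" is scaleC
  by (rule hardy_subspace_scaleC)
lift_definition scaleR_hardy :: "real \<Rightarrow> hardy \<Rightarrow> hardy" is scaleR
  by (simp add: hardy_subspace_scaleC flip: scaleC_of_real)
lift_definition cinner_hardy :: "hardy \<Rightarrow> hardy \<Rightarrow> complex" is cinner .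
lift_definition inner_hardy :: "hardy \<Rightarrow> hardy \<Rightarrow> real" is inner .
lift_definition norm_hardy :: "hardy \<Rightarrow> real" is norm .
lift_definition dist_hardy :: "hardy \<Rightarrow> hardy \<Rightarrow> real" is dist .

definition sgn_hardy :: "hardy \<Rightarrow> hardy" where "sgn_hardy x = inverse (norm x) *\<^sub>R x"
definition uniformity_hardy :: "(hardy \<times> hardy) filter" where
  "uniformity_hardy = (INF e\<in>{0<..}. principal {(x, y). dist x y < e})"
definition open_hardy :: "hardy set \<Rightarrow> bool" where
  "open_hardy U = (\<forall>x\<in>U. \<forall>\<^sub>F (x', y) in uniformity. x' = x \<longrightarrow> y \<in> U)"

instance
proof
  fix x y z :: hardy and a b :: real and c d :: complex
  show "x + y + z = x + (y + z)" "x + y = y + x" "0 + x = x" "- x + x = 0" "x - y = x + - y"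
    "a *\<^sub>R (x + y) = a *\<^sub>R x + a *\<^sub>R y" "(a + b) *\<^sub>R x = a *\<^sub>R x + b *\<^sub>R x"
    "a *\<^sub>R b *\<^sub>R x = (a * b) *\<^sub>R x" "1 *\<^sub>R x = x"
    by (transfer; simp add: algebra_simps)+
  show "c *\<^sub>C (x + y) = c *\<^sub>C x + c *\<^sub>C y" by transfer (rule scaleC_add_right)
  show "(c + d) *\<^sub>C x = c *\<^sub>C x + d *\<^sub>C x" by transfer (rule scaleC_add_left)
  show "c *\<^sub>C d *\<^sub>C x = (c * d) *\<^sub>C x" by transfer (rule scaleC_scaleC)
  show "complex_of_real a *\<^sub>C x = a *\<^sub>R x" by transfer (rule scaleC_of_real)
  show "sgn x = inverse (norm x) *\<^sub>R x" by (rule sgn_hardy_def)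
  show "dist x y = norm (x - y)" by transfer (rule dist_norm)
  show "uniformity = (INF e\<in>{0<..}. principal {(x, y :: hardy). dist x y < e})"
    by (rule uniformity_hardy_def)
  show "open U = (\<forall>x\<in>U. \<forall>\<^sub>F (x', y) in uniformity. x' = x \<longrightarrow> y \<in> U)" for U :: "hardy set"
    by (rule open_hardy_def)
  show "cinner x (y + z) = cinner x y + cinner x z" by transfer (rule cinner_add_right)
  show "cinner x (c *\<^sub>C y) = c * cinner x y" by transfer (rule cinner_scaleC_right)
  show "cinner x y = cnj (cinner y x)" by transfer (rule cinner_commute)
  show "inner x y = Re (cinner x y)" by transfer (rule inner_eq_Re_cinner)
  show "inner x y = inner y x" by transfer (rule inner_commute)
  show "inner (x + y) z = inner x z + inner y z" by transfer (rule inner_add_left)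
  show "inner (a *\<^sub>R x) y = a * inner x y" by transfer (rule inner_scaleR_left)
  show "0 \<le> inner x x" by transfer (rule inner_ge_zero)
  show "inner x x = 0 \<longleftrightarrow> x = 0" by transfer (rule inner_eq_zero_iff)
  show "norm x = sqrt (inner x x)" by transfer (rule norm_eq_sqrt_inner)
qed

end

instance hardy :: chilbert_space
proof
  fix X :: "nat \<Rightarrow> hardy" assume "Cauchy X"
  then have "Cauchy (\<lambda>n. Rep_hardy (X n))" by (simp add: Cauchy_def dist_hardy.rep_eq)
  then have "convergent (\<lambda>n. Rep_hardy (X n))" by (rule Cauchy_convergent)
  then obtain l where l: "(\<lambda>n. Rep_hardy (X n)) \<longlonglongrightarrow> l"
    unfolding convergent_def by blast
  have "closed hardy_subspace" by (simp add: hardy_subspace_def)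
  then have "l \<in> hardy_subspace" using Rep_hardy l by (rule closed_sequentially)
  then have "(\<lambda>n. dist (X n) (Abs_hardy l)) \<longlonglongrightarrow> 0"
    using l[unfolded tendsto_dist_iff[of _ l]] by (simp add: dist_hardy.rep_eq Abs_hardy_inverse)
  then have "X \<longlonglongrightarrow> Abs_hardy l" by (rule tendsto_dist_iff[THEN iffD2])
  then show "convergent X" by (rule convergentI)
qed

text \<open>The compression to the Hardy space of multiplication by \<open>f\<close>; the orthogonal projection is
  eliminated by testing against elements of the Hardy space.\<close>

definition toeplitz_op :: "(complex \<Rightarrow> complex) \<Rightarrow> (hardy \<Rightarrow>\<^sub>L hardy)" where
  "toeplitz_op f = (THE T. T \<in> bounded_ops \<and>
     (\<forall>g h. cinner h (blinfun_apply T g) = cinner (Rep_hardy h) (circle_mult f (Rep_hardy g))))"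

lemma circle_mult_id:
  "circle_mult circle_id (x + y) = circle_mult circle_id x + circle_mult circle_id y" (is ?add)
  "circle_mult circle_id (c *\<^sub>C x) = c *\<^sub>C circle_mult circle_id x" (is ?scale)
  "cinner (circle_mult circle_id x) (circle_mult circle_id y) = cinner x y" (is ?isometric)
  "circle_mult circle_id (circle_monomial n) = circle_monomial (Suc n)" (is ?monomial)
proof -
  have si: "square_integrable (\<lambda>z. circle_id z * f z)" if "square_integrable f" for f
    by (rule square_integrable_mult_bounded[of _ _ 1])
      (use that circle_continuous_measurable[OF circle_id_continuous] in \<open>auto simp: circle_id_def\<close>)
  have AE_id: "AE z in circle_measure. circle_id z = z \<and> cnj z * z = 1"
    using AE_circle by eventually_elim (simp add: circle_id_def mult.commute[of "cnj _"] flip: complex_norm_square)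
  show ?add
  proof transfer
    fix f g assume "L2_eq f f" "L2_eq g g"
    then have "square_integrable (\<lambda>z. circle_id z * (f z + g z))"
      by (intro si square_integrable_add) (auto simp: L2_eq_def)
    then show "L2_eq (if circle_id \<in> circle_continuous then \<lambda>z. circle_id z * (f z + g z) else (\<lambda>_. 0))
      (\<lambda>z. (if circle_id \<in> circle_continuous then \<lambda>z. circle_id z * f z else (\<lambda>_. 0)) z +
           (if circle_id \<in> circle_continuous then \<lambda>z. circle_id z * g z else (\<lambda>_. 0)) z)"
      by (simp add: circle_id_continuous L2_eq_def distrib_left)
  qed
  show ?scale
  proof transfer
    fix c f assume "L2_eq f f"
    then have "square_integrable (\<lambda>z. circle_id z * (c * f z))"
      by (intro si square_integrable_scale) (auto simp: L2_eq_def)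
    then show "L2_eq (if circle_id \<in> circle_continuous then \<lambda>z. circle_id z * (c * f z) else (\<lambda>_. 0))
      (\<lambda>z. c * (if circle_id \<in> circle_continuous then \<lambda>z. circle_id z * f z else (\<lambda>_. 0)) z)"
      by (simp add: circle_id_continuous L2_eq_def mult.left_commute)
  qed
  show ?isometric
  proof transfer
    fix f g assume "L2_eq f f" "L2_eq g g"
    then have f: "square_integrable f" and g: "square_integrable g" by (auto simp: L2_eq_def)
    have "AE z in circle_measure. cnj (circle_id z * f z) * (circle_id z * g z) = cnj (f z) * g z"
      using AE_id
    proof eventually_elim
      case (elim z)
      have "cnj (circle_id z * f z) * (circle_id z * g z) =
          (cnj (circle_id z) * circle_id z) * (cnj (f z) * g z)" by (simp add: mult_ac)
      with elim show ?case by simp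
    qed
    then have "(LINT z|circle_measure. cnj (circle_id z * f z) * (circle_id z * g z)) =
        (LINT z|circle_measure. cnj (f z) * g z)"
      using integrable_cnj_mult[OF si[OF f] si[OF g]] integrable_cnj_mult[OF f g]
      by (intro integral_cong_AE) auto
    then show "(LINT z|circle_measure.
        cnj ((if circle_id \<in> circle_continuous then \<lambda>z. circle_id z * f z else (\<lambda>_. 0)) z) *
        (if circle_id \<in> circle_continuous then \<lambda>z. circle_id z * g z else (\<lambda>_. 0)) z) =
        (LINT z|circle_measure. cnj (f z) * g z)"
      by (simp only: circle_id_continuous if_True)
  qed
  have mono: "square_integrable (\<lambda>z. z ^ n)" for n
  proof -
    have "square_integrable (\<lambda>z. z ^ n * 1)"
      by (rule square_integrable_mult_bounded[of _ _ 1]) (auto simp: square_integrable_def norm_power)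
    then show ?thesis by simp
  qed
  show ?monomial
  proof transfer
    fix n
    have "AE z in circle_measure. circle_id z * z ^ n = z ^ Suc n"
      using AE_id by eventually_elim simp
    then show "L2_eq (if circle_id \<in> circle_continuous then \<lambda>z. circle_id z * z ^ n else (\<lambda>_. 0))
        (\<lambda>z. z ^ Suc n)"
      using si[OF mono] mono[of "Suc n"] by (simp add: circle_id_continuous L2_eq_def)
  qed
qed

lemma norm_circle_mult_id: "norm (circle_mult circle_id x) = norm x"
  by (simp add: norm_eq_sqrt_inner inner_eq_Re_cinner circle_mult_id(3))

lemma bounded_linear_circle_mult_id: "bounded_linear (circle_mult circle_id)"
proof (rule bounded_linear_intro[of _ 1])
  show "circle_mult circle_id (r *\<^sub>R x) = r *\<^sub>R circle_mult circle_id x" for r x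
    by (metis circle_mult_id(2) scaleC_of_real)
qed (simp_all add: circle_mult_id(1) norm_circle_mult_id)

lemma hardy_subspace_circle_mult_id:
  assumes "x \<in> hardy_subspace" shows "circle_mult circle_id x \<in> hardy_subspace"
proof -
  let ?S = "complex_vector.span (range circle_monomial)"
  have S: "circle_mult circle_id x \<in> ?S" if "x \<in> ?S" for x
    using that
  proof (induction rule: complex_vector.span_induct_alt)
    case base
    show ?case
      using bounded_linear_circle_mult_id by (simp add: linear_0 bounded_linear.linear complex_vector.span_zero)
  next
    case (step c x y)
    then obtain n where "x = circle_monomial n" by blast
    then have "circle_mult circle_id (c *\<^sub>C x + y) =
        c *\<^sub>C circle_monomial (Suc n) + circle_mult circle_id y"
      by (simp add: circle_mult_id(1,2,4))
    also have "\<dots> \<in> ?S"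
      by (intro complex_vector.span_add complex_vector.span_scale complex_vector.span_base step)
        simp
    finally show ?case .
  qed
  obtain u where "\<And>n. u n \<in> ?S" "u \<longlonglongrightarrow> x"
    using assms unfolding hardy_subspace_def closure_sequential by blast
  then show ?thesis unfolding hardy_subspace_def closure_sequential
    by (intro exI[of _ "\<lambda>n. circle_mult circle_id (u n)"])
      (auto intro: S bounded_linear.tendsto[OF bounded_linear_circle_mult_id])
qed

lemma toeplitz_op_circle_id:
  "Rep_hardy (toeplitz_op circle_id g) = circle_mult circle_id (Rep_hardy g)"
  and toeplitz_op_circle_id_bounded: "toeplitz_op circle_id \<in> bounded_ops"
proof -
  define s where "s g = Abs_hardy (circle_mult circle_id (Rep_hardy g))" for g
  have Rep_s: "Rep_hardy (s g) = circle_mult circle_id (Rep_hardy g)" for g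
    unfolding s_def by (rule Abs_hardy_inverse) (rule hardy_subspace_circle_mult_id[OF Rep_hardy])
  have "bounded_linear s"
  proof (rule bounded_linear_intro[of _ 1])
    show "s (x + y) = s x + s y" for x y
      by (simp add: Rep_hardy_inject[symmetric] Rep_s plus_hardy.rep_eq circle_mult_id(1))
    show "s (r *\<^sub>R x) = r *\<^sub>R s x" for r x
      by (simp add: Rep_hardy_inject[symmetric] Rep_s scaleR_hardy.rep_eq
          linear_cmul[OF bounded_linear.linear[OF bounded_linear_circle_mult_id]])
    show "norm (s x) \<le> norm x * 1" for x
      by (simp add: norm_hardy.rep_eq Rep_s norm_circle_mult_id)
  qed
  then have S: "blinfun_apply (Blinfun s) = s" by (rule bounded_linear_Blinfun_apply)
  let ?P = "\<lambda>T. T \<in> bounded_ops \<and> (\<forall>g h. cinner h (blinfun_apply T g) =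
    cinner (Rep_hardy h) (circle_mult circle_id (Rep_hardy g)))"
  have P: "?P (Blinfun s)"
    by (simp add: S bounded_ops_def cinner_hardy.rep_eq Rep_s)
      (simp add: Rep_hardy_inject[symmetric] Rep_s scaleC_hardy.rep_eq circle_mult_id(2))
  have "T = Blinfun s" if "?P T" for T
  proof (rule blinfun_eqI, rule inner_eqI)
    fix g h
    have "cinner h (T g) = cinner h (Blinfun s g)" using that P by simp
    then have "inner h (T g) = inner h (Blinfun s g)" by (simp add: inner_eq_Re_cinner)
    then show "inner (T g) h = inner (Blinfun s g) h" by (simp add: inner_commute)
  qed
  with P have T: "toeplitz_op circle_id = Blinfun s"
    unfolding toeplitz_op_def by (rule the_equality)
  show "Rep_hardy (toeplitz_op circle_id g) = circle_mult circle_id (Rep_hardy g)"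
    by (simp add: T S Rep_s)
  show "toeplitz_op circle_id \<in> bounded_ops" using P by (simp add: T)
qed

definition toeplitz_algebra :: "(hardy \<Rightarrow>\<^sub>L hardy) set" where
  "toeplitz_algebra = cstar_generated {toeplitz_op circle_id}"


section \<open>Extensions of the continuous functions on the circle\<close>

record 'a star_algebra =
  alg_carrier :: "'a set"
  alg_zero :: 'a
  alg_one :: 'a
  alg_add :: "'a \<Rightarrow> 'a \<Rightarrow> 'a"
  alg_mult :: "'a \<Rightarrow> 'a \<Rightarrow> 'a"
  alg_scale :: "complex \<Rightarrow> 'a \<Rightarrow> 'a"
  alg_star :: "'a \<Rightarrow> 'a"

definition op_algebra :: "('h::chilbert_space \<Rightarrow>\<^sub>L 'h) set \<Rightarrow> ('h \<Rightarrow>\<^sub>L 'h) star_algebra" where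
  "op_algebra A = \<lparr>alg_carrier = A, alg_zero = 0, alg_one = id_blinfun, alg_add = (+),
     alg_mult = (o\<^sub>L), alg_scale = scaleC_op, alg_star = adj\<rparr>"

definition circle_algebra :: "(complex \<Rightarrow> complex) star_algebra" where
  "circle_algebra = \<lparr>alg_carrier = circle_continuous, alg_zero = (\<lambda>z. 0),
     alg_one = (\<lambda>z. if z \<in> sphere 0 1 then 1 else 0), alg_add = (\<lambda>f g z. f z + g z),
     alg_mult = (\<lambda>f g z. f z * g z), alg_scale = (\<lambda>c f z. c * f z), alg_star = (\<lambda>f z. cnj (f z))\<rparr>"

definition unital_star_hom :: "'a star_algebra \<Rightarrow> 'b star_algebra \<Rightarrow> ('a \<Rightarrow> 'b) \<Rightarrow> bool" where
  "unital_star_hom A B \<phi> \<longleftrightarrow>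
     (\<forall>a\<in>alg_carrier A. \<phi> a \<in> alg_carrier B) \<and>
     \<phi> (alg_one A) = alg_one B \<and>
     (\<forall>a\<in>alg_carrier A. \<forall>b\<in>alg_carrier A.
        \<phi> (alg_add A a b) = alg_add B (\<phi> a) (\<phi> b) \<and> \<phi> (alg_mult A a b) = alg_mult B (\<phi> a) (\<phi> b)) \<and>
     (\<forall>c. \<forall>a\<in>alg_carrier A. \<phi> (alg_scale A c a) = alg_scale B c (\<phi> a)) \<and>
     (\<forall>a\<in>alg_carrier A. \<phi> (alg_star A a) = alg_star B (\<phi> a))"

definition star_iso :: "'a star_algebra \<Rightarrow> 'b star_algebra \<Rightarrow> ('a \<Rightarrow> 'b) \<Rightarrow> bool" where
  "star_iso A B \<phi> \<longleftrightarrow> unital_star_hom A B \<phi> \<and> bij_betw \<phi> (alg_carrier A) (alg_carrier B)"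

text \<open>Short exact sequences \<open>0 \<rightarrow> K(H) \<rightarrow> E \<rightarrow> B \<rightarrow> 0\<close> with \<open>E\<close> a unital C*-subalgebra of \<open>B(H)\<close>,
  the first map being the inclusion and the second one \<open>q\<close>. As usual for a unital quotient, all
  homomorphisms are unital, including the splittings below.\<close>

definition extension_by_compacts ::
  "('h::chilbert_space \<Rightarrow>\<^sub>L 'h) set \<Rightarrow> 'b star_algebra \<Rightarrow> (('h \<Rightarrow>\<^sub>L 'h) \<Rightarrow> 'b) \<Rightarrow> bool" where
  "extension_by_compacts E B q \<longleftrightarrow>
     cstar_subalgebra E \<and> id_blinfun \<in> E \<and> compact_ops \<subseteq> E \<and>
     unital_star_hom (op_algebra E) B q \<and> q ` E = alg_carrier B \<and>
     {T \<in> E. q T = alg_zero B} = compact_ops"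

definition split_extension ::
  "('h::chilbert_space \<Rightarrow>\<^sub>L 'h) set \<Rightarrow> (('h \<Rightarrow>\<^sub>L 'h) \<Rightarrow> complex \<Rightarrow> complex) \<Rightarrow> bool" where
  "split_extension E q \<longleftrightarrow> extension_by_compacts E circle_algebra q \<and>
     (\<exists>\<sigma>. unital_star_hom circle_algebra (op_algebra E) \<sigma> \<and> (\<forall>f\<in>circle_continuous. q (\<sigma> f) = f))"

text \<open>The Busby invariant, with values in the quotient of \<open>B(H)\<close> by \<open>K(H)\<close>: for an extension,
  \<open>busby E q f\<close> is a coset of the compact operators.\<close>

definition busby ::
  "('h::chilbert_space \<Rightarrow>\<^sub>L 'h) set \<Rightarrow> (('h \<Rightarrow>\<^sub>L 'h) \<Rightarrow> complex \<Rightarrow> complex)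
     \<Rightarrow> (complex \<Rightarrow> complex) \<Rightarrow> ('h \<Rightarrow>\<^sub>L 'h) set" where
  "busby E q f = {T \<in> E. q T = f}"

definition busby_sum ::
  "((complex \<Rightarrow> complex) \<Rightarrow> ('h::chilbert_space \<Rightarrow>\<^sub>L 'h) set)
     \<Rightarrow> ((complex \<Rightarrow> complex) \<Rightarrow> ('k::chilbert_space \<Rightarrow>\<^sub>L 'k) set)
     \<Rightarrow> (complex \<Rightarrow> complex) \<Rightarrow> (('h \<times> 'k) \<Rightarrow>\<^sub>L ('h \<times> 'k)) set" where
  "busby_sum \<tau> \<rho> f = {direct_sum_op S T + K |S T K. S \<in> \<tau> f \<and> T \<in> \<rho> f \<and> K \<in> compact_ops}"

definition unitarily_equivalent ::
  "((complex \<Rightarrow> complex) \<Rightarrow> ('h::chilbert_space \<Rightarrow>\<^sub>L 'h) set)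
     \<Rightarrow> ((complex \<Rightarrow> complex) \<Rightarrow> ('k::chilbert_space \<Rightarrow>\<^sub>L 'k) set) \<Rightarrow> bool" where
  "unitarily_equivalent \<tau> \<rho> \<longleftrightarrow> (\<exists>U. unitary_op U \<and>
     (\<forall>f\<in>circle_continuous. \<rho> f = (\<lambda>T. U o\<^sub>L T o\<^sub>L adj U) ` \<tau> f))"

text \<open>Equality of classes in Ext of the continuous functions on the circle: unitary equivalence
  after adding split extensions. Every split extension on a separable Hilbert space is unitarily
  equivalent to one on \<open>nat ell2\<close>. The zero class is the class of the split extensions.\<close>

definition same_ext_class ::
  "('h::chilbert_space \<Rightarrow>\<^sub>L 'h) set \<Rightarrow> (('h \<Rightarrow>\<^sub>L 'h) \<Rightarrow> complex \<Rightarrow> complex)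
     \<Rightarrow> ('k::chilbert_space \<Rightarrow>\<^sub>L 'k) set \<Rightarrow> (('k \<Rightarrow>\<^sub>L 'k) \<Rightarrow> complex \<Rightarrow> complex) \<Rightarrow> bool" where
  "same_ext_class E q F r \<longleftrightarrow>
     (\<exists>(D :: (nat ell2 \<Rightarrow>\<^sub>L nat ell2) set) d (D' :: (nat ell2 \<Rightarrow>\<^sub>L nat ell2) set) d'.
        split_extension D d \<and> split_extension D' d' \<and>
        unitarily_equivalent (busby_sum (busby E q) (busby D d)) (busby_sum (busby F r) (busby D' d')))"

definition zero_ext_class ::
  "('h::chilbert_space \<Rightarrow>\<^sub>L 'h) set \<Rightarrow> (('h \<Rightarrow>\<^sub>L 'h) \<Rightarrow> complex \<Rightarrow> complex) \<Rightarrow> bool" where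
  "zero_ext_class E q \<longleftrightarrow>
     (\<exists>(D :: (nat ell2 \<Rightarrow>\<^sub>L nat ell2) set) d. split_extension D d \<and> same_ext_class E q D d)"

text \<open>The Toeplitz extension of the continuous functions on the circle, with quotient map \<open>p\<close>.\<close>

definition toeplitz_extension :: "((hardy \<Rightarrow>\<^sub>L hardy) \<Rightarrow> complex \<Rightarrow> complex) \<Rightarrow> bool" where
  "toeplitz_extension p \<longleftrightarrow> extension_by_compacts toeplitz_algebra circle_algebra p \<and>
     p (toeplitz_op circle_id) = circle_id"

end

theory Submission
  imports Defs "HOL-Computational_Algebra.Polynomial"
begin

text \<open>An isometry \<open>T\<close> satisfies von Neumann's inequality for polynomials, so by Stone--Weierstrass \<open>z \<mapsto> T\<close>
  extends to a contractive, star-preserving linear map \<open>f \<mapsto> f(T)\<close> on the continuous functions of the circle;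
  it is multiplicative modulo every closed ideal containing \<open>1 - T T\<^sup>*\<close>. If some orbit of \<open>T\<close> is
  orthonormal, averages along it give weakly null approximate eigenvectors for every point of the circle, whence
  \<open>\<parallel>f\<parallel> \<le> \<parallel>f(T) + K\<parallel>\<close> for compact \<open>K\<close>, and \<open>f\<close> is recovered from \<open>f(T) + K\<close>. This describes the
  algebras of the integers (bilateral shift, no compact operators), of the nonzero integers (the bilateral shift
  across the gap, which differs from the partial translation by a rank-one operator) and the Toeplitz algebra
  (unilateral shift). The shift across the gap is unitary, so the second extension splits. Were its class
  that of the Toeplitz extension, the direct sum of the unilateral shift and a unitary would be a compact
  perturbation of a unitary, although it is an isometry that is not onto.\<close>

section \<open>Bounded operators on complex Hilbert spaces\<close>

text \<open>Compact operators enter through one parameter, a closed ideal \<open>J\<close> inside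
  \<open>compact_ops\<close> that contains \<open>id_blinfun - (T o\<^sub>L adj T)\<close>. Taking
  \<open>{0}\<close> for the integers and \<open>compact_ops\<close> for the other two algebras
  brings an isomorphism with C(S^1) and two extensions under the same argument. The quotient map of
  the theorem is the symbol on the nonzero integers followed by the calculus of the bilateral shift.

  Neither a Fredholm index nor a Calkin algebra is formed. The approximate eigenvectors do the work
  of both: they make symbols unique and contractive, which in turn makes the algebras norm closed,
  and they rule out a compact perturbation of the identity that has a wandering vector.

  The classes are compared up to arbitrary split summands and for an arbitrary Toeplitz quotient map
  sending the shift to z. The obstruction may therefore rely only on what every split extension
  provides, namely a unitary lift of z.\<close>

lemma cinner_add_left: "cinner (x + y) (z::'a::complex_inner) = cinner x z + cinner y z"
  by (metis cinner_add_right cinner_commute complex_cnj_add)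

lemma cinner_scaleC_left: "cinner (c *\<^sub>C x) (y::'a::complex_inner) = cnj c * cinner x y"
  by (metis cinner_commute cinner_scaleC_right complex_cnj_mult)

lemma cinner_zero_right [simp]: "cinner x (0::'a::complex_inner) = 0"
  using cinner_add_right[of x 0 0] by simp

lemma cinner_zero_left [simp]: "cinner (0::'a::complex_inner) x = 0"
  using cinner_add_left[of 0 0 x] by simp

lemma cinner_minus_right: "cinner x (- y) = - cinner x (y::'a::complex_inner)"
  using cinner_add_right[of x y "- y"] by (simp add: eq_neg_iff_add_eq_0 add.commute)

lemma cinner_minus_left: "cinner (- x) y = - cinner x (y::'a::complex_inner)"
  using cinner_add_left[of x "- x" y] by (simp add: eq_neg_iff_add_eq_0 add.commute)

lemma cinner_diff_right: "cinner x (y - z) = cinner x y - cinner x (z::'a::complex_inner)"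
  using cinner_add_right[of x y "- z"] by (simp add: cinner_minus_right)

lemma cinner_diff_left: "cinner (x - y) z = cinner x z - cinner y (z::'a::complex_inner)"
  using cinner_add_left[of x "- y" z] by (simp add: cinner_minus_left)

lemma cinner_scaleR_right: "cinner x (r *\<^sub>R y) = of_real r * cinner x (y::'a::complex_inner)"
  by (simp add: cinner_scaleC_right flip: scaleC_of_real)

lemma cinner_scaleR_left: "cinner (r *\<^sub>R x) y = of_real r * cinner x (y::'a::complex_inner)"
  by (simp add: cinner_scaleC_left flip: scaleC_of_real)

lemmas cinner_simps = cinner_add_left cinner_add_right cinner_diff_left cinner_diff_right
  cinner_minus_left cinner_minus_right cinner_scaleC_left cinner_scaleC_right

lemma cinner_sum_right: "cinner x (\<Sum>i\<in>F. f i) = (\<Sum>i\<in>F. cinner x (f i :: 'a::complex_inner))"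
  by (induction F rule: infinite_finite_induct) (auto simp: cinner_add_right)

lemma cinner_sum_left: "cinner (\<Sum>i\<in>F. f i) x = (\<Sum>i\<in>F. cinner (f i) (x :: 'a::complex_inner))"
  by (induction F rule: infinite_finite_induct) (auto simp: cinner_add_left)

lemma cinner_eqI: "(\<And>x. cinner x a = cinner x b) \<Longrightarrow> a = (b :: 'a::complex_inner)"
  by (metis inner_commute inner_eqI inner_eq_Re_cinner)

lemma scaleC_diff_right: "c *\<^sub>C (x - y) = c *\<^sub>C x - c *\<^sub>C (y::'a::complex_inner)"
  by (rule complex_vector.scale_right_diff_distrib)

lemma norm_eqI_cinner: "cinner x x = cinner y y \<Longrightarrow> norm (x::'a::complex_inner) = norm (y::'b::complex_inner)"
  by (simp add: cinner_self) (metis norm_ge_zero power2_eq_iff_nonneg of_real_eq_iff of_real_power)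

text \<open>Rotating \<open>y\<close> by a phase \<open>u\<close> makes the inner product real and
  nonnegative, which reduces the claim to the real inequality.\<close>

lemma cinner_cauchy_schwarz: "cmod (cinner x y) \<le> norm x * norm (y::'a::complex_inner)"
proof -
  let ?c = "cinner x y"
  define u where "u = (if ?c = 0 then 1 else cnj ?c / cmod ?c)"
  have u: "cmod u = 1" by (simp add: u_def norm_divide)
  have "cinner x (u *\<^sub>C y) = of_real (cmod ?c)"
  proof (cases "?c = 0")
    case False
    have "cnj ?c * ?c = of_real ((cmod ?c)\<^sup>2)" by (simp add: complex_norm_square mult.commute del: of_real_power)
    then show ?thesis using False by (simp add: u_def cinner_scaleC_right power2_eq_square)
  qed (simp add: cinner_scaleC_right)
  then have "cmod ?c = inner x (u *\<^sub>C y)" by (simp add: inner_eq_Re_cinner)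
  also have "\<dots> \<le> norm x * norm (u *\<^sub>C y)" by (rule norm_cauchy_schwarz)
  finally show ?thesis by (simp add: norm_scaleC u)
qed

text \<open>Conjugate-linearity in the first argument is invisible to real scalars, so the limit
  rules for real bilinear maps apply.\<close>

lemma bounded_bilinear_cinner: "bounded_bilinear (cinner :: 'a::complex_inner \<Rightarrow> 'a \<Rightarrow> complex)"
proof
  show "\<exists>K. \<forall>a b :: 'a. norm (cinner a b) \<le> norm a * norm b * K"
    by (intro exI[of _ 1]) (simp add: cinner_cauchy_schwarz)
qed (simp_all add: cinner_simps cinner_scaleR_left cinner_scaleR_right scaleR_conv_of_real)

lemmas tendsto_cinner = bounded_bilinear.tendsto[OF bounded_bilinear_cinner]

lemma pythagoras_cinner:
  assumes "cinner x y = 0" shows "(norm (x + y))\<^sup>2 = (norm x)\<^sup>2 + (norm (y::'a::complex_inner))\<^sup>2"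
proof -
  have "cinner y x = 0" using assms by (metis cinner_commute complex_cnj_zero)
  then have "of_real ((norm (x + y))\<^sup>2) = complex_of_real ((norm x)\<^sup>2 + (norm y)\<^sup>2)"
    using assms by (simp only: of_real_add cinner_self[symmetric] cinner_add_left cinner_add_right) simp
  then show ?thesis using of_real_eq_iff by blast
qed

lemma bounded_opsD: "T \<in> bounded_ops \<Longrightarrow> blinfun_apply T (c *\<^sub>C x) = c *\<^sub>C T x"
  by (simp add: bounded_ops_def)

lemma bounded_ops_zero [simp]: "0 \<in> bounded_ops"
  and bounded_ops_id [simp]: "id_blinfun \<in> bounded_ops"
  and bounded_ops_add: "S \<in> bounded_ops \<Longrightarrow> T \<in> bounded_ops \<Longrightarrow> S + T \<in> bounded_ops"
  and bounded_ops_diff: "S \<in> bounded_ops \<Longrightarrow> T \<in> bounded_ops \<Longrightarrow> S - T \<in> bounded_ops"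
  and bounded_ops_minus: "S \<in> bounded_ops \<Longrightarrow> - S \<in> bounded_ops"
  and bounded_ops_scaleC: "S \<in> bounded_ops \<Longrightarrow> scaleC_op c S \<in> bounded_ops"
  by (auto simp: bounded_ops_def blinfun.bilinear_simps scaleC_add_right scaleC_diff_right scaleC_op.rep_eq
      scaleC_scaleC mult.commute)

lemma bounded_ops_compose: "S \<in> bounded_ops \<Longrightarrow> T \<in> bounded_ops \<Longrightarrow> S o\<^sub>L T \<in> bounded_ops"
  by (auto simp: bounded_ops_def)

lemmas bounded_ops_intros = bounded_ops_zero bounded_ops_id bounded_ops_add bounded_ops_diff
  bounded_ops_minus bounded_ops_scaleC bounded_ops_compose adj_bounded_ops

lemma closed_bounded_ops: "closed (bounded_ops :: ('a::complex_inner \<Rightarrow>\<^sub>L 'b::complex_inner) set)"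
proof (rule closed_sequential_limits[THEN iffD2], intro allI impI, elim conjE)
  fix X and L :: "'a \<Rightarrow>\<^sub>L 'b" assume X: "\<forall>n. X n \<in> bounded_ops" and L: "X \<longlonglongrightarrow> L"
  have app: "(\<lambda>n. X n x) \<longlonglongrightarrow> L x" for x by (intro tendsto_intros L)
  have "L (c *\<^sub>C x) = c *\<^sub>C L x" for c x
  proof (rule LIMSEQ_unique)
    show "(\<lambda>n. X n (c *\<^sub>C x)) \<longlonglongrightarrow> L (c *\<^sub>C x)" by (rule app)
    show "(\<lambda>n. X n (c *\<^sub>C x)) \<longlonglongrightarrow> c *\<^sub>C L x"
      using bounded_linear.tendsto[OF bounded_linear_scaleC app] X by (simp add: bounded_ops_def)
  qed
  then show "L \<in> bounded_ops" by (simp add: bounded_ops_def)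
qed

lemma cinner_adj': "T \<in> bounded_ops \<Longrightarrow> cinner x (adj T y) = cinner (blinfun_apply T x) y"
  by (metis cinner_adj cinner_commute)

lemma adj_eqI:
  assumes "T \<in> bounded_ops" "S \<in> bounded_ops" "\<And>x y. cinner (blinfun_apply S y) x = cinner y (T x)"
  shows "adj T = S"
  using ex_adj[OF assms(1)] assms adj_bounded_ops[OF assms(1)] cinner_adj[OF assms(1)] by blast

lemma adj_adj [simp]: "T \<in> bounded_ops \<Longrightarrow> adj (adj T) = T"
  by (rule adj_eqI) (simp_all add: adj_bounded_ops cinner_adj')

lemma adj_zero [simp]: "adj 0 = 0"
  by (rule adj_eqI) auto

lemma adj_compose: "S \<in> bounded_ops \<Longrightarrow> T \<in> bounded_ops \<Longrightarrow> adj (S o\<^sub>L T) = adj T o\<^sub>L adj S"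
  by (rule adj_eqI) (auto intro: bounded_ops_intros simp: cinner_adj)

lemma adj_add: "S \<in> bounded_ops \<Longrightarrow> T \<in> bounded_ops \<Longrightarrow> adj (S + T) = adj S + adj T"
  by (rule adj_eqI) (auto intro: bounded_ops_intros simp: cinner_adj cinner_simps blinfun.bilinear_simps)

lemma adj_diff: "S \<in> bounded_ops \<Longrightarrow> T \<in> bounded_ops \<Longrightarrow> adj (S - T) = adj S - adj T"
  by (rule adj_eqI) (auto intro: bounded_ops_intros simp: cinner_adj cinner_simps blinfun.bilinear_simps)

lemma adj_scaleC: "S \<in> bounded_ops \<Longrightarrow> adj (scaleC_op c S) = scaleC_op (cnj c) (adj S)"
  by (rule adj_eqI) (auto intro: bounded_ops_intros simp: cinner_adj cinner_simps scaleC_op.rep_eq)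

lemma adj_id [simp]: "adj id_blinfun = id_blinfun"
  by (rule adj_eqI) auto

lemma norm_adj_le: "T \<in> bounded_ops \<Longrightarrow> norm (adj T) \<le> norm T"
proof (rule norm_blinfun_bound)
  fix y assume T: "T \<in> bounded_ops"
  show "norm (adj T y) \<le> norm T * norm y"
  proof (cases "adj T y = 0")
    case False
    have "norm (adj T y) * norm (adj T y) = cmod (cinner (adj T y) (adj T y))"
      by (simp add: cinner_self power2_eq_square norm_mult)
    also have "\<dots> = cmod (cinner y (T (adj T y)))" using T by (simp add: cinner_adj)
    also have "\<dots> \<le> norm y * (norm T * norm (adj T y))"
      by (rule order_trans[OF cinner_cauchy_schwarz]) (intro mult_left_mono norm_blinfun norm_ge_zero)
    finally show ?thesis using False by (simp add: mult_ac)
  qed simp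
qed simp

lemma tendsto_adj:
  assumes "X \<longlonglongrightarrow> L" "\<And>n. X n \<in> bounded_ops" shows "(\<lambda>n. adj (X n)) \<longlonglongrightarrow> adj L"
proof -
  have L: "L \<in> bounded_ops" using closed_bounded_ops assms closed_sequentially by blast
  have "(\<lambda>n. norm (X n - L)) \<longlonglongrightarrow> 0" using assms(1) tendsto_norm_zero LIM_zero by blast
  then have "(\<lambda>n. adj (X n) - adj L) \<longlonglongrightarrow> 0"
    by (rule Lim_null_comparison[rotated])
      (use norm_adj_le[OF bounded_ops_diff[OF assms(2) L]] in \<open>simp add: adj_diff[OF assms(2) L]\<close>)
  then show ?thesis by (rule LIM_zero_cancel)
qed

lemma tendsto_blinfun_compose:
  "(X \<longlongrightarrow> A) F \<Longrightarrow> (Y \<longlongrightarrow> B) F \<Longrightarrow> ((\<lambda>n. X n o\<^sub>L Y n) \<longlongrightarrow> A o\<^sub>L B) F"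
  by (rule bounded_bilinear.tendsto[OF bounded_bilinear_blinfun_compose])

lemma blinfun_compose_simps:
  "(A + B) o\<^sub>L C = (A o\<^sub>L C) + (B o\<^sub>L C)" "(A - B) o\<^sub>L C = (A o\<^sub>L C) - (B o\<^sub>L C)"
  "A o\<^sub>L (C + D) = (A o\<^sub>L C) + (A o\<^sub>L D)" "A o\<^sub>L (C - D) = (A o\<^sub>L C) - (A o\<^sub>L D)"
  "A o\<^sub>L id_blinfun = A" "id_blinfun o\<^sub>L A = A"
  by (auto intro!: blinfun_eqI simp: blinfun.bilinear_simps)

lemma blinfun_compose_assoc: "(A o\<^sub>L B) o\<^sub>L C = A o\<^sub>L (B o\<^sub>L C)"
  by (auto intro!: blinfun_eqI)

lemma scaleC_op_compose:
  "scaleC_op c A o\<^sub>L B = scaleC_op c (A o\<^sub>L B)"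
  "A \<in> bounded_ops \<Longrightarrow> A o\<^sub>L scaleC_op c B = scaleC_op c (A o\<^sub>L B)"
  by (auto intro!: blinfun_eqI simp: scaleC_op.rep_eq bounded_opsD)

lemma scaleC_op_simps [simp]:
  "scaleC_op 0 A = 0" "scaleC_op 1 A = A" "scaleC_op c 0 = 0" "scaleC_op (-1) A = - A"
  by (auto intro!: blinfun_eqI simp: scaleC_op.rep_eq scaleC_one blinfun.bilinear_simps)

lemma norm_scaleC_op: "norm (scaleC_op c A) \<le> cmod c * norm A"
proof (rule norm_blinfun_bound)
  show "norm (scaleC_op c A x) \<le> cmod c * norm A * norm x" for x
    using mult_left_mono[OF norm_blinfun[of A x], of "cmod c"]
    by (simp add: scaleC_op.rep_eq norm_scaleC mult_ac)
qed simp

lemma scaleC_op_diff: "scaleC_op c (A - B) = scaleC_op c A - scaleC_op c B"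
  by (auto intro!: blinfun_eqI simp: scaleC_op.rep_eq blinfun.bilinear_simps scaleC_diff_right)

lemma tendsto_scaleC_op:
  assumes "X \<longlonglongrightarrow> L" shows "(\<lambda>n. scaleC_op c (X n)) \<longlonglongrightarrow> scaleC_op c L"
proof -
  have "(\<lambda>n. cmod c * norm (X n - L)) \<longlonglongrightarrow> 0"
    using assms by (intro tendsto_mult_right_zero tendsto_norm_zero LIM_zero)
  then have "(\<lambda>n. scaleC_op c (X n) - scaleC_op c L) \<longlonglongrightarrow> 0"
    by (rule Lim_null_comparison[rotated]) (simp add: norm_scaleC_op flip: scaleC_op_diff)
  then show ?thesis by (rule LIM_zero_cancel)
qed

lemma isometry_cinner:
  assumes "T \<in> bounded_ops" "adj T o\<^sub>L T = id_blinfun"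
  shows "cinner (T x) (T y) = cinner x y"
proof -
  have "cinner (T x) (T y) = cinner x ((adj T o\<^sub>L T) y)" using assms(1) by (simp add: cinner_adj')
  then show ?thesis unfolding assms(2) by simp
qed

lemma isometry_norm:
  assumes "T \<in> bounded_ops" "adj T o\<^sub>L T = id_blinfun" shows "norm (T x) = norm x"
  by (rule norm_eqI_cinner) (simp add: isometry_cinner[OF assms])

lemma isometry_imp_adj_compose:
  assumes T: "T \<in> bounded_ops" and "\<And>x y. cinner (T x) (T y) = cinner x y"
  shows "adj T o\<^sub>L T = id_blinfun"
  by (rule blinfun_eqI, rule cinner_eqI) (simp add: cinner_adj'[OF T] assms(2))

section \<open>C*-subalgebras and generation\<close>

lemma cstar_subalgebraD:
  assumes "cstar_subalgebra A"
  shows "T \<in> A \<Longrightarrow> T \<in> bounded_ops" "0 \<in> A" "S \<in> A \<Longrightarrow> T \<in> A \<Longrightarrow> S + T \<in> A"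
    "S \<in> A \<Longrightarrow> T \<in> A \<Longrightarrow> S o\<^sub>L T \<in> A" "T \<in> A \<Longrightarrow> scaleC_op c T \<in> A" "T \<in> A \<Longrightarrow> adj T \<in> A" "closed A"
  using assms unfolding cstar_subalgebra_def by auto

lemma cstar_subalgebra_minus:
  assumes "cstar_subalgebra A" "T \<in> A" shows "- T \<in> A"
  using cstar_subalgebraD(5)[OF assms, of "-1"] by simp

lemma cstar_subalgebra_diff:
  assumes "cstar_subalgebra A" "S \<in> A" "T \<in> A" shows "S - T \<in> A"
  using cstar_subalgebraD(3)[OF assms(1,2) cstar_subalgebra_minus[OF assms(1,3)]] by simp

lemma cstar_subalgebra_sum:
  assumes "cstar_subalgebra A" "\<And>i. i \<in> F \<Longrightarrow> T i \<in> A" shows "(\<Sum>i\<in>F. T i) \<in> A"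
  using assms(2) by (induction F rule: infinite_finite_induct) (auto intro: cstar_subalgebraD[OF assms(1)])

lemma cstar_subalgebra_bounded_ops: "cstar_subalgebra bounded_ops"
  by (auto simp: cstar_subalgebra_def closed_bounded_ops intro: bounded_ops_intros)

text \<open>The hypothesis makes \<open>bounded_ops\<close> a member of the intersected family. An
  empty family would give all real-linear operators.\<close>

lemma cstar_generated:
  assumes "G \<subseteq> bounded_ops"
  shows "cstar_subalgebra (cstar_generated G)" "G \<subseteq> cstar_generated G"
    "cstar_subalgebra A \<Longrightarrow> G \<subseteq> A \<Longrightarrow> cstar_generated G \<subseteq> A"
proof -
  let ?F = "{A. cstar_subalgebra A \<and> G \<subseteq> A}"
  have "bounded_ops \<in> ?F" using assms cstar_subalgebra_bounded_ops by blast
  then have "\<Inter>?F \<subseteq> bounded_ops" by blast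
  moreover have "closed (\<Inter>?F)" by (rule closed_Inter) (auto simp: cstar_subalgebra_def)
  ultimately show "cstar_subalgebra (cstar_generated G)"
    unfolding cstar_generated_def cstar_subalgebra_def
    by (auto simp: cstar_subalgebra_def)
qed (auto simp: cstar_generated_def)

subsection \<open>Compact operators\<close>

lemma compact_ops_subseq:
  assumes K: "K \<in> compact_ops" and B: "\<And>n. norm (x n) \<le> B"
  obtains l r where "strict_mono (r :: nat \<Rightarrow> nat)" "(\<lambda>n. blinfun_apply K (x (r n))) \<longlonglongrightarrow> l"
proof -
  \<comment> \<open>The maximum keeps the scaling factor positive when \<open>B\<close> is
    0.\<close>
  define C where "C = max B 1"
  have C: "C > 0" "\<And>n. norm (x n) \<le> C" using B by (auto simp: C_def le_max_iff_disj)
  let ?S = "closure (blinfun_apply K ` cball 0 1)"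
  have "compact ?S" using K by (simp add: compact_ops_def)
  moreover have "\<forall>n. K ((1 / C) *\<^sub>R x n) \<in> ?S"
    using C by (intro allI subsetD[OF closure_subset] imageI) (simp add: divide_le_eq)
  ultimately obtain l r where r: "strict_mono r" and l: "((\<lambda>n. K ((1 / C) *\<^sub>R x n)) \<circ> r) \<longlonglongrightarrow> l"
    unfolding compact_def by (elim allE[where x = "\<lambda>n. K ((1 / C) *\<^sub>R x n)"]) blast
  have "(\<lambda>n. C *\<^sub>R K ((1 / C) *\<^sub>R x (r n))) \<longlonglongrightarrow> C *\<^sub>R l"
    using l unfolding o_def by (intro tendsto_intros)
  then have "(\<lambda>n. K (x (r n))) \<longlonglongrightarrow> C *\<^sub>R l"
    using C(1) by (simp add: blinfun.bilinear_simps)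
  with r show ?thesis by (rule that)
qed

text \<open>Halving the radius leaves room for closed balls, whose finite union is closed and hence
  also covers the closure.\<close>

lemma compact_closure_totally_bounded:
  "compact (closure S) \<longleftrightarrow> (\<forall>e>0. \<exists>k. finite k \<and> S \<subseteq> (\<Union>x\<in>k. ball x e))"
  for S :: "'a::complete_space set"
proof
  assume "compact (closure S)"
  then show "\<forall>e>0. \<exists>k. finite k \<and> S \<subseteq> (\<Union>x\<in>k. ball x e)"
    using closure_subset unfolding compact_eq_totally_bounded by (meson order_trans)
next
  assume *: "\<forall>e>0. \<exists>k. finite k \<and> S \<subseteq> (\<Union>x\<in>k. ball x e)"
  have "\<exists>k. finite k \<and> closure S \<subseteq> (\<Union>x\<in>k. ball x e)" if "e > 0" for e
  proof -
    obtain k where k: "finite k" "S \<subseteq> (\<Union>x\<in>k. ball x (e / 2))" using * \<open>e > 0\<close> half_gt_zero by blast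
    then have "S \<subseteq> (\<Union>x\<in>k. cball x (e / 2))"
      by (elim order_trans) (intro UN_mono order_refl ball_subset_cball)
    moreover have "closed (\<Union>x\<in>k. cball x (e / 2))" using k by (intro closed_UN) auto
    ultimately have "closure S \<subseteq> (\<Union>x\<in>k. cball x (e / 2))" by (rule closure_minimal)
    also have "\<dots> \<subseteq> (\<Union>x\<in>k. ball x e)" using \<open>e > 0\<close> by (intro UN_mono) auto
    finally show ?thesis using k by blast
  qed
  then show "compact (closure S)"
    unfolding compact_eq_totally_bounded using complete_eq_closed by blast
qed

lemma compact_ops_totally_bounded:
  fixes K :: "'a::complex_inner \<Rightarrow>\<^sub>L 'b::chilbert_space"
  shows "K \<in> compact_ops \<longleftrightarrow> K \<in> bounded_ops \<and>
    (\<forall>e>0. \<exists>k. finite k \<and> blinfun_apply K ` cball 0 1 \<subseteq> (\<Union>x\<in>k. ball x e))"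
  by (simp add: compact_ops_def compact_closure_totally_bounded)

text \<open>Compactness speaks of sequences in the closure of the image. Each term lies within
  1/(n+1) of a genuine image point, so a convergent subsequence of the image points is also one of
  the given sequence.\<close>

lemma compact_opsI:
  fixes K :: "'a::complex_inner \<Rightarrow>\<^sub>L 'b::complex_inner"
  assumes K: "K \<in> bounded_ops"
    and sub: "\<And>x. (\<And>n :: nat. norm (x n) \<le> 1) \<Longrightarrow>
      \<exists>r l. strict_mono (r :: nat \<Rightarrow> nat) \<and> (\<lambda>n. blinfun_apply K (x (r n))) \<longlonglongrightarrow> l"
  shows "K \<in> compact_ops"
proof -
  let ?S = "blinfun_apply K ` cball 0 1"
  have "compact (closure ?S)"
    unfolding compact_def
  proof (intro allI impI)
    fix y assume y: "\<forall>n :: nat. y n \<in> closure ?S"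
    have "\<exists>x. norm x \<le> 1 \<and> dist (K x) (y n) < 1 / real (Suc n)" for n :: nat
      using y[rule_format, of n] unfolding closure_approachable
      by (metis (no_types, lifting) imageE mem_cball_0 of_nat_0_less_iff zero_less_Suc zero_less_divide_1_iff)
    then obtain x where x: "\<And>n. norm (x n) \<le> 1" "\<And>n. dist (K (x n)) (y n) < 1 / real (Suc n)" by metis
    obtain r l where r: "strict_mono r" and l: "(\<lambda>n. K (x (r n))) \<longlonglongrightarrow> l" using sub[of x, OF x(1)] by blast
    have "(\<lambda>n. dist (K (x n)) (y n)) \<longlonglongrightarrow> 0"
      by (rule tendsto_sandwich[OF _ _ tendsto_const LIMSEQ_Suc[OF lim_1_over_n]])
        (use x(2) less_imp_le in \<open>auto intro!: always_eventually\<close>)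
    then have "(\<lambda>n. dist (K (x (r n))) (y (r n))) \<longlonglongrightarrow> 0"
      using LIMSEQ_subseq_LIMSEQ[OF _ r] by (fastforce simp: o_def)
    then have "(\<lambda>n. K (x (r n)) - y (r n)) \<longlonglongrightarrow> 0"
      by (simp add: dist_norm tendsto_norm_zero_iff)
    from tendsto_diff[OF l this] have "(y \<circ> r) \<longlonglongrightarrow> l" by (simp add: o_def)
    moreover have "l \<in> closure ?S"
      by (rule closed_sequentially[OF closed_closure _ calculation]) (use y in auto)
    ultimately show "\<exists>l\<in>closure ?S. \<exists>r. strict_mono r \<and> (y \<circ> r) \<longlonglongrightarrow> l" using r by blast
  qed
  then show ?thesis using K by (simp add: compact_ops_def)
qed

lemma compact_ops_bounded: "K \<in> compact_ops \<Longrightarrow> K \<in> bounded_ops"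
  by (simp add: compact_ops_def)

lemma compact_ops_zero [simp]: "0 \<in> compact_ops"
  by (rule compact_opsI) (auto intro: exI[of _ id] simp: strict_mono_def)

lemma compact_ops_add:
  fixes K :: "'a::complex_inner \<Rightarrow>\<^sub>L 'b::complex_inner"
  assumes "K \<in> compact_ops" "L \<in> compact_ops" shows "K + L \<in> compact_ops"
proof (rule compact_opsI)
  fix x :: "nat \<Rightarrow> 'a" assume x: "\<And>n. norm (x n) \<le> 1"
  obtain r a where r: "strict_mono r" "(\<lambda>n. K (x (r n))) \<longlonglongrightarrow> a"
    using compact_ops_subseq[where x = x, OF assms(1) x] by blast
  obtain s b where s: "strict_mono s" "(\<lambda>n. L (x (r (s n)))) \<longlonglongrightarrow> b"
    using compact_ops_subseq[where x = "\<lambda>n. x (r n)", OF assms(2) x] by blast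
  have "(\<lambda>n. K (x (r (s n)))) \<longlonglongrightarrow> a"
    using LIMSEQ_subseq_LIMSEQ[OF r(2) s(1)] by (simp add: o_def)
  from tendsto_add[OF this s(2)] show "\<exists>r l. strict_mono r \<and> (\<lambda>n. (K + L) (x (r n))) \<longlonglongrightarrow> l"
    using strict_mono_o[OF r(1) s(1)] by (auto simp: o_def blinfun.bilinear_simps)
qed (use assms in \<open>auto intro: bounded_ops_intros compact_ops_bounded\<close>)

lemma compact_ops_compose_right:
  fixes S :: "'a::complex_inner \<Rightarrow>\<^sub>L 'b::complex_inner"
  assumes "K \<in> compact_ops" "S \<in> bounded_ops" shows "K o\<^sub>L S \<in> compact_ops"
proof (rule compact_opsI)
  fix x :: "nat \<Rightarrow> 'a" assume x: "\<And>n. norm (x n) \<le> 1"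
  have "norm (S (x n)) \<le> norm S" for n
    using norm_blinfun[of S "x n"] mult_left_mono[OF x[of n], of "norm S"] by simp
  then obtain r l where "strict_mono r" "(\<lambda>n. K (S (x (r n)))) \<longlonglongrightarrow> l"
    using compact_ops_subseq[where x = "\<lambda>n. S (x n)", OF assms(1)] by blast
  then show "\<exists>r l. strict_mono r \<and> (\<lambda>n. (K o\<^sub>L S) (x (r n))) \<longlonglongrightarrow> l" by auto
qed (use assms in \<open>auto intro: bounded_ops_intros compact_ops_bounded\<close>)

lemma compact_ops_compose_left:
  fixes K :: "'a::complex_inner \<Rightarrow>\<^sub>L 'b::complex_inner"
  assumes "K \<in> compact_ops" "S \<in> bounded_ops" shows "S o\<^sub>L K \<in> compact_ops"
proof (rule compact_opsI)
  fix x :: "nat \<Rightarrow> 'a" assume x: "\<And>n. norm (x n) \<le> 1"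
  obtain r a where r: "strict_mono r" "(\<lambda>n. K (x (r n))) \<longlonglongrightarrow> a"
    using compact_ops_subseq[where x = x, OF assms(1) x] by blast
  then have "(\<lambda>n. S (K (x (r n)))) \<longlonglongrightarrow> S a" by (intro tendsto_intros)
  with r(1) show "\<exists>r l. strict_mono r \<and> (\<lambda>n. (S o\<^sub>L K) (x (r n))) \<longlonglongrightarrow> l" by auto
qed (use assms in \<open>auto intro: bounded_ops_intros compact_ops_bounded\<close>)

lemma compact_ops_scaleC: "K \<in> compact_ops \<Longrightarrow> scaleC_op c K \<in> compact_ops"
  using compact_ops_compose_left[of K "scaleC_op c id_blinfun"]
  by (auto simp: scaleC_op_compose blinfun_compose_simps intro: bounded_ops_intros)

lemma compact_ops_minus: "K \<in> compact_ops \<Longrightarrow> - K \<in> compact_ops"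
  using compact_ops_scaleC[of K "-1"] by simp

text \<open>From |adj K y|^2 <= |y| |K (adj K y)|: where the compact operator
  \<open>K o\<^sub>L adj K\<close> gives a Cauchy subsequence, so does \<open>adj K\<close>.\<close>

lemma compact_ops_adj:
  fixes K :: "'a::chilbert_space \<Rightarrow>\<^sub>L 'b::chilbert_space"
  assumes K: "K \<in> compact_ops" shows "adj K \<in> compact_ops"
proof (rule compact_opsI)
  have Kb: "K \<in> bounded_ops" using K by (rule compact_ops_bounded)
  then show "adj K \<in> bounded_ops" by (rule adj_bounded_ops)
  fix x :: "nat \<Rightarrow> 'b" assume x: "\<And>n. norm (x n) \<le> 1"
  obtain r a where r: "strict_mono r" and a: "(\<lambda>n. (K o\<^sub>L adj K) (x (r n))) \<longlonglongrightarrow> a"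
    using compact_ops_subseq[where x = x, OF compact_ops_compose_right[OF K adj_bounded_ops[OF Kb]] x] by blast
  have est: "(norm (adj K y))\<^sup>2 \<le> norm y * norm ((K o\<^sub>L adj K) y)" for y
  proof -
    have "complex_of_real ((norm (adj K y))\<^sup>2) = cinner y ((K o\<^sub>L adj K) y)"
      unfolding cinner_self[symmetric] by (simp add: cinner_adj[OF Kb])
    then have "(norm (adj K y))\<^sup>2 = cmod (cinner y ((K o\<^sub>L adj K) y))"
      by (metis abs_power2 norm_of_real real_norm_def)
    then show ?thesis using cinner_cauchy_schwarz by metis
  qed
  have "Cauchy (\<lambda>n. adj K (x (r n)))"
  proof (rule metric_CauchyI)
    fix e :: real assume "e > 0"
    \<comment> \<open>The squared norm has to fall below e^2, and differences of two vectors of the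
      unit ball have norm at most 2.\<close>
    then obtain N where N: "\<And>m n. m \<ge> N \<Longrightarrow> n \<ge> N \<Longrightarrow>
        dist ((K o\<^sub>L adj K) (x (r m))) ((K o\<^sub>L adj K) (x (r n))) < e\<^sup>2 / 2"
      using metric_CauchyD[OF LIMSEQ_imp_Cauchy[OF a], of "e\<^sup>2 / 2"] by auto
    have "dist (adj K (x (r m))) (adj K (x (r n))) < e" if "m \<ge> N" "n \<ge> N" for m n
    proof -
      let ?y = "x (r m) - x (r n)"
      have "norm ?y \<le> 2" using norm_triangle_ineq4[of "x (r m)" "x (r n)"] x[of "r m"] x[of "r n"] by linarith
      then have "(norm (adj K ?y))\<^sup>2 \<le> 2 * norm ((K o\<^sub>L adj K) ?y)"
        by (intro order_trans[OF est] mult_right_mono) auto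
      also have "\<dots> < e\<^sup>2" using N[OF that] by (simp add: dist_norm blinfun.bilinear_simps)
      finally show ?thesis using \<open>e > 0\<close> by (simp add: dist_norm blinfun.bilinear_simps power2_less_imp_less)
    qed
    then show "\<exists>N. \<forall>m\<ge>N. \<forall>n\<ge>N. dist (adj K (x (r m))) (adj K (x (r n))) < e" by blast
  qed
  then show "\<exists>r l. strict_mono r \<and> (\<lambda>n. adj K (x (r n))) \<longlonglongrightarrow> l"
    using r by (auto simp: Cauchy_convergent_iff convergent_def)
qed

lemma closed_compact_ops: "closed (compact_ops :: ('a::complex_inner \<Rightarrow>\<^sub>L 'b::chilbert_space) set)"
proof (rule closed_sequential_limits[THEN iffD2], intro allI impI, elim conjE)
  fix X and L :: "'a \<Rightarrow>\<^sub>L 'b" assume X: "\<forall>n. X n \<in> compact_ops" and L: "X \<longlonglongrightarrow> L"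
  have "\<exists>k. finite k \<and> blinfun_apply L ` cball 0 1 \<subseteq> (\<Union>x\<in>k. ball x e)" if "e > 0" for e
  proof -
    obtain n where n: "norm (X n - L) < e / 2"
      using LIMSEQ_D[OF L, of "e / 2"] \<open>e > 0\<close> by auto
    obtain k where k: "finite k" "blinfun_apply (X n) ` cball 0 1 \<subseteq> (\<Union>x\<in>k. ball x (e / 2))"
      using X[rule_format, of n, unfolded compact_ops_totally_bounded] half_gt_zero[OF \<open>e > 0\<close>] by blast
    have "L x \<in> (\<Union>x\<in>k. ball x e)" if "norm x \<le> 1" for x
    proof -
      have "X n x \<in> (\<Union>x\<in>k. ball x (e / 2))" using subsetD[OF k(2) imageI[of x]] that by simp
      then obtain y where y: "y \<in> k" "dist y (X n x) < e / 2" unfolding UN_iff mem_ball by blast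
      have "dist (X n x) (L x) = norm ((X n - L) x)" by (simp add: dist_norm blinfun.bilinear_simps)
      also have "\<dots> \<le> norm (X n - L) * norm x" by (rule norm_blinfun)
      also have "\<dots> \<le> norm (X n - L)" using that by (simp add: mult_left_le)
      finally have "dist y (L x) < e" using n y(2) dist_triangle[of y "L x" "X n x"] by linarith
      then show ?thesis using y(1) by auto
    qed
    then show ?thesis using k(1) by auto
  qed
  moreover have "L \<in> bounded_ops"
    using closed_sequentially[OF closed_bounded_ops _ L] X compact_ops_bounded by blast
  ultimately show "L \<in> compact_ops"
    unfolding compact_ops_totally_bounded by blast
qed

text \<open>Otherwise some subsequence of the images stays away from 0 and, by compactness, has a
  limit point \<open>l\<close>. Moving \<open>K\<close> to the other side of the inner product shows
  that \<open>l\<close> is orthogonal to itself.\<close>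

lemma compact_ops_weakly_null:
  fixes K :: "'a::chilbert_space \<Rightarrow>\<^sub>L 'b::chilbert_space"
  assumes K: "K \<in> compact_ops" and B: "\<And>n. norm (x n) \<le> B"
    and weak: "\<And>y. (\<lambda>n. cinner y (x n)) \<longlonglongrightarrow> 0"
  shows "(\<lambda>n. K (x n)) \<longlonglongrightarrow> 0"
proof (rule ccontr)
  assume "\<not> (\<lambda>n. K (x n)) \<longlonglongrightarrow> 0"
  then obtain e where e: "e > 0" and "\<exists>\<^sub>\<infinity>n. \<not> norm (K (x n)) < e"
    unfolding tendsto_iff dist_0_norm dist_commute[of _ 0] frequently_sequentially[symmetric]
    by (auto simp: not_eventually cofinite_eq_sequentially)
  then have inf: "infinite {n. \<not> norm (K (x n)) < e}" by (simp add: frequently_cofinite)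
  obtain s where s: "strict_mono (s :: nat \<Rightarrow> nat)" "\<And>n. \<not> norm (K (x (s n))) < e"
    using infinite_enumerate[OF inf] by blast
  obtain r l where r: "strict_mono r" and l: "(\<lambda>n. K (x (s (r n)))) \<longlonglongrightarrow> l"
    using compact_ops_subseq[where x = "\<lambda>n. x (s n)", OF K B] by blast
  have "(\<lambda>n. cinner l (K (x (s (r n))))) \<longlonglongrightarrow> cinner l l" by (intro tendsto_cinner tendsto_const l)
  moreover have "(\<lambda>n. cinner l (K (x (s (r n))))) \<longlonglongrightarrow> 0"
    using LIMSEQ_subseq_LIMSEQ[OF weak[of "adj K l"] strict_mono_o[OF s(1) r]]
    by (simp add: o_def cinner_adj[OF compact_ops_bounded[OF K]])
  ultimately have "cinner l l = 0" by (rule LIMSEQ_unique)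
  then have "l = 0" by (simp add: cinner_self)
  moreover have "e \<le> norm l"
    by (rule tendsto_lowerbound[OF tendsto_norm[OF l]]) (use s(2) in \<open>auto simp: not_less\<close>)
  ultimately show False using e by simp
qed

subsection \<open>Rank-one operators\<close>

text \<open>The operator |x><y| of bra-ket notation.\<close>

definition rank_one :: "'b::complex_inner \<Rightarrow> 'a::complex_inner \<Rightarrow> ('a \<Rightarrow>\<^sub>L 'b)" where
  "rank_one x y = Blinfun (\<lambda>z. cinner y z *\<^sub>C x)"

lemma rank_one_apply: "rank_one x y z = cinner y z *\<^sub>C x"
proof -
  have "bounded_linear (\<lambda>z. cinner y z *\<^sub>C x)"
  proof (rule bounded_linear_intro)
    show "norm (cinner y z *\<^sub>C x) \<le> norm z * (norm y * norm x)" for z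
      using mult_right_mono[OF cinner_cauchy_schwarz[of y z], of "norm x"] by (simp add: norm_scaleC mult_ac)
    show "cinner y (r *\<^sub>R z) *\<^sub>C x = r *\<^sub>R cinner y z *\<^sub>C x" for r z
      by (simp add: cinner_scaleR_right scaleC_scaleC scaleC_of_real[symmetric, of r "_ *\<^sub>C x"])
  qed (simp add: cinner_simps scaleC_add_left)
  then show ?thesis by (simp add: rank_one_def bounded_linear_Blinfun_apply)
qed

lemma rank_one_bounded: "rank_one x y \<in> bounded_ops"
  by (simp add: bounded_ops_def rank_one_apply cinner_simps scaleC_scaleC)

lemma rank_one_compact:
  fixes y :: "'a::complex_inner"
  shows "rank_one x y \<in> compact_ops"
proof (rule compact_opsI[OF rank_one_bounded])
  fix u :: "nat \<Rightarrow> 'a" assume u: "\<And>n. norm (u n) \<le> 1"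
  have "bounded (range (\<lambda>n. cinner y (u n)))"
    unfolding bounded_iff
    using order_trans[OF cinner_cauchy_schwarz mult_left_mono[OF u, of "norm y"]] by (intro exI[of _ "norm y"]) auto
  then obtain l r where r: "strict_mono r" and l: "(\<lambda>n. cinner y (u (r n))) \<longlonglongrightarrow> l"
    using bounded_imp_convergent_subsequence[of "\<lambda>n. cinner y (u n)"] by (auto simp: o_def)
  have "(\<lambda>n. cinner y (u (r n)) *\<^sub>C x - l *\<^sub>C x) \<longlonglongrightarrow> 0"
  proof (rule Lim_null_comparison)
    show "(\<lambda>n. norm (cinner y (u (r n)) - l) * norm x) \<longlonglongrightarrow> 0"
      using l by (intro tendsto_mult_left_zero tendsto_norm_zero LIM_zero)
  qed (simp add: norm_scaleC flip: complex_vector.scale_left_diff_distrib)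
  then have "(\<lambda>n. rank_one x y (u (r n))) \<longlonglongrightarrow> l *\<^sub>C x" by (simp add: rank_one_apply LIM_zero_iff)
  with r show "\<exists>r l. strict_mono r \<and> (\<lambda>n. rank_one x y (u (r n))) \<longlonglongrightarrow> l" by blast
qed

lemma compose_rank_one:
  "S \<in> bounded_ops \<Longrightarrow> S o\<^sub>L rank_one x y = rank_one (S x) y"
  "S \<in> bounded_ops \<Longrightarrow> rank_one x y o\<^sub>L adj S = rank_one x (S y)"
  "S \<in> bounded_ops \<Longrightarrow> rank_one x y o\<^sub>L S = rank_one x (adj S y)"
  by (auto intro!: blinfun_eqI simp: rank_one_apply bounded_opsD cinner_adj' cinner_adj)

lemma norm_blinfun_bound_unit:
  fixes A :: "'a::real_normed_vector \<Rightarrow>\<^sub>L 'b::real_normed_vector"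
  assumes "0 \<le> c" "\<And>x. norm x = 1 \<Longrightarrow> norm (A x) \<le> c" shows "norm A \<le> c"
proof (rule norm_blinfun_bound[OF assms(1)])
  fix x
  show "norm (A x) \<le> c * norm x"
  proof (cases "x = 0")
    case False
    then show ?thesis
      using assms(2)[of "(1 / norm x) *\<^sub>R x"] by (simp add: blinfun.bilinear_simps divide_le_eq)
  qed simp
qed

lemma norm_rank_one: "norm (rank_one x y) \<le> norm x * norm y"
proof (rule norm_blinfun_bound)
  show "norm (rank_one x y z) \<le> norm x * norm y * norm z" for z
    using mult_right_mono[OF cinner_cauchy_schwarz[of y z], of "norm x"]
    by (simp add: rank_one_apply norm_scaleC mult_ac)
qed simp

lemma rank_one_combination: "rank_one x (c *\<^sub>C y + z) = scaleC_op (cnj c) (rank_one x y) + rank_one x z"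
  by (auto intro!: blinfun_eqI simp: rank_one_apply scaleC_op.rep_eq blinfun.bilinear_simps
      scaleC_add_left scaleC_scaleC cinner_simps)

lemma rank_one_diff: "rank_one x (y - z) = rank_one x y - rank_one x z"
  by (auto intro!: blinfun_eqI simp: rank_one_apply blinfun.bilinear_simps cinner_simps
      complex_vector.scale_left_diff_distrib)

section \<open>Orthonormal families, finite projections and approximation of compact
  operators\<close>

definition orthonormal_family :: "('i \<Rightarrow> 'h::complex_inner) \<Rightarrow> bool" where
  "orthonormal_family b \<longleftrightarrow> (\<forall>i j. cinner (b i) (b j) = (if i = j then 1 else 0))"

definition finite_proj :: "('i \<Rightarrow> 'h::complex_inner) \<Rightarrow> 'i set \<Rightarrow> 'h \<Rightarrow> 'h" where
  "finite_proj b F x = (\<Sum>i\<in>F. cinner (b i) x *\<^sub>C b i)"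

lemma finite_proj_linear:
  "finite_proj b F (x + y) = finite_proj b F x + finite_proj b F y"
  "finite_proj b F (x - y) = finite_proj b F x - finite_proj b F y"
  "finite_proj b F (c *\<^sub>C x) = c *\<^sub>C finite_proj b F x"
  by (simp_all add: finite_proj_def cinner_simps scaleC_add_left sum.distrib sum_subtractf
      complex_vector.scale_left_diff_distrib scaleC_scaleC complex_vector.scale_sum_right)

lemma finite_proj_basis:
  assumes "orthonormal_family b" "finite F" "i \<in> F" shows "finite_proj b F (b i) = b i"
proof -
  have "finite_proj b F (b i) = (\<Sum>j\<in>F. if j = i then b i else 0)"
    unfolding finite_proj_def using assms(1)
    by (intro sum.cong) (auto simp: orthonormal_family_def scaleC_one)
  then show ?thesis using assms by simp
qed

lemma cinner_finite_proj:
  assumes "orthonormal_family b" "finite F" "i \<in> F" shows "cinner (b i) (finite_proj b F x) = cinner (b i) x"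
proof -
  have "cinner (b i) (finite_proj b F x) = (\<Sum>j\<in>F. if j = i then cinner (b i) x else 0)"
    unfolding finite_proj_def cinner_sum_right using assms(1)
    by (intro sum.cong) (auto simp: orthonormal_family_def cinner_scaleC_right)
  then show ?thesis using assms by simp
qed

lemma norm_finite_proj:
  assumes b: "orthonormal_family b" and F: "finite F"
  shows "(norm x)\<^sup>2 = (norm (x - finite_proj b F x))\<^sup>2 + (norm (finite_proj b F x))\<^sup>2"
    and "(norm (finite_proj b F x))\<^sup>2 = (\<Sum>i\<in>F. (cmod (cinner (b i) x))\<^sup>2)"
proof -
  have expand: "cinner (finite_proj b F x) y = (\<Sum>i\<in>F. cnj (cinner (b i) x) * cinner (b i) y)" for y
    by (simp add: finite_proj_def cinner_sum_left cinner_scaleC_left)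
  have "cinner (finite_proj b F x) (x - finite_proj b F x) = 0"
    by (simp add: expand cinner_diff_right cinner_finite_proj[OF b F])
  then have "cinner (x - finite_proj b F x) (finite_proj b F x) = 0"
    by (metis cinner_commute complex_cnj_zero)
  from pythagoras_cinner[OF this]
  show "(norm x)\<^sup>2 = (norm (x - finite_proj b F x))\<^sup>2 + (norm (finite_proj b F x))\<^sup>2" by simp
  have "complex_of_real ((norm (finite_proj b F x))\<^sup>2) = (\<Sum>i\<in>F. complex_of_real ((cmod (cinner (b i) x))\<^sup>2))"
    unfolding cinner_self[symmetric] expand complex_norm_square
    by (intro sum.cong) (auto simp: cinner_finite_proj[OF b F] mult.commute)
  then show "(norm (finite_proj b F x))\<^sup>2 = (\<Sum>i\<in>F. (cmod (cinner (b i) x))\<^sup>2)"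
    by (simp only: of_real_eq_iff flip: of_real_sum)
qed

lemma bessel_inequality:
  assumes "orthonormal_family b" "finite F"
  shows "(\<Sum>i\<in>F. (cmod (cinner (b i) x))\<^sup>2) \<le> (norm x)\<^sup>2"
  using norm_finite_proj[OF assms, of x] zero_le_power2[of "norm (x - finite_proj b F x)"] by linarith

lemma norm_diff_finite_proj_le:
  assumes "orthonormal_family b" "finite F" shows "norm (x - finite_proj b F x) \<le> norm x"
proof (rule power2_le_imp_le[OF _ norm_ge_zero])
  show "(norm (x - finite_proj b F x))\<^sup>2 \<le> (norm x)\<^sup>2"
    using norm_finite_proj(1)[OF assms, of x] zero_le_power2[of "norm (finite_proj b F x)"] by linarith
qed

lemma finite_proj_span:
  assumes b: "orthonormal_family b" and "s \<in> complex_vector.span (range b)"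
  shows "\<exists>F. finite F \<and> (\<forall>G. F \<subseteq> G \<longrightarrow> finite G \<longrightarrow> finite_proj b G s = s)"
  using assms(2)
proof (induction rule: complex_vector.span_induct_alt)
  case base
  show ?case by (intro exI[of _ "{}"]) (simp add: finite_proj_def)
next
  case (step c x y)
  then obtain i F where i: "x = b i" and F: "finite F"
    "\<And>G. F \<subseteq> G \<Longrightarrow> finite G \<Longrightarrow> finite_proj b G y = y" by blast
  have "finite_proj b G (c *\<^sub>C x + y) = c *\<^sub>C x + y" if "insert i F \<subseteq> G" "finite G" for G
    using that F(2)[of G] finite_proj_basis[OF b, of G i] by (simp add: finite_proj_linear i)
  with F(1) show ?case by (intro exI[of _ "insert i F"]) blast
qed

definition total_family :: "('i \<Rightarrow> 'h::complex_inner) \<Rightarrow> bool" where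
  "total_family b \<longleftrightarrow> (\<forall>x. x \<in> closure (complex_vector.span (range b)))"

text \<open>A projection that fixes a nearby \<open>s\<close> has the same residual on
  \<open>x\<close> as on \<open>x - s\<close>. The quantification over all larger \<open>G\<close>
  lets finitely many vectors share one projection.\<close>

lemma finite_proj_approx:
  assumes b: "orthonormal_family b" and "total_family b" and "e > 0"
  shows "\<exists>F. finite F \<and> (\<forall>G. F \<subseteq> G \<longrightarrow> finite G \<longrightarrow> norm (x - finite_proj b G x) < e)"
proof -
  obtain s where s: "s \<in> complex_vector.span (range b)" "norm (x - s) < e"
    using assms(2,3) unfolding total_family_def closure_approachable
    by (metis dist_commute dist_norm)
  obtain F where F: "finite F" "\<And>G. F \<subseteq> G \<Longrightarrow> finite G \<Longrightarrow> finite_proj b G s = s"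
    using finite_proj_span[OF b s(1)] by blast
  have "norm (x - finite_proj b G x) < e" if G: "F \<subseteq> G" "finite G" for G
  proof -
    have "x - finite_proj b G x = (x - s) - finite_proj b G (x - s)"
      using F(2)[OF G] by (simp add: finite_proj_linear)
    then have "norm (x - finite_proj b G x) \<le> norm (x - s)"
      using norm_diff_finite_proj_le[OF b G(2), of "x - s"] by (simp only:)
    with s(2) show ?thesis by simp
  qed
  then show ?thesis using F(1) by blast
qed

lemma blinfun_eqI_total:
  fixes S T :: "'h::complex_inner \<Rightarrow>\<^sub>L 'k::complex_inner"
  assumes "S \<in> bounded_ops" "T \<in> bounded_ops" "total_family b" and eq: "\<And>i. blinfun_apply S (b i) = T (b i)"
  shows "S = T"
proof (rule blinfun_eqI)
  fix x
  have span: "S s = T s" if "s \<in> complex_vector.span (range b)" for s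
    using that by (induction rule: complex_vector.span_induct_alt)
      (auto simp: blinfun.bilinear_simps bounded_opsD[OF assms(1)] bounded_opsD[OF assms(2)] eq)
  obtain s where s: "\<And>n. s n \<in> complex_vector.span (range b)" "s \<longlonglongrightarrow> x"
    using assms(3) unfolding total_family_def closure_sequential by blast
  have "(\<lambda>n. S (s n)) \<longlonglongrightarrow> S x" "(\<lambda>n. T (s n)) \<longlonglongrightarrow> T x" using s(2) by (intro tendsto_intros; assumption)+
  then show "S x = T x" using span[OF s(1)] LIMSEQ_unique by simp
qed

text \<open>The image of the unit ball is totally bounded, so one finite projection is uniformly
  close to the identity on it. Hence the projection composed with \<open>K\<close> is norm-close to
  \<open>K\<close>; it is a finite sum of operators \<open>rank_one (b i) y\<close>, which lie in
  \<open>A\<close> because \<open>y\<close> is a limit of combinations of basis vectors.\<close>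

lemma compact_ops_subset_if_rank_one:
  fixes A :: "('h::chilbert_space \<Rightarrow>\<^sub>L 'h) set"
  assumes A: "cstar_subalgebra A" and b: "orthonormal_family b" "total_family b"
    and units: "\<And>i j. rank_one (b i) (b j) \<in> A"
  shows "compact_ops \<subseteq> A"
proof
  fix K :: "'h \<Rightarrow>\<^sub>L 'h" assume K: "K \<in> compact_ops"
  have Kb: "K \<in> bounded_ops" using K by (rule compact_ops_bounded)
  have span: "rank_one (b i) y \<in> A" if "y \<in> complex_vector.span (range b)" for i y
    using that
  proof (induction rule: complex_vector.span_induct_alt)
    case base
    have "rank_one (b i) (0::'h) = 0" by (auto intro!: blinfun_eqI simp: rank_one_apply)
    then show ?case using cstar_subalgebraD(2)[OF A] by simp
  next
    case (step c y z)
    then show ?case using units by (auto simp: rank_one_combination intro!: cstar_subalgebraD[OF A])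
  qed
  have all: "rank_one (b i) y \<in> A" for i y
  proof -
    obtain s where s: "\<And>n. s n \<in> complex_vector.span (range b)" "s \<longlonglongrightarrow> y"
      using b(2) unfolding total_family_def closure_sequential by blast
    have "(\<lambda>n. norm (b i) * norm (s n - y)) \<longlonglongrightarrow> 0"
      using s(2) by (intro tendsto_mult_right_zero tendsto_norm_zero LIM_zero)
    then have "(\<lambda>n. rank_one (b i) (s n) - rank_one (b i) y) \<longlonglongrightarrow> 0"
      by (rule Lim_null_comparison[rotated]) (simp add: norm_rank_one flip: rank_one_diff)
    then have "(\<lambda>n. rank_one (b i) (s n)) \<longlonglongrightarrow> rank_one (b i) y" by (rule LIM_zero_cancel)
    then show ?thesis by (rule closed_sequentially[OF cstar_subalgebraD(7)[OF A], rotated]) (rule span[OF s(1)])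
  qed
  have "\<exists>y\<in>A. dist y K < e" if "e > 0" for e
  proof -
    have "e / 4 > 0" using that by simp
    then obtain k where k: "finite k" "blinfun_apply K ` cball 0 1 \<subseteq> (\<Union>x\<in>k. ball x (e / 4))"
      using K[unfolded compact_ops_totally_bounded] by blast
    have "\<forall>y. \<exists>F. finite F \<and> (\<forall>G. F \<subseteq> G \<longrightarrow> finite G \<longrightarrow> norm (y - finite_proj b G y) < e / 4)"
      using finite_proj_approx[OF b \<open>e / 4 > 0\<close>] by blast
    then obtain F where F: "\<And>y. finite (F y)"
      "\<And>y G. F y \<subseteq> G \<Longrightarrow> finite G \<Longrightarrow> norm (y - finite_proj b G y) < e / 4" by metis
    define G where "G = (\<Union>y\<in>k. F y)"
    have G: "finite G" using k(1) F(1) by (simp add: G_def)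
    have Gk: "norm (y - finite_proj b G y) < e / 4" if "y \<in> k" for y
      by (rule F(2)[OF _ G]) (use that in \<open>auto simp: G_def\<close>)
    \<comment> \<open>The composite of \<open>finite_proj b G\<close> and \<open>K\<close>, with
      \<open>K\<close> absorbed into the second argument through its adjoint.\<close>
    define P where "P = (\<Sum>i\<in>G. rank_one (b i) (adj K (b i)))"
    have P: "P x = finite_proj b G (K x)" for x
      by (simp add: P_def finite_proj_def blinfun.sum_left rank_one_apply cinner_adj[OF Kb])
    have "norm (P - K) \<le> e / 2"
    proof (rule norm_blinfun_bound_unit)
      fix x :: 'h assume "norm x = 1"
      then obtain y where y: "y \<in> k" "norm (K x - y) < e / 4"
        using k(2) by (force simp: dist_norm norm_minus_commute)
      have "(P - K) x = - ((K x - y) - finite_proj b G (K x - y)) - (y - finite_proj b G y)"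
        by (simp add: P finite_proj_linear blinfun.bilinear_simps)
      also have "norm \<dots> \<le> norm ((K x - y) - finite_proj b G (K x - y)) + norm (y - finite_proj b G y)"
        by (metis norm_minus_cancel norm_triangle_ineq4)
      also have "\<dots> \<le> norm (K x - y) + e / 4"
        using norm_diff_finite_proj_le[OF b(1) G] Gk[OF y(1)] by (intro add_mono) auto
      finally show "norm ((P - K) x) \<le> e / 2" using y(2) by simp
    qed (use that in auto)
    moreover have "P \<in> A" unfolding P_def by (rule cstar_subalgebra_sum[OF A all])
    ultimately show ?thesis using that by (intro bexI[of _ P]) (auto simp: dist_norm)
  qed
  then have "K \<in> closure A" by (simp add: closure_approachable)
  then show "K \<in> A" using cstar_subalgebraD(7)[OF A] by simp
qed

text \<open>Makes spaces of operators into a Hilbert space complete, as needed for the limit that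
  defines the functional calculus.\<close>

instance chilbert_space \<subseteq> banach ..

section \<open>Continuous functions on the circle\<close>

lemma circle_continuous_add: "f \<in> circle_continuous \<Longrightarrow> g \<in> circle_continuous \<Longrightarrow> (\<lambda>z. f z + g z) \<in> circle_continuous"
  and circle_continuous_diff: "f \<in> circle_continuous \<Longrightarrow> g \<in> circle_continuous \<Longrightarrow> (\<lambda>z. f z - g z) \<in> circle_continuous"
  and circle_continuous_mult: "f \<in> circle_continuous \<Longrightarrow> g \<in> circle_continuous \<Longrightarrow> (\<lambda>z. f z * g z) \<in> circle_continuous"
  and circle_continuous_scale: "f \<in> circle_continuous \<Longrightarrow> (\<lambda>z. c * f z) \<in> circle_continuous"
  and circle_continuous_cnj: "f \<in> circle_continuous \<Longrightarrow> (\<lambda>z. cnj (f z)) \<in> circle_continuous"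
  and circle_continuous_zero: "(\<lambda>z. 0) \<in> circle_continuous"
  by (auto simp: circle_continuous_def intro!: continuous_intros)

lemma circle_continuous_one: "(\<lambda>z. if z \<in> sphere 0 1 then 1 else 0) \<in> circle_continuous"
proof -
  have "continuous_on (sphere 0 1) (\<lambda>z::complex. if z \<in> sphere 0 1 then 1 else 0 :: complex)
      \<longleftrightarrow> continuous_on (sphere 0 1 :: complex set) (\<lambda>z. 1 :: complex)"
    by (rule continuous_on_cong) auto
  then show ?thesis by (simp add: circle_continuous_def)
qed

lemma circle_continuous_eqI:
  assumes "f \<in> circle_continuous" "g \<in> circle_continuous" "\<And>z. cmod z = 1 \<Longrightarrow> f z = g z"
  shows "f = g"
proof
  fix z show "f z = g z"
    using assms by (cases "cmod z = 1") (auto simp: circle_continuous_def)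
qed

lemma cnj_mult_self: "cmod z = 1 \<Longrightarrow> cnj z * z = 1" "cmod z = 1 \<Longrightarrow> z * cnj z = 1"
  by (simp_all add: mult.commute[of "cnj z"] flip: complex_norm_square)

lemma tendsto_divide_Suc: "(\<lambda>n. c / real (Suc n)) \<longlonglongrightarrow> 0"
  using tendsto_mult_right_zero[OF LIMSEQ_Suc[OF lim_1_over_n], of c] by simp

section \<open>Monomials on the circle\<close>

lemma integral_circle_measure:
  fixes f :: "complex \<Rightarrow> complex"
  assumes [measurable]: "f \<in> borel_measurable borel"
  shows "(LINT z|circle_measure. f z) = (LINT t|lborel. (indicator {0..2*pi} t / (2*pi)) *\<^sub>R f (cis t))"
proof -
  have "uniform_measure lborel {0..2 * pi} = density lborel (\<lambda>t. ennreal (indicator {0..2*pi} t / (2*pi)))"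
    unfolding uniform_measure_def
    by (rule density_cong) (auto simp: indicator_def divide_ennreal simp flip: ennreal_1)
  then show ?thesis
    unfolding circle_measure_def by (simp add: integral_distr integral_density)
qed

text \<open>On the circle the integrand is \<open>cis\<close> of (n - m) t. For distinct exponents
  its antiderivative takes equal values at 0 and 2 pi, because n - m is an integer.\<close>

lemma integral_circle_monomial:
  "(LINT z|circle_measure. cnj (z ^ m) * z ^ n) = (if m = n then 1 else 0)"
proof -
  have meas: "(\<lambda>z. cnj (z ^ m) * z ^ n :: complex) \<in> borel_measurable borel"
    by (intro borel_measurable_continuous_onI continuous_intros)
  have cis: "cnj (cis t ^ m) * cis t ^ n = cis ((real n - real m) * t)" for t
    by (simp add: Complex.DeMoivre cis_cnj cis_mult algebra_simps)
  have "(LINT z|circle_measure. cnj (z ^ m) * z ^ n) =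
      (LINT t|lborel. (indicator {0..2*pi} t / (2*pi)) *\<^sub>R cis ((real n - real m) * t))"
    unfolding integral_circle_measure[OF meas] cis ..
  also have "\<dots> = (1 / (2*pi)) *\<^sub>R (LINT t|lborel. indicator {0..2*pi} t *\<^sub>R cis ((real n - real m) * t))"
    by (subst integral_scaleR_right[symmetric]) (simp_all add: mult.commute)
  also have "(LINT t|lborel. indicator {0..2*pi} t *\<^sub>R cis ((real n - real m) * t)) =
      (if m = n then complex_of_real (2 * pi) else 0)"
  proof (cases "m = n")
    case True
    then show ?thesis by (simp add: scaleR_conv_of_real)
  next
    case False
    define k where "k = real n - real m"
    have k: "k \<noteq> 0" using False by (simp add: k_def)
    have "(LINT t|lborel. indicator {0..2*pi} t *\<^sub>R cis (k * t)) =
        cis (k * (2*pi)) / (\<i> * k) - cis (k * 0) / (\<i> * k)"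
    proof (rule integral_FTC_Icc)
      show "((\<lambda>t. cis (k * t) / (\<i> * k)) has_vector_derivative cis (k * t)) (at t within {0..2*pi})" for t
      proof -
        define c where "c = \<i> * complex_of_real k"
        have "c \<noteq> 0" using k by (simp add: c_def)
        then have "((\<lambda>w. exp (c * w) / c) has_field_derivative exp (c * of_real t)) (at (complex_of_real t))"
          by (auto intro!: derivative_eq_intros)
        from has_vector_derivative_real_field[OF this] show ?thesis by (simp add: cis_conv_exp c_def mult.assoc)
      qed
    qed (auto intro!: continuous_intros)
    also have "cis (k * (2*pi)) = 1"
      using cis_multiple_2pi[of k] by (simp add: k_def mult_ac)
    finally show ?thesis using False by (simp add: k_def)
  qed
  finally show ?thesis by (simp add: scaleR_conv_of_real)
qed

lemma integrable_circle_monomial: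
  "integrable circle_measure (\<lambda>z. cnj (z ^ m) * z ^ n)"
proof (rule circle.integrable_const_bound[where B = 1])
  show "AE z in circle_measure. norm (cnj (z ^ m) * z ^ n) \<le> 1"
    using AE_circle by eventually_elim (simp add: norm_mult norm_power)
  have "(\<lambda>z. cnj (z ^ m) * z ^ n :: complex) \<in> borel_measurable borel"
    by (intro borel_measurable_continuous_onI continuous_intros)
  then show "(\<lambda>z. cnj (z ^ m) * z ^ n) \<in> borel_measurable circle_measure" by simp
qed

text \<open>The vectors \<open>w j\<close> are arbitrary: orthogonality comes from the powers of z,
  which leave only the diagonal terms of the expanded square. Below, the \<open>w j\<close> run
  through an orbit of the isometry.\<close>

lemma parseval_circle:
  fixes w :: "nat \<Rightarrow> 'h::complex_inner"
  shows "integrable circle_measure (\<lambda>z. (norm (\<Sum>j\<le>M. z ^ j *\<^sub>C w j))\<^sup>2)"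
    and "(LINT z|circle_measure. (norm (\<Sum>j\<le>M. z ^ j *\<^sub>C w j))\<^sup>2) = (\<Sum>j\<le>M. (norm (w j))\<^sup>2)"
proof -
  let ?F = "\<lambda>z. \<Sum>j\<le>M. z ^ j *\<^sub>C w j"
  have sq: "complex_of_real ((norm (?F z))\<^sup>2) = (\<Sum>i\<le>M. \<Sum>j\<le>M. cinner (w i) (w j) * (cnj (z ^ i) * z ^ j))" for z
    unfolding cinner_self[symmetric]
    by (subst sum.swap) (simp add: cinner_sum_left cinner_sum_right cinner_scaleC_left cinner_scaleC_right
        mult_ac sum_distrib_left)
  have int: "integrable circle_measure (\<lambda>z. complex_of_real ((norm (?F z))\<^sup>2))"
    unfolding sq by (intro Bochner_Integration.integrable_sum integrable_mult_right integrable_circle_monomial)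
  then show "integrable circle_measure (\<lambda>z. (norm (?F z))\<^sup>2)"
    by (simp only: complex_of_real_integrable_eq)
  have "complex_of_real (LINT z|circle_measure. (norm (?F z))\<^sup>2) =
      (\<Sum>i\<le>M. \<Sum>j\<le>M. cinner (w i) (w j) * (if i = j then 1 else 0))"
    unfolding integral_complex_of_real[symmetric] sq
    by (subst Bochner_Integration.integral_sum, intro Bochner_Integration.integrable_sum integrable_mult_right integrable_circle_monomial,
      intro sum.cong refl, subst Bochner_Integration.integral_sum)
      (simp_all add: integrable_circle_monomial integral_circle_monomial del: complex_cnj_power)
  also have "\<dots> = complex_of_real (\<Sum>j\<le>M. (norm (w j))\<^sup>2)"
    by (simp add: cinner_self if_distrib cong: if_cong)
  finally show "(LINT z|circle_measure. (norm (?F z))\<^sup>2) = (\<Sum>j\<le>M. (norm (w j))\<^sup>2)"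
    using of_real_eq_iff by blast
qed

section \<open>Polynomials of an operator\<close>

lemma scaleC_op_add: "scaleC_op (a + b) A = scaleC_op a A + scaleC_op b A"
  "scaleC_op c (A + B) = scaleC_op c A + scaleC_op c B"
  "scaleC_op a (scaleC_op b A) = scaleC_op (a * b) A"
  by (auto intro!: blinfun_eqI simp: scaleC_op.rep_eq blinfun.bilinear_simps scaleC_add_left scaleC_add_right scaleC_scaleC)

text \<open>Evaluation of \<open>p\<close> at \<open>T\<close> in Horner form, so that
  \<open>pCons\<close> induction follows the definition.\<close>

definition op_poly :: "('h::chilbert_space \<Rightarrow>\<^sub>L 'h) \<Rightarrow> complex poly \<Rightarrow> ('h \<Rightarrow>\<^sub>L 'h)" where
  "op_poly T p = fold_coeffs (\<lambda>a B. scaleC_op a id_blinfun + (T o\<^sub>L B)) p 0"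

lemma op_poly_0 [simp]: "op_poly T 0 = 0"
  by (simp add: op_poly_def)

lemma op_poly_pCons [simp]: "op_poly T (pCons a p) = scaleC_op a id_blinfun + (T o\<^sub>L op_poly T p)"
proof (cases "p = 0 \<and> a = 0")
  case True
  then show ?thesis by (simp add: op_poly_def)
qed (auto simp: op_poly_def)

lemma op_poly_bounded_ops: "T \<in> bounded_ops \<Longrightarrow> op_poly T p \<in> bounded_ops"
  by (induction p) (auto intro!: bounded_ops_intros)

lemma op_poly_add: "op_poly T (p + q) = op_poly T p + op_poly T q"
  by (induction p q rule: poly_induct2) (auto simp: scaleC_op_add blinfun_compose_simps)

lemma op_poly_smult: "T \<in> bounded_ops \<Longrightarrow> op_poly T (smult c p) = scaleC_op c (op_poly T p)"
  by (induction p) (auto simp: scaleC_op_add scaleC_op_compose)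

lemma op_poly_commute:
  assumes "B \<in> bounded_ops" "B o\<^sub>L T = T o\<^sub>L B"
  shows "B o\<^sub>L op_poly T p = op_poly T p o\<^sub>L B"
proof (induction p)
  case (pCons a p)
  have "B o\<^sub>L (T o\<^sub>L op_poly T p) = (T o\<^sub>L op_poly T p) o\<^sub>L B"
    by (metis pCons.IH assms(2) blinfun_compose_assoc)
  then show ?case using assms(1) by (simp add: blinfun_compose_simps scaleC_op_compose)
qed simp

lemma op_poly_mult: "T \<in> bounded_ops \<Longrightarrow> op_poly T (p * q) = op_poly T p o\<^sub>L op_poly T q"
  by (induction p) (auto simp: op_poly_add op_poly_smult blinfun_compose_simps scaleC_op_compose blinfun_compose_assoc)

lemma op_poly_monom_Suc: "op_poly T (monom 1 (Suc n)) = T o\<^sub>L op_poly T (monom 1 n)"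
  by (simp add: monom_Suc)

lemma op_poly_1 [simp]: "op_poly T 1 = id_blinfun"
  by (simp add: one_pCons)

lemma op_poly_monom_add:
  "T \<in> bounded_ops \<Longrightarrow> op_poly T (monom 1 (m + n)) = op_poly T (monom 1 m) o\<^sub>L op_poly T (monom 1 n)"
  by (simp flip: op_poly_mult add: mult_monom)

lemma op_poly_monom_apply: "op_poly T (monom 1 n) x = (blinfun_apply T ^^ n) x"
  by (induction n) (simp_all add: op_poly_monom_Suc)

lemma op_poly_monom_Suc': "T \<in> bounded_ops \<Longrightarrow> op_poly T (monom 1 (Suc n)) = op_poly T (monom 1 n) o\<^sub>L T"
  using op_poly_commute[of T T "monom 1 n"] by (simp add: op_poly_monom_Suc)

lemma adj_op_poly_monom:
  "T \<in> bounded_ops \<Longrightarrow> adj (op_poly T (monom 1 n)) = op_poly (adj T) (monom 1 n)"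
  by (induction n) (simp_all add: op_poly_monom_Suc adj_compose op_poly_bounded_ops op_poly_monom_Suc'[of "adj T"] adj_bounded_ops
      flip: op_poly_monom_Suc')


section \<open>Von Neumann's inequality for isometries\<close>

locale hilbert_isometry =
  fixes T :: "'h::chilbert_space \<Rightarrow>\<^sub>L 'h"
  assumes bounded: "T \<in> bounded_ops" and isometry: "adj T o\<^sub>L T = id_blinfun"
begin

lemma norm_apply [simp]: "norm (T x) = norm x"
  by (rule isometry_norm[OF bounded isometry])

lemma norm_apply_iterate [simp]: "norm ((blinfun_apply T ^^ n) x) = norm x"
  by (induction n) simp_all

text \<open>As a function of \<open>z\<close> on the circle, \<open>orbit_sum M z x\<close> has mean square norm \<open>(M + 1) \<parallel>x\<parallel>\<^sup>2\<close>, while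
  multiplying it by \<open>z\<close> differs from applying \<open>T\<close> by boundary terms only. Letting \<open>M\<close> grow transfers the
  bound for a polynomial on the circle to the operator.\<close>

primrec orbit_sum :: "nat \<Rightarrow> complex \<Rightarrow> 'h \<Rightarrow> 'h" where
  "orbit_sum 0 z x = x"
| "orbit_sum (Suc M) z x = z *\<^sub>C orbit_sum M z x + (blinfun_apply T ^^ Suc M) x"

text \<open>The same sum extended at its other end. Comparing both recursions leaves the boundary
  terms: z F - T F = z^(M+1) x - T^(M+1) x for F = \<open>orbit_sum M z x\<close>.\<close>

lemma orbit_sum_Suc': "orbit_sum (Suc M) z x = z ^ Suc M *\<^sub>C x + T (orbit_sum M z x)"
proof (induction M)
  case (Suc M)
  have "orbit_sum (Suc (Suc M)) z x = z *\<^sub>C orbit_sum (Suc M) z x + T ((blinfun_apply T ^^ Suc M) x)"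
    by simp
  also have "\<dots> = z ^ Suc (Suc M) *\<^sub>C x + T (z *\<^sub>C orbit_sum M z x + (blinfun_apply T ^^ Suc M) x)"
    unfolding Suc by (simp add: scaleC_add_right scaleC_scaleC blinfun.bilinear_simps bounded_opsD[OF bounded])
  finally show ?case by simp
qed simp

lemma orbit_sum_sum: "orbit_sum M z x = (\<Sum>j\<le>M. z ^ j *\<^sub>C (blinfun_apply T ^^ (M - j)) x)"
proof (induction M)
  case (Suc M)
  then show ?case
    unfolding sum.atMost_Suc_shift
    by (simp add: complex_vector.scale_sum_right scaleC_scaleC scaleC_one add.commute)
qed (simp add: scaleC_one)

lemma orbit_sum_commute:
  assumes "B \<in> bounded_ops" "B o\<^sub>L T = T o\<^sub>L B" shows "B (orbit_sum M z x) = orbit_sum M z (B x)"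
proof (induction M)
  case (Suc M)
  have BT: "B (T y) = T (B y)" for y using arg_cong[OF assms(2), of "\<lambda>A. blinfun_apply A y"] by simp
  have "B ((blinfun_apply T ^^ n) x) = (blinfun_apply T ^^ n) (B x)" for n
    by (induction n) (simp_all add: BT)
  with Suc show ?case by (simp add: blinfun.bilinear_simps bounded_opsD[OF assms(1)] BT)
qed simp

text \<open>What matters is that \<open>C\<close> does not depend on \<open>M\<close>: each Horner
  step adds one boundary term of norm at most 2 |x|, multiplied by the value at z of the remaining
  polynomial.\<close>

lemma poly_orbit_sum_bound:
  "\<exists>C\<ge>0. \<forall>M z x. cmod z = 1 \<longrightarrow>
    norm (poly p z *\<^sub>C orbit_sum M z x - op_poly T p (orbit_sum M z x)) \<le> C * norm x"
proof (induction p)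
  case 0
  show ?case by (intro exI[of _ 0]) simp
next
  case (pCons a p)
  then obtain C where C: "C \<ge> 0" "\<And>M z x. cmod z = 1 \<Longrightarrow>
      norm (poly p z *\<^sub>C orbit_sum M z x - op_poly T p (orbit_sum M z x)) \<le> C * norm x" by blast
  have "compact (poly p ` sphere 0 1)"
    by (intro compact_continuous_image continuous_intros compact_sphere)
  then have "bounded (poly p ` sphere 0 1)" by (rule compact_imp_bounded)
  then obtain B where "\<And>y. y \<in> poly p ` sphere 0 1 \<Longrightarrow> cmod y \<le> B" unfolding bounded_iff by blast
  then have B: "cmod (poly p z) \<le> B" if "cmod z = 1" for z using that by simp
  have "norm (poly (pCons a p) z *\<^sub>C orbit_sum M z x - op_poly T (pCons a p) (orbit_sum M z x)) \<le>
      (2 * B + C) * norm x" if z: "cmod z = 1" for M z x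
  proof -
    let ?F = "orbit_sum M z x"
    have F: "z *\<^sub>C ?F - T ?F = z ^ Suc M *\<^sub>C x - (blinfun_apply T ^^ Suc M) x"
      using orbit_sum_Suc'[of M z x] by (simp add: algebra_simps)
    have "poly (pCons a p) z *\<^sub>C ?F - op_poly T (pCons a p) ?F =
        poly p z *\<^sub>C (z *\<^sub>C ?F - T ?F) + T (poly p z *\<^sub>C ?F - op_poly T p ?F)"
      by (simp add: blinfun.bilinear_simps scaleC_op.rep_eq scaleC_add_left scaleC_scaleC scaleC_diff_right
          bounded_opsD[OF bounded] mult.commute)
    also have "norm \<dots> \<le> cmod (poly p z) * norm (z *\<^sub>C ?F - T ?F) + norm (poly p z *\<^sub>C ?F - op_poly T p ?F)"
      by (rule order_trans[OF norm_triangle_ineq]) (simp add: norm_scaleC)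
    also have "\<dots> \<le> B * (2 * norm x) + C * norm x"
    proof (intro add_mono mult_mono B C z)
      have "norm (z ^ Suc M *\<^sub>C x - (blinfun_apply T ^^ Suc M) x) \<le>
          norm (z ^ Suc M *\<^sub>C x) + norm ((blinfun_apply T ^^ Suc M) x)" by (rule norm_triangle_ineq4)
      then show "norm (z *\<^sub>C ?F - T ?F) \<le> 2 * norm x"
        unfolding F using norm_apply_iterate[of "Suc M" x]
        by (simp only: norm_scaleC norm_power z norm_mult power_one mult_1_left)
      show "0 \<le> B" using order_trans[OF norm_ge_zero B[OF z]] .
    qed auto
    finally show ?thesis by (simp add: algebra_simps)
  qed
  moreover have "0 \<le> 2 * B + C" using C(1) order_trans[OF norm_ge_zero B[of 1]] by simp
  ultimately show ?case by blast
qed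

text \<open>Since p(T) commutes with \<open>T\<close>, it maps the orbit sum of \<open>x\<close> to
  the orbit sum of p(T) x. Parseval therefore turns a pointwise estimate on the circle into one
  between |p(T) x|^2 and |x|^2, up to an error that is bounded while both sides are multiplied by M
  + 1.\<close>

lemma von_neumann_inequality:
  assumes s: "\<And>z. cmod z = 1 \<Longrightarrow> cmod (poly p z) \<le> s"
  shows "norm (op_poly T p) \<le> s"
proof (rule norm_blinfun_bound)
  show s0: "0 \<le> s" using order_trans[OF norm_ge_zero s[of 1]] by simp
  fix x
  let ?P = "op_poly T p"
  obtain C where C: "C \<ge> 0" "\<And>M z x. cmod z = 1 \<Longrightarrow>
      norm (poly p z *\<^sub>C orbit_sum M z x - ?P (orbit_sum M z x)) \<le> C * norm x"
    using poly_orbit_sum_bound by blast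
  have P: "?P \<in> bounded_ops" by (rule op_poly_bounded_ops[OF bounded])
  have comm: "?P o\<^sub>L T = T o\<^sub>L ?P" using op_poly_commute[OF bounded refl] by simp
  have int: "integrable circle_measure (\<lambda>z. (norm (orbit_sum M z y))\<^sup>2)"
    and lint: "(LINT z|circle_measure. (norm (orbit_sum M z y))\<^sup>2) = real (Suc M) * (norm y)\<^sup>2" for M y
    using parseval_circle[where w = "\<lambda>j. (blinfun_apply T ^^ (M - j)) y"] by (simp_all add: orbit_sum_sum)
  have "(norm (?P x))\<^sup>2 \<le> (1 + d) * s\<^sup>2 * (norm x)\<^sup>2" if "d > 0" for d
  proof -
    \<comment> \<open>\<open>d\<close> is the weight in (a + b)^2 <= (1 + d) a^2 + (1 + 1/d) b^2.
      The boundary error is collected in \<open>c\<close>, which is free of \<open>M\<close>; only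
      after \<open>M\<close> has grown does \<open>d\<close> tend to 0.\<close>
    define a b c where "a = (norm (?P x))\<^sup>2" and "b = (1 + d) * s\<^sup>2 * (norm x)\<^sup>2"
      and "c = (1 + 1 / d) * (C * norm x)\<^sup>2"
    have ptw: "(norm (orbit_sum M z (?P x)))\<^sup>2 \<le> (1 + d) * s\<^sup>2 * (norm (orbit_sum M z x))\<^sup>2 + c"
      if z: "cmod z = 1" for M z
    proof -
      let ?F = "orbit_sum M z x"
      have "norm (?P ?F) \<le> norm (poly p z *\<^sub>C ?F) + norm (poly p z *\<^sub>C ?F - ?P ?F)"
        using norm_triangle_ineq4[of "poly p z *\<^sub>C ?F" "poly p z *\<^sub>C ?F - ?P ?F"] by simp
      also have "\<dots> \<le> s * norm ?F + C * norm x"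
        unfolding norm_scaleC using s[OF z] C(2)[OF z] by (intro add_mono mult_right_mono) auto
      finally have "(norm (?P ?F))\<^sup>2 \<le> (s * norm ?F + C * norm x)\<^sup>2" by (rule power_mono) simp
      also have "\<dots> \<le> (1 + d) * (s * norm ?F)\<^sup>2 + (1 + 1 / d) * (C * norm x)\<^sup>2"
      proof -
        have "0 \<le> (sqrt d * (s * norm ?F) - (C * norm x) / sqrt d)\<^sup>2" by simp
        also have "\<dots> = d * (s * norm ?F)\<^sup>2 + (1 / d) * (C * norm x)\<^sup>2 - 2 * (s * norm ?F) * (C * norm x)"
          using \<open>d > 0\<close> by (simp add: power2_diff power_mult_distrib power_divide)
        finally show ?thesis by (simp add: power2_sum algebra_simps)
      qed
      finally show ?thesis by (simp add: orbit_sum_commute[OF P comm] c_def power_mult_distrib mult_ac)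
    qed
    have main: "real (Suc M) * a \<le> real (Suc M) * b + c" for M
    proof -
      have "(LINT z|circle_measure. (norm (orbit_sum M z (?P x)))\<^sup>2) \<le>
          (LINT z|circle_measure. (1 + d) * s\<^sup>2 * (norm (orbit_sum M z x))\<^sup>2 + c)"
      proof (rule integral_mono_AE)
        show "AE z in circle_measure. (norm (orbit_sum M z (?P x)))\<^sup>2 \<le> (1 + d) * s\<^sup>2 * (norm (orbit_sum M z x))\<^sup>2 + c"
          using AE_circle by eventually_elim (rule ptw)
      qed (auto intro!: Bochner_Integration.integrable_add integrable_mult_right int)
      also have "\<dots> = (1 + d) * s\<^sup>2 * (real (Suc M) * (norm x)\<^sup>2) + c"
        using int by (simp add: lint circle.prob_space)
      finally show ?thesis unfolding lint a_def b_def by (simp add: mult_ac)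
    qed
    have "a \<le> b"
    proof (rule ccontr)
      assume "\<not> a \<le> b"
      then have "a - b > 0" by simp
      then obtain M where "c < real M * (a - b)" using reals_Archimedean3 by blast
      with \<open>a - b > 0\<close> show False using main[of M] by (simp add: algebra_simps)
    qed
    then show ?thesis by (simp add: a_def b_def)
  qed
  note * = this
  have "(norm (?P x))\<^sup>2 \<le> (s * norm x)\<^sup>2"
  proof (rule tendsto_lowerbound)
    show "((\<lambda>d. (1 + d) * s\<^sup>2 * (norm x)\<^sup>2) \<longlongrightarrow> (s * norm x)\<^sup>2) (at_right 0)"
      by (auto intro!: tendsto_eq_intros simp: power_mult_distrib)
    show "\<forall>\<^sub>F d in at_right 0. (norm (?P x))\<^sup>2 \<le> (1 + d) * s\<^sup>2 * (norm x)\<^sup>2"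
      using eventually_at_right_less[of 0] by eventually_elim (rule *)
  qed simp
  then show "norm (?P x) \<le> s * norm x" by (rule power2_le_imp_le) (use s0 in simp)
qed


lemma adj_bounded: "adj T \<in> bounded_ops"
  by (rule adj_bounded_ops[OF bounded])

lemma adj_monom_monom: "op_poly (adj T) (monom 1 n) o\<^sub>L op_poly T (monom 1 n) = id_blinfun"
proof (induction n)
  case (Suc n)
  have "op_poly (adj T) (monom 1 (Suc n)) o\<^sub>L op_poly T (monom 1 (Suc n)) =
      op_poly (adj T) (monom 1 n) o\<^sub>L ((adj T o\<^sub>L T) o\<^sub>L op_poly T (monom 1 n))"
    unfolding op_poly_monom_Suc'[OF adj_bounded] op_poly_monom_Suc[of T] by (simp only: blinfun_compose_assoc)
  then show ?case using Suc by (simp add: isometry blinfun_compose_simps)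
qed (simp add: blinfun_compose_simps)

section \<open>Trigonometric polynomials of an isometry\<close>

text \<open>All adjoints stand on the left, so that the relation
  \<open>adj T o\<^sub>L T = id_blinfun\<close> can cancel common powers.\<close>

definition trig_op :: "nat \<Rightarrow> complex poly \<Rightarrow> ('h \<Rightarrow>\<^sub>L 'h)" where
  "trig_op m p = op_poly (adj T) (monom 1 m) o\<^sub>L op_poly T p"

text \<open>A relation, because a trigonometric polynomial has many representations by
  \<open>m\<close> and \<open>p\<close>. That the values on the circle determine \<open>A\<close>
  follows only from the norm estimate \<open>is_trig_norm_le\<close>, applied to a
  difference.\<close>

definition is_trig :: "(complex \<Rightarrow> complex) \<Rightarrow> ('h \<Rightarrow>\<^sub>L 'h) \<Rightarrow> bool" where
  "is_trig f A \<longleftrightarrow> (\<exists>m p. A = trig_op m p \<and> (\<forall>z. cmod z = 1 \<longrightarrow> f z = cnj z ^ m * poly p z))"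

lemma is_trigI: "(\<And>z. cmod z = 1 \<Longrightarrow> f z = cnj z ^ m * poly p z) \<Longrightarrow> is_trig f (trig_op m p)"
  unfolding is_trig_def by blast

lemma trig_op_bounded_ops: "trig_op m p \<in> bounded_ops"
  unfolding trig_op_def by (intro bounded_ops_compose op_poly_bounded_ops bounded adj_bounded)

lemma is_trig_bounded_ops: "is_trig f A \<Longrightarrow> A \<in> bounded_ops"
  unfolding is_trig_def using trig_op_bounded_ops by blast

text \<open>The powers of \<open>adj T\<close> and \<open>T\<close> meet in the middle and cancel.
  This plays the role of expanding a fraction, and two operators can be brought to a common exponent
  \<open>m\<close>.\<close>

lemma trig_op_shift: "trig_op (m + k) (monom 1 k * p) = trig_op m p"
proof -
  have "trig_op (m + k) (monom 1 k * p) =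
      op_poly (adj T) (monom 1 m) o\<^sub>L ((op_poly (adj T) (monom 1 k) o\<^sub>L op_poly T (monom 1 k)) o\<^sub>L op_poly T p)"
    unfolding trig_op_def op_poly_mult[OF bounded] op_poly_monom_add[OF adj_bounded]
    by (simp only: blinfun_compose_assoc)
  then show ?thesis by (simp add: adj_monom_monom trig_op_def blinfun_compose_simps)
qed

lemma is_trig_common:
  assumes "is_trig f A" "is_trig g B"
  obtains m p q where "A = trig_op m p" "B = trig_op m q"
    "\<And>z. cmod z = 1 \<Longrightarrow> f z = cnj z ^ m * poly p z" "\<And>z. cmod z = 1 \<Longrightarrow> g z = cnj z ^ m * poly q z"
proof -
  obtain m p n q where A: "A = trig_op m p" "\<And>z. cmod z = 1 \<Longrightarrow> f z = cnj z ^ m * poly p z"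
    and B: "B = trig_op n q" "\<And>z. cmod z = 1 \<Longrightarrow> g z = cnj z ^ n * poly q z"
    using assms unfolding is_trig_def by blast
  have shift: "cnj z ^ (k + l) * poly (monom 1 l * r) z = cnj z ^ k * poly r z" if "cmod z = 1" for z k l r
  proof -
    have "cnj z ^ (k + l) * poly (monom 1 l * r) z = cnj z ^ k * (cnj z * z) ^ l * poly r z"
      by (simp add: power_add poly_monom power_mult_distrib mult_ac)
    then show ?thesis using that by (simp add: cnj_mult_self)
  qed
  show ?thesis
  proof (rule that[of "m + n" "monom 1 n * p" "monom 1 m * q"])
    show "A = trig_op (m + n) (monom 1 n * p)" by (simp add: A trig_op_shift)
    show "B = trig_op (m + n) (monom 1 m * q)" by (simp add: B trig_op_shift add.commute[of m])
    show "f z = cnj z ^ (m + n) * poly (monom 1 n * p) z" if "cmod z = 1" for z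
      unfolding A(2)[OF that] shift[OF that] ..
    show "g z = cnj z ^ (m + n) * poly (monom 1 m * q) z" if "cmod z = 1" for z
      unfolding B(2)[OF that] add.commute[of m] shift[OF that] ..
  qed
qed

lemma is_trig_add:
  assumes "is_trig f A" "is_trig g B" shows "is_trig (\<lambda>z. f z + g z) (A + B)"
  using assms
proof (rule is_trig_common)
  fix m p q assume *: "A = trig_op m p" "B = trig_op m q"
    "\<And>z. cmod z = 1 \<Longrightarrow> f z = cnj z ^ m * poly p z" "\<And>z. cmod z = 1 \<Longrightarrow> g z = cnj z ^ m * poly q z"
  have "A + B = trig_op m (p + q)" by (simp add: * trig_op_def op_poly_add blinfun_compose_simps)
  then show ?thesis by (auto intro!: is_trigI simp: * distrib_left)
qed

lemma is_trig_scale: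
  assumes "is_trig f A" shows "is_trig (\<lambda>z. c * f z) (scaleC_op c A)"
proof -
  obtain m p where *: "A = trig_op m p" "\<And>z. cmod z = 1 \<Longrightarrow> f z = cnj z ^ m * poly p z"
    using assms unfolding is_trig_def by blast
  have "scaleC_op c A = trig_op m (smult c p)"
    by (simp add: * trig_op_def op_poly_smult[OF bounded] scaleC_op_compose op_poly_bounded_ops[OF adj_bounded])
  then show ?thesis by (auto intro!: is_trigI simp: *)
qed

lemma is_trig_diff:
  assumes "is_trig f A" "is_trig g B" shows "is_trig (\<lambda>z. f z - g z) (A - B)"
  using is_trig_add[OF assms(1) is_trig_scale[OF assms(2), of "-1"]] by simp

lemma norm_adj_monom_le: "norm (op_poly (adj T) (monom 1 m)) \<le> 1"
proof -
  have "norm (op_poly T (monom 1 m)) \<le> 1"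
    by (rule von_neumann_inequality) (simp add: poly_monom norm_power)
  then show ?thesis
    using norm_adj_le[OF op_poly_bounded_ops[OF bounded, of "monom 1 m"]] by (simp add: adj_op_poly_monom[OF bounded])
qed

text \<open>The factor \<open>cnj z ^ m\<close> has modulus 1, so f and p have the same modulus on
  the circle; the power of \<open>adj T\<close> in front is a contraction.\<close>

lemma is_trig_norm_le:
  assumes "is_trig f A" and s: "\<And>z. cmod z = 1 \<Longrightarrow> cmod (f z) \<le> s"
  shows "norm A \<le> s"
proof -
  obtain m p where *: "A = trig_op m p" "\<And>z. cmod z = 1 \<Longrightarrow> f z = cnj z ^ m * poly p z"
    using assms(1) unfolding is_trig_def by blast
  have "norm A \<le> norm (op_poly (adj T) (monom 1 m)) * norm (op_poly T p)"
    unfolding * trig_op_def by (rule norm_blinfun_compose)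
  also have "\<dots> \<le> 1 * norm (op_poly T p)"
    by (intro mult_right_mono norm_adj_monom_le) simp
  also have "norm (op_poly T p) \<le> s"
  proof (rule von_neumann_inequality)
    fix z :: complex assume z: "cmod z = 1"
    show "cmod (poly p z) \<le> s" using s[OF z] by (simp add: *(2)[OF z] norm_mult norm_power z)
  qed
  finally show ?thesis by simp
qed

text \<open>A single term, a power of \<open>adj T\<close> followed by a power of \<open>T\<close>,
  has an adjoint of the same shape with exchanged exponents. Linearity does the rest.\<close>

lemma is_trig_adj:
  assumes "is_trig f A" shows "is_trig (\<lambda>z. cnj (f z)) (adj A)"
proof -
  obtain m p where *: "A = trig_op m p" "\<And>z. cmod z = 1 \<Longrightarrow> f z = cnj z ^ m * poly p z"
    using assms unfolding is_trig_def by blast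
  \<comment> \<open>The offset \<open>k\<close> absorbs the factor z that \<open>pCons\<close> puts
    before the tail of the polynomial.\<close>
  have "is_trig (\<lambda>z. z ^ m * cnj (z ^ k * poly p z)) (adj (trig_op m (monom 1 k * p)))" for k
  proof (induction p arbitrary: k)
    case 0
    have "trig_op m (monom 1 k * 0) = 0" by (simp add: trig_op_def)
    moreover have "is_trig (\<lambda>z. 0) (trig_op 0 0)" by (rule is_trigI) simp
    ultimately show ?case by (simp add: trig_op_def blinfun_compose_simps)
  next
    case (pCons a p)
    have mon: "is_trig (\<lambda>z. cnj z ^ k * z ^ m) (trig_op k (monom 1 m))"
      by (rule is_trigI) (simp add: poly_monom)
    have "adj (trig_op m (monom 1 k)) = trig_op k (monom 1 m)"
      by (simp add: trig_op_def adj_compose op_poly_bounded_ops bounded adj_bounded adj_op_poly_monom)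
    with is_trig_scale[OF mon, of "cnj a"]
    have 1: "is_trig (\<lambda>z. cnj a * (cnj z ^ k * z ^ m)) (adj (scaleC_op a (trig_op m (monom 1 k))))"
      by (simp add: adj_scaleC trig_op_bounded_ops)
    have "trig_op m (monom 1 k * pCons a p) = scaleC_op a (trig_op m (monom 1 k)) + trig_op m (monom 1 (Suc k) * p)"
    proof -
      have "monom 1 k * pCons a p = smult a (monom 1 k) + monom 1 (Suc k) * p"
        by (simp add: mult_pCons_right monom_Suc)
      then show ?thesis
        by (simp add: trig_op_def op_poly_add op_poly_smult bounded blinfun_compose_simps scaleC_op_compose
            op_poly_bounded_ops adj_bounded)
    qed
    then have "adj (trig_op m (monom 1 k * pCons a p)) =
        adj (scaleC_op a (trig_op m (monom 1 k))) + adj (trig_op m (monom 1 (Suc k) * p))"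
      by (simp add: adj_add bounded_ops_scaleC trig_op_bounded_ops)
    with is_trig_add[OF 1 pCons.IH[of "Suc k"]] show ?case
      by (simp add: algebra_simps)
  qed
  from this[of 0] show ?thesis unfolding is_trig_def by (simp add: * flip: one_pCons monom_0)
qed


section \<open>Continuous functional calculus of an isometry\<close>

text \<open>This concerns functions only. The product of the operators need not represent the
  product function, as powers of \<open>T\<close> and \<open>adj T\<close> would have to be
  exchanged.\<close>

lemma ex_trig_mult:
  assumes "\<exists>A. is_trig f A" "\<exists>A. is_trig g A" shows "\<exists>A. is_trig (\<lambda>z. f z * g z) A"
proof -
  obtain A B where "is_trig f A" "is_trig g B" using assms by blast
  then obtain m p q where "\<And>z. cmod z = 1 \<Longrightarrow> f z = cnj z ^ m * poly p z"
    "\<And>z. cmod z = 1 \<Longrightarrow> g z = cnj z ^ m * poly q z" by (rule is_trig_common) blast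
  then have "is_trig (\<lambda>z. f z * g z) (trig_op (m + m) (p * q))"
    by (intro is_trigI) (simp add: power_add mult_ac)
  then show ?thesis by blast
qed

lemma ex_trig_add:
  assumes "\<exists>A. is_trig f A" "\<exists>A. is_trig g A" shows "\<exists>A. is_trig (\<lambda>z. f z + g z) A"
  using assms is_trig_add by blast

lemma is_trig_const: "is_trig (\<lambda>z. c) (scaleC_op c id_blinfun)"
proof -
  have "scaleC_op c id_blinfun = trig_op 0 [:c:]" by (simp add: trig_op_def blinfun_compose_simps)
  then show ?thesis by (auto intro!: is_trigI)
qed

lemma is_trig_ident: "is_trig (\<lambda>z. z) T"
proof -
  have "T = trig_op 0 [:0, 1:]" by (simp add: trig_op_def blinfun_compose_simps)
  moreover have "is_trig (\<lambda>z. z) (trig_op 0 [:0, 1:])" by (rule is_trigI) simp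
  ultimately show ?thesis by (rule ssubst)
qed

lemma is_trig_cnj: "is_trig cnj (adj T)"
  using is_trig_adj[OF is_trig_ident] by simp

lemma ex_trig_real_polynomial:
  assumes "real_polynomial_function h" shows "\<exists>A. is_trig (\<lambda>z. complex_of_real (h z)) A"
  using assms
proof (induction rule: real_polynomial_function.induct)
  case (linear h)
  interpret bounded_linear h by fact
  \<comment> \<open>A real-linear functional on the plane is h(1) Re z + h(i) Im z; these constants
    rewrite it in terms of z and \<open>cnj z\<close>.\<close>
  define a b where "a = complex_of_real (h 1 / 2)" and "b = complex_of_real (h \<i>) / (2 * \<i>)"
  have h: "complex_of_real (h z) = a * (z + cnj z) + b * (z - cnj z)" for z
  proof -
    have "h z = h (Re z *\<^sub>R 1 + Im z *\<^sub>R \<i>)" by (rule arg_cong[of _ _ h]) (simp add: complex_eq_iff)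
    also have "\<dots> = Re z * h 1 + Im z * h \<i>" by (simp only: add scaleR) simp
    finally show ?thesis by (simp add: a_def b_def complex_eq_iff)
  qed
  show ?case unfolding h
    using is_trig_add[OF is_trig_scale[OF is_trig_add[OF is_trig_ident is_trig_cnj]]
        is_trig_scale[OF is_trig_diff[OF is_trig_ident is_trig_cnj]]] by blast
next
  case (const c)
  show ?case using is_trig_const by blast
next
  case (add f g)
  then show ?case using ex_trig_add by simp
next
  case (mult f g)
  then show ?case using ex_trig_mult by simp
qed

lemma trig_dense:
  assumes "f \<in> circle_continuous" "e > 0"
  shows "\<exists>g A. is_trig g A \<and> (\<forall>z. cmod z = 1 \<longrightarrow> cmod (f z - g z) \<le> e)"
proof -
  obtain g :: "complex \<Rightarrow> complex" where g: "polynomial_function g" "\<And>z. z \<in> sphere 0 1 \<Longrightarrow> cmod (f z - g z) < e"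
    using Stone_Weierstrass_polynomial_function[of "sphere 0 1" f e] assms
    by (auto simp: circle_continuous_def)
  have "real_polynomial_function (Re \<circ> g)" "real_polynomial_function (Im \<circ> g)"
    using g(1) bounded_linear_Re bounded_linear_Im unfolding polynomial_function_def by blast+
  then obtain A B where "is_trig (\<lambda>z. complex_of_real (Re (g z))) A" "is_trig (\<lambda>z. complex_of_real (Im (g z))) B"
    by (fastforce dest!: ex_trig_real_polynomial)
  from is_trig_add[OF this(1) is_trig_scale[OF this(2), of \<i>]]
  have "is_trig g (A + scaleC_op \<i> B)" by (simp flip: complex_eq)
  moreover have "\<forall>z. cmod z = 1 \<longrightarrow> cmod (f z - g z) \<le> e" using g(2) by (auto intro: less_imp_le)
  ultimately show ?thesis by blast
qed

text \<open>A limit of arbitrarily chosen approximants; \<open>calc_limit\<close> shows that any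
  other uniformly convergent choice gives the same operator.\<close>

definition calc :: "(complex \<Rightarrow> complex) \<Rightarrow> ('h \<Rightarrow>\<^sub>L 'h)" where
  "calc f = lim (\<lambda>n. SOME A. \<exists>g. is_trig g A \<and> (\<forall>z. cmod z = 1 \<longrightarrow> cmod (f z - g z) \<le> 1 / real (Suc n)))"

lemma calc_sequence:
  assumes f: "f \<in> circle_continuous"
  shows "\<exists>g A. (\<forall>n. is_trig (g n) (A n)) \<and>
    (\<forall>n z. cmod z = 1 \<longrightarrow> cmod (f z - g n z) \<le> 1 / real (Suc n)) \<and> A \<longlonglongrightarrow> calc f"
proof -
  define A where "A n = (SOME A. \<exists>g. is_trig g A \<and> (\<forall>z. cmod z = 1 \<longrightarrow> cmod (f z - g z) \<le> 1 / real (Suc n)))" for n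
  have "\<exists>g. is_trig g (A n) \<and> (\<forall>z. cmod z = 1 \<longrightarrow> cmod (f z - g z) \<le> 1 / real (Suc n))" for n
    unfolding A_def by (rule someI_ex) (use trig_dense[OF f, of "1 / real (Suc n)"] in force)
  then obtain g where g: "\<And>n. is_trig (g n) (A n)"
    "\<And>n z. cmod z = 1 \<Longrightarrow> cmod (f z - g n z) \<le> 1 / real (Suc n)" by metis
  have dist: "norm (A m - A n) \<le> 1 / real (Suc m) + 1 / real (Suc n)" for m n
  proof (rule is_trig_norm_le[OF is_trig_diff[OF g(1) g(1)]])
    fix z :: complex assume z: "cmod z = 1"
    have "cmod (g m z - g n z) \<le> cmod (f z - g n z) + cmod (f z - g m z)"
      using norm_triangle_ineq4[of "f z - g n z" "f z - g m z"] by simp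
    then show "cmod (g m z - g n z) \<le> 1 / real (Suc m) + 1 / real (Suc n)" using g(2)[OF z, of m] g(2)[OF z, of n] by linarith
  qed
  have "Cauchy A"
  proof (rule metric_CauchyI)
    fix e :: real assume "e > 0"
    then obtain N where N: "2 / real (Suc N) < e"
      using reals_Archimedean[of "e / 2"] by (auto simp: field_simps)
    have "dist (A m) (A n) < e" if "m \<ge> N" "n \<ge> N" for m n
    proof -
      have "1 / real (Suc m) \<le> 1 / real (Suc N)" "1 / real (Suc n) \<le> 1 / real (Suc N)"
        using that by (auto intro: divide_left_mono)
      then show ?thesis using dist[of m n] N by (simp add: dist_norm)
    qed
    then show "\<exists>M. \<forall>m\<ge>M. \<forall>n\<ge>M. dist (A m) (A n) < e" by blast
  qed
  then have "A \<longlonglongrightarrow> lim A" by (simp add: Cauchy_convergent_iff convergent_LIMSEQ_iff)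
  moreover have "lim A = calc f" unfolding calc_def by (intro arg_cong[of _ _ lim] ext) (rule A_def)
  ultimately show ?thesis using g by (intro exI[of _ g] exI[of _ A]) simp
qed

text \<open>The source of the other properties of the calculus: e = 0 gives agreement with
  trigonometric polynomials, e tending to 0 gives independence of the approximants, and g = 0 gives
  contractivity.\<close>

lemma calc_approx:
  assumes f: "f \<in> circle_continuous" and g: "is_trig g A" and e: "\<And>z. cmod z = 1 \<Longrightarrow> cmod (f z - g z) \<le> e"
  shows "norm (calc f - A) \<le> e"
proof -
  obtain h B where h: "\<And>n. is_trig (h n) (B n)"
    "\<And>n z. cmod z = 1 \<Longrightarrow> cmod (f z - h n z) \<le> 1 / real (Suc n)" "B \<longlonglongrightarrow> calc f"
    using calc_sequence[OF f] by blast
  have bound: "norm (B n - A) \<le> e + 1 / real (Suc n)" for n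
  proof (rule is_trig_norm_le[OF is_trig_diff[OF h(1) g]])
    fix z :: complex assume z: "cmod z = 1"
    have "cmod (h n z - g z) \<le> cmod (f z - g z) + cmod (f z - h n z)"
      using norm_triangle_ineq4[of "f z - g z" "f z - h n z"] by simp
    then show "cmod (h n z - g z) \<le> e + 1 / real (Suc n)" using e[OF z] h(2)[OF z, of n] by linarith
  qed
  show ?thesis
  proof (rule LIMSEQ_le)
    show "(\<lambda>n. norm (B n - A)) \<longlonglongrightarrow> norm (calc f - A)" by (intro tendsto_intros h(3))
    show "(\<lambda>n. e + 1 / real (Suc n)) \<longlonglongrightarrow> e"
      using tendsto_add[OF tendsto_const LIMSEQ_Suc[OF lim_1_over_n], of e] by simp
  qed (use bound in blast)
qed

lemma calc_limit:
  assumes f: "f \<in> circle_continuous" and g: "\<And>n. is_trig (g n) (A n)"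
    and e: "\<And>n z. cmod z = 1 \<Longrightarrow> cmod (f z - g n z) \<le> e n" "e \<longlonglongrightarrow> 0"
  shows "A \<longlonglongrightarrow> calc f"
proof -
  have "(\<lambda>n. A n - calc f) \<longlonglongrightarrow> 0"
    by (rule Lim_null_comparison[OF _ e(2)]) (use calc_approx[OF f g e(1)] in \<open>simp add: norm_minus_commute\<close>)
  then show ?thesis by (rule LIM_zero_cancel)
qed

lemma calc_trig: "f \<in> circle_continuous \<Longrightarrow> is_trig f A \<Longrightarrow> calc f = A"
  using calc_approx[of f f A 0] by simp

lemma calc_bounded_ops:
  assumes "f \<in> circle_continuous" shows "calc f \<in> bounded_ops"
  using calc_sequence[OF assms] is_trig_bounded_ops closed_sequentially[OF closed_bounded_ops] by metis

lemma is_trig_cong: "(\<And>z. cmod z = 1 \<Longrightarrow> f z = g z) \<Longrightarrow> is_trig f A \<longleftrightarrow> is_trig g A"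
  unfolding is_trig_def by (metis (no_types, lifting))

lemma calc_one: "calc (\<lambda>z. if z \<in> sphere 0 1 then 1 else 0) = id_blinfun"
proof (rule calc_trig[OF circle_continuous_one])
  show "is_trig (\<lambda>z. if z \<in> sphere 0 1 then 1 else 0) id_blinfun"
    using is_trig_const[of 1] by (subst is_trig_cong[of _ "\<lambda>z. 1"]) auto
qed

lemma calc_id: "calc circle_id = T"
proof (rule calc_trig[OF circle_id_continuous])
  show "is_trig circle_id T"
    using is_trig_ident by (subst is_trig_cong[of _ "\<lambda>z. z"]) (auto simp: circle_id_def)
qed

lemma calc_add:
  assumes f: "f \<in> circle_continuous" and g: "g \<in> circle_continuous"
  shows "calc (\<lambda>z. f z + g z) = calc f + calc g"
proof -
  obtain u A where u: "\<And>n. is_trig (u n) (A n)"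
    "\<And>n z. cmod z = 1 \<Longrightarrow> cmod (f z - u n z) \<le> 1 / real (Suc n)" "A \<longlonglongrightarrow> calc f"
    using calc_sequence[OF f] by blast
  obtain v B where v: "\<And>n. is_trig (v n) (B n)"
    "\<And>n z. cmod z = 1 \<Longrightarrow> cmod (g z - v n z) \<le> 1 / real (Suc n)" "B \<longlonglongrightarrow> calc g"
    using calc_sequence[OF g] by blast
  have "(\<lambda>n. A n + B n) \<longlonglongrightarrow> calc (\<lambda>z. f z + g z)"
  proof (rule calc_limit[OF circle_continuous_add[OF f g] is_trig_add[OF u(1) v(1)]])
    fix n and z :: complex assume z: "cmod z = 1"
    have "cmod (f z + g z - (u n z + v n z)) \<le> cmod (f z - u n z) + cmod (g z - v n z)"
      using norm_triangle_ineq[of "f z - u n z" "g z - v n z"] by (simp add: algebra_simps)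
    then show "cmod (f z + g z - (u n z + v n z)) \<le> 2 / real (Suc n)"
      using u(2)[OF z, of n] v(2)[OF z, of n] by simp
  qed (rule tendsto_divide_Suc)
  then show ?thesis using tendsto_add[OF u(3) v(3)] LIMSEQ_unique by blast
qed

lemma calc_scale:
  assumes f: "f \<in> circle_continuous" shows "calc (\<lambda>z. c * f z) = scaleC_op c (calc f)"
proof -
  obtain u A where u: "\<And>n. is_trig (u n) (A n)"
    "\<And>n z. cmod z = 1 \<Longrightarrow> cmod (f z - u n z) \<le> 1 / real (Suc n)" "A \<longlonglongrightarrow> calc f"
    using calc_sequence[OF f] by blast
  have "(\<lambda>n. scaleC_op c (A n)) \<longlonglongrightarrow> calc (\<lambda>z. c * f z)"
  proof (rule calc_limit[OF circle_continuous_scale[OF f] is_trig_scale[OF u(1)]])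
    fix n and z :: complex assume z: "cmod z = 1"
    show "cmod (c * f z - c * u n z) \<le> cmod c / real (Suc n)"
      using mult_left_mono[OF u(2)[OF z, of n], of "cmod c"] by (simp flip: norm_mult right_diff_distrib)
  qed (rule tendsto_divide_Suc)
  then show ?thesis using tendsto_scaleC_op[OF u(3)] LIMSEQ_unique by blast
qed

lemma calc_diff:
  assumes f: "f \<in> circle_continuous" and g: "g \<in> circle_continuous"
  shows "calc (\<lambda>z. f z - g z) = calc f - calc g"
  using calc_add[OF f circle_continuous_scale[OF g], of "-1"] calc_scale[OF g, of "-1"] by simp

lemma calc_zero: "calc (\<lambda>z. 0) = 0"
  using calc_diff[OF circle_continuous_zero circle_continuous_zero] by simp

lemma calc_adj:
  assumes f: "f \<in> circle_continuous" shows "calc (\<lambda>z. cnj (f z)) = adj (calc f)"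
proof -
  obtain u A where u: "\<And>n. is_trig (u n) (A n)"
    "\<And>n z. cmod z = 1 \<Longrightarrow> cmod (f z - u n z) \<le> 1 / real (Suc n)" "A \<longlonglongrightarrow> calc f"
    using calc_sequence[OF f] by blast
  have "(\<lambda>n. adj (A n)) \<longlonglongrightarrow> calc (\<lambda>z. cnj (f z))"
  proof (rule calc_limit[OF circle_continuous_cnj[OF f] is_trig_adj[OF u(1)]])
    fix n and z :: complex assume z: "cmod z = 1"
    show "cmod (cnj (f z) - cnj (u n z)) \<le> 1 / real (Suc n)"
      using u(2)[OF z, of n] by (simp flip: complex_cnj_diff)
  qed (rule tendsto_divide_Suc)
  then show ?thesis using tendsto_adj[OF u(3) is_trig_bounded_ops[OF u(1)]] LIMSEQ_unique by blast
qed

lemma norm_calc_le: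
  assumes f: "f \<in> circle_continuous" and s: "\<And>z. cmod z = 1 \<Longrightarrow> cmod (f z) \<le> s"
  shows "norm (calc f) \<le> s"
  using calc_approx[OF f is_trig_const[of 0] , of s] s by simp

lemma calc_in_cstar_subalgebra:
  assumes A: "cstar_subalgebra A" "id_blinfun \<in> A" "T \<in> A" and f: "f \<in> circle_continuous"
  shows "calc f \<in> A"
proof -
  have op: "op_poly S p \<in> A" if "S \<in> A" for S p
    using that A(2) by (induction p) (auto intro: cstar_subalgebraD[OF A(1)])
  have trig: "B \<in> A" if "is_trig g B" for g B
    using that op[OF A(3)] op[OF cstar_subalgebraD(6)[OF A(1,3)]]
    by (auto simp: is_trig_def trig_op_def intro: cstar_subalgebraD[OF A(1)])
  obtain u B where u: "\<And>n. is_trig (u n) (B n)"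
    "\<And>n z. cmod z = 1 \<Longrightarrow> cmod (f z - u n z) \<le> 1 / real (Suc n)" "B \<longlonglongrightarrow> calc f"
    using calc_sequence[OF f] by blast
  show ?thesis
    by (rule closed_sequentially[OF cstar_subalgebraD(7)[OF A(1)] trig[OF u(1)] u(3)])
qed

end

text \<open>Instances are \<open>{0}\<close> and \<open>compact_ops\<close>. Being contained in
  \<open>compact_ops\<close> is what makes the test vectors blind to \<open>J\<close> and symbols
  unique.\<close>

definition closed_ideal :: "('h::chilbert_space \<Rightarrow>\<^sub>L 'h) set \<Rightarrow> bool" where
  "closed_ideal J \<longleftrightarrow> J \<subseteq> compact_ops \<and> 0 \<in> J \<and> (\<forall>A\<in>J. \<forall>B\<in>J. A + B \<in> J) \<and>
     (\<forall>A\<in>J. \<forall>B\<in>bounded_ops. A o\<^sub>L B \<in> J \<and> B o\<^sub>L A \<in> J) \<and> (\<forall>A\<in>J. adj A \<in> J) \<and> closed J"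

lemma closed_idealD:
  assumes "closed_ideal J"
  shows "A \<in> J \<Longrightarrow> A \<in> compact_ops" "0 \<in> J" "A \<in> J \<Longrightarrow> B \<in> J \<Longrightarrow> A + B \<in> J"
    "A \<in> J \<Longrightarrow> B \<in> bounded_ops \<Longrightarrow> A o\<^sub>L B \<in> J" "A \<in> J \<Longrightarrow> B \<in> bounded_ops \<Longrightarrow> B o\<^sub>L A \<in> J"
    "A \<in> J \<Longrightarrow> adj A \<in> J" "closed J"
  using assms by (auto simp: closed_ideal_def)

lemma closed_ideal_scaleC:
  assumes "closed_ideal J" "A \<in> J" shows "scaleC_op c A \<in> J"
  using closed_idealD(5)[OF assms bounded_ops_scaleC[OF bounded_ops_id], of c]
  by (simp add: scaleC_op_compose blinfun_compose_simps)

lemma closed_ideal_minus: "closed_ideal J \<Longrightarrow> A \<in> J \<Longrightarrow> - A \<in> J"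
  using closed_ideal_scaleC[of J A "-1"] by simp

lemma closed_ideal_diff: "closed_ideal J \<Longrightarrow> A \<in> J \<Longrightarrow> B \<in> J \<Longrightarrow> A - B \<in> J"
  using closed_idealD(3)[of J A "- B"] closed_ideal_minus[of J B] by simp

lemma closed_ideal_zero: "closed_ideal {0}"
  by (auto simp: closed_ideal_def)

lemma closed_ideal_compact_ops: "closed_ideal compact_ops"
  by (auto simp: closed_ideal_def closed_compact_ops
      intro: compact_ops_add compact_ops_compose_left compact_ops_compose_right compact_ops_adj)

context hilbert_isometry
begin

text \<open>To bring a product into normal form, p(T) must be moved past powers of
  \<open>adj T\<close>. The basic commutator
  \<open>(T o\<^sub>L adj T) - (adj T o\<^sub>L T)\<close> is minus the defect
  \<open>id_blinfun - (T o\<^sub>L adj T)\<close> and so lies in \<open>J\<close>; the ideal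
  property extends this to powers and then to polynomials.\<close>

lemma is_trig_mult:
  assumes J: "closed_ideal J" and TJ: "id_blinfun - (T o\<^sub>L adj T) \<in> J"
    and "is_trig f A" "is_trig g B"
  shows "\<exists>C. is_trig (\<lambda>z. f z * g z) C \<and> (A o\<^sub>L B) - C \<in> J"
proof -
  let ?S = "\<lambda>n. op_poly (adj T) (monom 1 n)"
  note bdd = op_poly_bounded_ops[OF bounded] op_poly_bounded_ops[OF adj_bounded] adj_bounded bounded
  have "- (id_blinfun - (T o\<^sub>L adj T)) \<in> J" by (rule closed_ideal_minus[OF J TJ])
  then have 1: "(T o\<^sub>L adj T) - (adj T o\<^sub>L T) \<in> J" by (simp add: isometry)
  have 2: "(T o\<^sub>L ?S n) - (?S n o\<^sub>L T) \<in> J" for n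
  proof (induction n)
    case (Suc n)
    have "(T o\<^sub>L ?S (Suc n)) - (?S (Suc n) o\<^sub>L T) =
        (((T o\<^sub>L adj T) - (adj T o\<^sub>L T)) o\<^sub>L ?S n) + (adj T o\<^sub>L ((T o\<^sub>L ?S n) - (?S n o\<^sub>L T)))"
      by (simp add: op_poly_monom_Suc blinfun_compose_simps blinfun_compose_assoc)
    then show ?case
      by (simp only:) (intro closed_idealD(3)[OF J] closed_idealD(4)[OF J 1] closed_idealD(5)[OF J Suc] bdd)
  qed (simp add: blinfun_compose_simps closed_idealD(2)[OF J])
  have 3: "(op_poly T p o\<^sub>L ?S n) - (?S n o\<^sub>L op_poly T p) \<in> J" for p n
  proof (induction p)
    case (pCons a p)
    have "(op_poly T (pCons a p) o\<^sub>L ?S n) - (?S n o\<^sub>L op_poly T (pCons a p)) =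
        (T o\<^sub>L ((op_poly T p o\<^sub>L ?S n) - (?S n o\<^sub>L op_poly T p))) + (((T o\<^sub>L ?S n) - (?S n o\<^sub>L T)) o\<^sub>L op_poly T p)"
      by (simp add: scaleC_op_compose bdd blinfun_compose_simps blinfun_compose_assoc)
    then show ?case
      by (simp only:) (intro closed_idealD(3)[OF J] closed_idealD(4)[OF J 2] closed_idealD(5)[OF J pCons.IH] bdd)
  qed (simp add: closed_idealD(2)[OF J])
  obtain m p where A: "A = trig_op m p" "\<And>z. cmod z = 1 \<Longrightarrow> f z = cnj z ^ m * poly p z"
    using assms(3) unfolding is_trig_def by blast
  obtain n q where B: "B = trig_op n q" "\<And>z. cmod z = 1 \<Longrightarrow> g z = cnj z ^ n * poly q z"
    using assms(4) unfolding is_trig_def by blast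
  have "is_trig (\<lambda>z. f z * g z) (trig_op (m + n) (p * q))"
    by (rule is_trigI) (simp add: A B power_add mult_ac)
  moreover have "(A o\<^sub>L B) - trig_op (m + n) (p * q) =
      ?S m o\<^sub>L (((op_poly T p o\<^sub>L ?S n) - (?S n o\<^sub>L op_poly T p)) o\<^sub>L op_poly T q)"
    by (simp add: A B trig_op_def op_poly_monom_add adj_bounded op_poly_mult bounded
        blinfun_compose_simps blinfun_compose_assoc)
  moreover have "\<dots> \<in> J" by (intro closed_idealD(4,5)[OF J] 3 bdd)
  ultimately show ?thesis by auto
qed

lemma calc_mult:
  assumes J: "closed_ideal J" and TJ: "id_blinfun - (T o\<^sub>L adj T) \<in> J"
    and f: "f \<in> circle_continuous" and g: "g \<in> circle_continuous"
  shows "(calc f o\<^sub>L calc g) - calc (\<lambda>z. f z * g z) \<in> J"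
proof -
  obtain u A where u: "\<And>n. is_trig (u n) (A n)"
    "\<And>n z. cmod z = 1 \<Longrightarrow> cmod (f z - u n z) \<le> 1 / real (Suc n)" "A \<longlonglongrightarrow> calc f"
    using calc_sequence[OF f] by blast
  obtain v B where v: "\<And>n. is_trig (v n) (B n)"
    "\<And>n z. cmod z = 1 \<Longrightarrow> cmod (g z - v n z) \<le> 1 / real (Suc n)" "B \<longlonglongrightarrow> calc g"
    using calc_sequence[OF g] by blast
  have "\<forall>n. \<exists>C. is_trig (\<lambda>z. u n z * v n z) C \<and> (A n o\<^sub>L B n) - C \<in> J"
    using is_trig_mult[OF J TJ u(1) v(1)] by blast
  then obtain C where C: "\<And>n. is_trig (\<lambda>z. u n z * v n z) (C n)" "\<And>n. (A n o\<^sub>L B n) - C n \<in> J"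
    by metis
  obtain F where F: "\<And>z. cmod z = 1 \<Longrightarrow> cmod (f z) \<le> F" using circle_continuous_bounded[OF f] by blast
  obtain G where G: "\<And>z. cmod z = 1 \<Longrightarrow> cmod (g z) \<le> G" using circle_continuous_bounded[OF g] by blast
  have "C \<longlonglongrightarrow> calc (\<lambda>z. f z * g z)"
  proof (rule calc_limit[OF circle_continuous_mult[OF f g] C(1)])
    fix n and z :: complex assume z: "cmod z = 1"
    have n: "1 / real (Suc n) \<le> 1" by simp
    have "cmod (v n z) \<le> cmod (g z) + cmod (g z - v n z)"
      using norm_triangle_ineq4[of "g z" "g z - v n z"] by simp
    then have "cmod (v n z) \<le> G + 1" using G[OF z] v(2)[OF z, of n] n by linarith
    have eq: "f z * g z - u n z * v n z = f z * (g z - v n z) + (f z - u n z) * v n z"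
      by (simp add: algebra_simps)
    moreover have "cmod (f z) * cmod (g z - v n z) \<le> F * (1 / real (Suc n))"
      using F[OF z] v(2)[OF z, of n] order_trans[OF norm_ge_zero F[OF z]] by (intro mult_mono) auto
    moreover have "cmod (f z - u n z) * cmod (v n z) \<le> 1 / real (Suc n) * (G + 1)"
      using \<open>cmod (v n z) \<le> G + 1\<close> u(2)[OF z, of n] by (intro mult_mono) auto
    ultimately have "cmod (f z * g z - u n z * v n z) \<le> F * (1 / real (Suc n)) + 1 / real (Suc n) * (G + 1)"
      using norm_triangle_ineq[of "f z * (g z - v n z)" "(f z - u n z) * v n z"] unfolding eq norm_mult by linarith
    then show "cmod (f z * g z - u n z * v n z) \<le> (F + G + 1) / real (Suc n)"
      by (simp add: add_divide_distrib)
  qed (rule tendsto_divide_Suc)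
  then have "(\<lambda>n. (A n o\<^sub>L B n) - C n) \<longlonglongrightarrow> (calc f o\<^sub>L calc g) - calc (\<lambda>z. f z * g z)"
    by (intro tendsto_diff tendsto_blinfun_compose u(3) v(3))
  then show ?thesis by (rule closed_sequentially[OF closed_idealD(7)[OF J] C(2)])
qed

end

section \<open>Isometries with a wandering vector\<close>

text \<open>The vector \<open>e\<close> has to be orthogonal only to its own forward orbit, not to
  the range of \<open>T\<close>, so that bilateral shifts, which are onto, are covered as
  well.\<close>

locale shift_isometry = hilbert_isometry T for T :: "'h::chilbert_space \<Rightarrow>\<^sub>L 'h" +
  fixes e :: 'h
  assumes norm_e: "norm e = 1"
    and wandering: "\<And>n. cinner e ((blinfun_apply T ^^ Suc n) e) = 0"
begin

lemma orthonormal_orbit: "orthonormal_family (\<lambda>n. (blinfun_apply T ^^ n) e)"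
proof -
  have iso: "cinner ((blinfun_apply T ^^ n) x) ((blinfun_apply T ^^ n) y) = cinner x y" for n x y
    by (induction n) (simp_all add: isometry_cinner[OF bounded isometry])
  have less: "cinner ((blinfun_apply T ^^ i) e) ((blinfun_apply T ^^ j) e) = 0" if "i < j" for i j
  proof -
    obtain k where "j = i + Suc k" using less_imp_Suc_add[OF \<open>i < j\<close>] by auto
    then have "(blinfun_apply T ^^ j) e = (blinfun_apply T ^^ i) ((blinfun_apply T ^^ Suc k) e)"
      by (simp only: funpow_add comp_apply)
    then show ?thesis using iso wandering by simp
  qed
  moreover have "cinner ((blinfun_apply T ^^ i) e) ((blinfun_apply T ^^ j) e) = 0" if "j < i" for i j
    using less[OF that] by (metis cinner_commute complex_cnj_zero)
  moreover have "cinner ((blinfun_apply T ^^ i) e) ((blinfun_apply T ^^ i) e) = 1" for i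
    by (simp add: iso cinner_self norm_e)
  ultimately show ?thesis unfolding orthonormal_family_def by (metis linorder_neqE_nat)
qed

text \<open>For \<open>|w| = 1\<close> these unit vectors escape to infinity along the orbit of \<open>e\<close> and are approximate
  eigenvectors of \<open>T\<close> for \<open>w\<close>; compact operators do not see them.\<close>

definition test_vector :: "complex \<Rightarrow> nat \<Rightarrow> 'h" where
  "test_vector w n = (1 / sqrt (real (Suc n))) *\<^sub>R (\<Sum>j<Suc n. cnj w ^ j *\<^sub>C (blinfun_apply T ^^ (n + j)) e)"

lemma norm_test_vector:
  assumes w: "cmod w = 1" shows "norm (test_vector w n) = 1"
proof -
  let ?b = "\<lambda>j. (blinfun_apply T ^^ j) e"
  let ?s = "\<Sum>j<Suc n. cnj w ^ j *\<^sub>C ?b (n + j)"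
  have orth: "cinner (?b i) (?b j) = (if i = j then 1 else 0)" for i j
    using orthonormal_orbit unfolding orthonormal_family_def by blast
  have "complex_of_real ((norm ?s)\<^sup>2) = (\<Sum>i<Suc n. \<Sum>j<Suc n. if i = j then w ^ i * cnj w ^ j else 0)"
    unfolding cinner_self[symmetric] cinner_sum_left cinner_sum_right
    by (intro sum.cong refl) (simp add: cinner_scaleC_left cinner_scaleC_right orth)
  also have "\<dots> = (\<Sum>i<Suc n. (w * cnj w) ^ i)"
    by (simp add: power_mult_distrib)
  also have "\<dots> = complex_of_real (real (Suc n))" using cnj_mult_self(2)[OF w] by simp
  finally have "(norm ?s)\<^sup>2 = real (Suc n)" using of_real_eq_iff by blast
  then have "norm ?s = sqrt (real (Suc n))" by (rule real_sqrt_unique[OF _ norm_ge_zero, symmetric])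
  then show ?thesis by (simp add: test_vector_def)
qed

text \<open>By Cauchy-Schwarz for finite sums, the squared inner product is at most a tail, starting
  at n, of the convergent Bessel series of \<open>y\<close> along the orbit.\<close>

lemma test_vector_weakly_null:
  assumes w: "cmod w = 1" shows "(\<lambda>n. cinner y (test_vector w n)) \<longlonglongrightarrow> 0"
proof -
  let ?b = "\<lambda>j. (blinfun_apply T ^^ j) e"
  define s where "s j = (cmod (cinner (?b j) y))\<^sup>2" for j
  have s0: "0 \<le> s j" for j by (simp add: s_def)
  have "(\<Sum>j<n. s j) \<le> (norm y)\<^sup>2" for n
    unfolding s_def by (rule bessel_inequality[OF orthonormal_orbit]) simp
  then have summ: "summable s" by (rule summableI_nonneg_bounded[OF s0])
  have bound: "(cmod (cinner y (test_vector w n)))\<^sup>2 \<le> (\<Sum>j. s (j + n))" for n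
  proof -
    have "cmod (cinner y (test_vector w n)) \<le> (1 / sqrt (real (Suc n))) * (\<Sum>j<Suc n. sqrt (s (n + j)))"
    proof -
      have "cmod (cinner y (\<Sum>j<Suc n. cnj w ^ j *\<^sub>C ?b (n + j))) \<le> (\<Sum>j<Suc n. sqrt (s (n + j)))"
        unfolding cinner_sum_right s_def
        by (rule sum_norm_le)
          (simp add: cinner_scaleC_right norm_mult norm_power w, metis cinner_commute complex_mod_cnj order_refl)
      then show ?thesis
        unfolding test_vector_def cinner_scaleR_right norm_mult by (intro mult_mono) (auto simp: norm_divide)
    qed
    then have "(cmod (cinner y (test_vector w n)))\<^sup>2 \<le> ((1 / sqrt (real (Suc n))) * (\<Sum>j<Suc n. sqrt (s (n + j))))\<^sup>2"
      by (rule power_mono) simp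
    also have "\<dots> = (1 / real (Suc n)) * (\<Sum>j<Suc n. sqrt (s (n + j)))\<^sup>2"
      unfolding power_mult_distrib power_divide by simp
    also have "\<dots> \<le> (1 / real (Suc n)) * ((\<Sum>j<Suc n. (sqrt (s (n + j)))\<^sup>2) * real (card {..<Suc n}))"
      by (intro mult_left_mono sum_squared_le_sum_of_squares) auto
    also have "\<dots> = (\<Sum>j<Suc n. s (j + n))" by (simp add: s0 add.commute del: sum.lessThan_Suc)
    also have "\<dots> \<le> (\<Sum>j. s (j + n))"
      by (rule sum_le_suminf) (use s0 summ in \<open>auto simp: summable_iff_shift\<close>)
    finally show ?thesis .
  qed
  have "(\<lambda>n. \<Sum>j. s (j + n)) \<longlonglongrightarrow> 0" by (rule LIMSEQ_I) (use suminf_exist_split[OF _ summ] in auto)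
  then have "(\<lambda>n. (cmod (cinner y (test_vector w n)))\<^sup>2) \<longlonglongrightarrow> 0"
    by (rule tendsto_sandwich[OF _ _ tendsto_const, rotated -1]) (use bound in auto)
  from tendsto_real_sqrt[OF this] show ?thesis by (simp add: tendsto_norm_zero_iff)
qed

definition approx_eigenvalue :: "complex \<Rightarrow> ('h \<Rightarrow>\<^sub>L 'h) \<Rightarrow> complex \<Rightarrow> bool" where
  "approx_eigenvalue w A c \<longleftrightarrow> (\<lambda>n. A (test_vector w n) - c *\<^sub>C test_vector w n) \<longlonglongrightarrow> 0"

lemma approx_eigenvalue_T:
  assumes w: "cmod w = 1" shows "approx_eigenvalue w T w"
proof -
  have "norm (T (test_vector w n) - w *\<^sub>C test_vector w n) \<le> 2 / sqrt (real (Suc n))" for n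
  proof -
    \<comment> \<open>Multiplication by \<open>w\<close> turns the j-th summand into
      \<open>u j\<close>, and \<open>T\<close> turns it into \<open>u (Suc j)\<close>; the
      difference telescopes to two unit vectors.\<close>
    define u where "u j = (w * cnj w ^ j) *\<^sub>C (blinfun_apply T ^^ (n + j)) e" for j
    have u: "cnj w ^ j *\<^sub>C T ((blinfun_apply T ^^ (n + j)) e) = u (Suc j)" for j
      using cnj_mult_self(2)[OF w] by (simp add: u_def mult.assoc[symmetric])
    have nu: "norm (u j) = 1" for j by (simp add: u_def norm_scaleC norm_mult norm_power w norm_e)
    let ?s = "\<Sum>j<Suc n. cnj w ^ j *\<^sub>C (blinfun_apply T ^^ (n + j)) e"
    have "T ?s - w *\<^sub>C ?s = (\<Sum>j<Suc n. u (Suc j) - u j)"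
      unfolding blinfun.sum_right complex_vector.scale_sum_right sum_subtractf
      by (simp only: bounded_opsD[OF bounded] u) (simp add: u_def scaleC_scaleC)
    also have "\<dots> = u (Suc n) - u 0" by (rule sum_lessThan_telescope)
    finally have "norm (T ?s - w *\<^sub>C ?s) \<le> 2"
      using norm_triangle_ineq4[of "u (Suc n)" "u 0"] by (simp only: nu)
    moreover have "T (test_vector w n) - w *\<^sub>C test_vector w n = (1 / sqrt (real (Suc n))) *\<^sub>R (T ?s - w *\<^sub>C ?s)"
      unfolding test_vector_def scaleC_of_real[symmetric] scaleC_diff_right bounded_opsD[OF bounded] scaleC_scaleC
      by (simp add: mult.commute)
    ultimately show ?thesis by (simp add: divide_right_mono)
  qed
  moreover have "(\<lambda>n. 2 / sqrt (real (Suc n))) \<longlonglongrightarrow> 0"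
    by (intro tendsto_divide_0[OF tendsto_const] filterlim_at_top_imp_at_infinity
        filterlim_compose[OF sqrt_at_top] filterlim_compose[OF filterlim_real_sequentially filterlim_Suc])
  ultimately show ?thesis unfolding approx_eigenvalue_def
    by (rule Lim_null_comparison[OF always_eventually[OF allI]])
qed

lemma approx_eigenvalue_compose:
  assumes A: "A \<in> bounded_ops" "approx_eigenvalue w A a" and B: "approx_eigenvalue w B b"
  shows "approx_eigenvalue w (A o\<^sub>L B) (a * b)"
proof -
  let ?x = "test_vector w"
  have "(\<lambda>n. A (B (?x n) - b *\<^sub>C ?x n) + b *\<^sub>C (A (?x n) - a *\<^sub>C ?x n)) \<longlonglongrightarrow> A 0 + b *\<^sub>C 0"
    using assms unfolding approx_eigenvalue_def
    by (intro tendsto_add tendsto_intros bounded_linear.tendsto[OF bounded_linear_scaleC]) auto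
  then show ?thesis unfolding approx_eigenvalue_def
    by (simp add: blinfun.bilinear_simps bounded_opsD[OF A(1)] scaleC_diff_right scaleC_scaleC mult.commute)
qed

lemma approx_eigenvalue_add:
  assumes "approx_eigenvalue w A a" "approx_eigenvalue w B b" shows "approx_eigenvalue w (A + B) (a + b)"
  using tendsto_add[OF assms[unfolded approx_eigenvalue_def]] unfolding approx_eigenvalue_def
  by (simp add: blinfun.bilinear_simps scaleC_add_left algebra_simps)

lemma approx_eigenvalue_const: "approx_eigenvalue w (scaleC_op c id_blinfun) c"
  by (simp add: approx_eigenvalue_def scaleC_op.rep_eq)

lemma approx_eigenvalue_compact:
  assumes "cmod w = 1" "K \<in> compact_ops" shows "approx_eigenvalue w K 0"
  using compact_ops_weakly_null[OF assms(2), of "test_vector w" 1]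
  by (simp add: approx_eigenvalue_def norm_test_vector test_vector_weakly_null assms(1))

text \<open>Applying \<open>adj T\<close> to T x - w x gives x - w (adj T x), and multiplying by
  \<open>- cnj w\<close> isolates adj T x - (cnj w) x.\<close>

lemma approx_eigenvalue_adj:
  assumes w: "cmod w = 1" shows "approx_eigenvalue w (adj T) (cnj w)"
proof -
  let ?x = "test_vector w"
  have TT: "adj T (T y) = y" for y using arg_cong[OF isometry, of "\<lambda>A. blinfun_apply A y"] by simp
  have "(\<lambda>n. (- cnj w) *\<^sub>C adj T (T (?x n) - w *\<^sub>C ?x n)) \<longlonglongrightarrow> (- cnj w) *\<^sub>C adj T 0"
    using approx_eigenvalue_T[OF w] unfolding approx_eigenvalue_def
    by (intro bounded_linear.tendsto[OF bounded_linear_scaleC] tendsto_intros) auto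
  then show ?thesis unfolding approx_eigenvalue_def
    by (simp add: blinfun.bilinear_simps bounded_opsD[OF adj_bounded] TT scaleC_diff_right scaleC_scaleC
        cnj_mult_self[OF w] scaleC_one)
qed

lemma approx_eigenvalue_poly:
  assumes "B \<in> bounded_ops" "approx_eigenvalue w B b" shows "approx_eigenvalue w (op_poly B p) (poly p b)"
proof (induction p)
  case 0
  show ?case by (simp add: approx_eigenvalue_def)
next
  case (pCons a p)
  then show ?case
    using approx_eigenvalue_add[OF approx_eigenvalue_const approx_eigenvalue_compose[OF assms pCons.IH]] by simp
qed

lemma approx_eigenvalue_trig:
  assumes "cmod w = 1" "is_trig f A" shows "approx_eigenvalue w A (f w)"
proof -
  obtain m p where *: "A = trig_op m p" "f w = cnj w ^ m * poly p w"
    using assms unfolding is_trig_def by blast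
  have "cnj w ^ m = poly (monom 1 m) (cnj w)" by (simp add: poly_monom)
  then show ?thesis unfolding * trig_op_def
    by (auto intro!: approx_eigenvalue_compose approx_eigenvalue_poly approx_eigenvalue_adj approx_eigenvalue_T
        op_poly_bounded_ops bounded adj_bounded assms)
qed

lemma approx_eigenvalue_le_norm:
  assumes "cmod w = 1" "approx_eigenvalue w A c" shows "cmod c \<le> norm A"
proof (rule LIMSEQ_le_const2)
  let ?x = "test_vector w"
  show "(\<lambda>n. cmod c - norm (A (?x n) - c *\<^sub>C ?x n)) \<longlonglongrightarrow> cmod c"
    using tendsto_diff[OF tendsto_const tendsto_norm_zero[OF assms(2)[unfolded approx_eigenvalue_def]], of "cmod c"]
    by simp
  have "cmod c - norm (A (?x n) - c *\<^sub>C ?x n) \<le> norm A" for n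
  proof -
    have "cmod c = norm (c *\<^sub>C ?x n)" by (simp add: norm_scaleC norm_test_vector assms)
    also have "\<dots> \<le> norm (A (?x n)) + norm (A (?x n) - c *\<^sub>C ?x n)"
      using norm_triangle_ineq4[of "A (?x n)" "A (?x n) - c *\<^sub>C ?x n"] by simp
    also have "norm (A (?x n)) \<le> norm A" using norm_blinfun[of A "?x n"] by (simp add: norm_test_vector assms)
    finally show ?thesis by simp
  qed
  then show "\<exists>N. \<forall>n\<ge>N. cmod c - norm (A (?x n) - c *\<^sub>C ?x n) \<le> norm A" by blast
qed

text \<open>A compact operator contributes the value 0 on the test vectors, so a trigonometric
  polynomial keeps its approximate eigenvalue under a compact perturbation; the bound then passes to
  uniform limits.\<close>

lemma calc_lower_bound:
  assumes f: "f \<in> circle_continuous" and K: "K \<in> compact_ops" and w: "cmod w = 1"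
  shows "cmod (f w) \<le> norm (calc f + K)"
proof -
  obtain u A where u: "\<And>n. is_trig (u n) (A n)"
    "\<And>n z. cmod z = 1 \<Longrightarrow> cmod (f z - u n z) \<le> 1 / real (Suc n)" "A \<longlonglongrightarrow> calc f"
    using calc_sequence[OF f] by blast
  show ?thesis
  proof (rule LIMSEQ_le)
    have "(\<lambda>n. f w - u n w) \<longlonglongrightarrow> 0"
      by (rule Lim_null_comparison[OF _ tendsto_divide_Suc[of 1]]) (use u(2)[OF w] in auto)
    then have "(\<lambda>n. u n w) \<longlonglongrightarrow> f w" using tendsto_diff[OF tendsto_const, of _ 0 _ "f w"] by fastforce
    then show "(\<lambda>n. cmod (u n w)) \<longlonglongrightarrow> cmod (f w)" by (rule tendsto_norm)
    show "(\<lambda>n. norm (A n + K)) \<longlonglongrightarrow> norm (calc f + K)" by (intro tendsto_intros u(3))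
    have "approx_eigenvalue w (A n + K) (u n w + 0)" for n
      by (intro approx_eigenvalue_add approx_eigenvalue_trig approx_eigenvalue_compact w K u(1))
    then show "\<exists>N. \<forall>n\<ge>N. cmod (u n w) \<le> norm (A n + K)"
      using approx_eigenvalue_le_norm[OF w] by (metis add.right_neutral)
  qed
qed


section \<open>The symbol of an operator\<close>

lemma calc_diff_compact_unique:
  assumes f: "f \<in> circle_continuous" and g: "g \<in> circle_continuous" and "calc f - calc g \<in> compact_ops"
  shows "f = g"
proof (rule circle_continuous_eqI[OF f g])
  fix z :: complex assume "cmod z = 1"
  from calc_lower_bound[OF circle_continuous_diff[OF f g] compact_ops_minus[OF assms(3)] this]
  show "f z = g z" by (simp add: calc_diff f g)
qed

definition calc_algebra :: "('h \<Rightarrow>\<^sub>L 'h) set \<Rightarrow> ('h \<Rightarrow>\<^sub>L 'h) set" where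
  "calc_algebra J = {A. \<exists>f\<in>circle_continuous. A - calc f \<in> J}"

definition symbol :: "('h \<Rightarrow>\<^sub>L 'h) set \<Rightarrow> ('h \<Rightarrow>\<^sub>L 'h) \<Rightarrow> complex \<Rightarrow> complex" where
  "symbol J A = (THE f. f \<in> circle_continuous \<and> A - calc f \<in> J)"

end

text \<open>The ideal \<open>J\<close> bounds the failure of the calculus to be multiplicative. For
  a unitary \<open>T\<close> the defect is 0, so the choice of \<open>J\<close> is free:
  \<open>{0}\<close> gives the algebra of the calculus itself, \<open>compact_ops\<close> an
  extension of it.\<close>

locale toeplitz_system = shift_isometry T e for T :: "'h::chilbert_space \<Rightarrow>\<^sub>L 'h" and e +
  fixes J :: "('h \<Rightarrow>\<^sub>L 'h) set"
  assumes ideal: "closed_ideal J" and defect: "id_blinfun - (T o\<^sub>L adj T) \<in> J"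
begin

lemma symbol_eqI:
  assumes f: "f \<in> circle_continuous" and "A - calc f \<in> J" shows "symbol J A = f"
  unfolding symbol_def
proof (rule the_equality)
  show "f \<in> circle_continuous \<and> A - calc f \<in> J" using assms by simp
  fix g assume g: "g \<in> circle_continuous \<and> A - calc g \<in> J"
  have "(A - calc f) - (A - calc g) \<in> J" using assms(2) g by (blast intro: closed_ideal_diff[OF ideal])
  then have "calc g - calc f \<in> compact_ops" by (simp add: closed_idealD(1)[OF ideal])
  then show "g = f" using g f calc_diff_compact_unique by blast
qed

lemma symbol_calc [simp]: "f \<in> circle_continuous \<Longrightarrow> symbol J (calc f) = f"
  by (rule symbol_eqI) (simp_all add: closed_idealD(2)[OF ideal])

lemma calc_algebraE:
  assumes "A \<in> calc_algebra J" shows "symbol J A \<in> circle_continuous" "A - calc (symbol J A) \<in> J"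
  using assms symbol_eqI unfolding calc_algebra_def by auto

lemma calc_algebraI: "f \<in> circle_continuous \<Longrightarrow> A - calc f \<in> J \<Longrightarrow> A \<in> calc_algebra J"
  unfolding calc_algebra_def by blast

lemma calc_in_calc_algebra: "f \<in> circle_continuous \<Longrightarrow> calc f \<in> calc_algebra J"
  by (rule calc_algebraI[of f]) (simp_all add: closed_idealD(2)[OF ideal])

lemma calc_algebra_add:
  assumes A: "A \<in> calc_algebra J" and B: "B \<in> calc_algebra J"
  shows "A + B \<in> calc_algebra J" "symbol J (A + B) = (\<lambda>z. symbol J A z + symbol J B z)"
proof -
  note a = calc_algebraE[OF A] and b = calc_algebraE[OF B]
  have "(A + B) - calc (\<lambda>z. symbol J A z + symbol J B z) = (A - calc (symbol J A)) + (B - calc (symbol J B))"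
    by (simp add: calc_add a b)
  then have *: "(A + B) - calc (\<lambda>z. symbol J A z + symbol J B z) \<in> J"
    using closed_idealD(3)[OF ideal a(2) b(2)] by (simp only:)
  from calc_algebraI[OF circle_continuous_add[OF a(1) b(1)] *] show "A + B \<in> calc_algebra J" .
  from symbol_eqI[OF circle_continuous_add[OF a(1) b(1)] *]
  show "symbol J (A + B) = (\<lambda>z. symbol J A z + symbol J B z)" .
qed

lemma calc_algebra_scale:
  assumes A: "A \<in> calc_algebra J"
  shows "scaleC_op c A \<in> calc_algebra J" "symbol J (scaleC_op c A) = (\<lambda>z. c * symbol J A z)"
proof -
  note a = calc_algebraE[OF A]
  have "scaleC_op c A - calc (\<lambda>z. c * symbol J A z) = scaleC_op c (A - calc (symbol J A))"
    by (simp add: calc_scale a scaleC_op_diff)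
  then have *: "scaleC_op c A - calc (\<lambda>z. c * symbol J A z) \<in> J"
    using closed_ideal_scaleC[OF ideal a(2)] by (simp only:)
  from calc_algebraI[OF circle_continuous_scale[OF a(1)] *] show "scaleC_op c A \<in> calc_algebra J" .
  from symbol_eqI[OF circle_continuous_scale[OF a(1)] *] show "symbol J (scaleC_op c A) = (\<lambda>z. c * symbol J A z)" .
qed

lemma calc_algebra_subset_bounded_ops: "A \<in> calc_algebra J \<Longrightarrow> A \<in> bounded_ops"
proof -
  assume A: "A \<in> calc_algebra J"
  have "(A - calc (symbol J A)) + calc (symbol J A) \<in> bounded_ops"
    by (intro bounded_ops_add calc_bounded_ops calc_algebraE[OF A] compact_ops_bounded closed_idealD(1)[OF ideal])
  then show ?thesis by simp
qed

lemma calc_algebra_adj: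
  assumes A: "A \<in> calc_algebra J"
  shows "adj A \<in> calc_algebra J" "symbol J (adj A) = (\<lambda>z. cnj (symbol J A z))"
proof -
  note a = calc_algebraE[OF A]
  have "adj A - calc (\<lambda>z. cnj (symbol J A z)) = adj (A - calc (symbol J A))"
    by (simp add: calc_adj a adj_diff calc_bounded_ops calc_algebra_subset_bounded_ops[OF A])
  then have *: "adj A - calc (\<lambda>z. cnj (symbol J A z)) \<in> J"
    using closed_idealD(6)[OF ideal a(2)] by (simp only:)
  from calc_algebraI[OF circle_continuous_cnj[OF a(1)] *] show "adj A \<in> calc_algebra J" .
  from symbol_eqI[OF circle_continuous_cnj[OF a(1)] *] show "symbol J (adj A) = (\<lambda>z. cnj (symbol J A z))" .
qed

lemma calc_algebra_compose:
  assumes A: "A \<in> calc_algebra J" and B: "B \<in> calc_algebra J"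
  shows "A o\<^sub>L B \<in> calc_algebra J" "symbol J (A o\<^sub>L B) = (\<lambda>z. symbol J A z * symbol J B z)"
proof -
  note a = calc_algebraE[OF A] and b = calc_algebraE[OF B]
  let ?a = "calc (symbol J A)" and ?b = "calc (symbol J B)" and ?c = "calc (\<lambda>z. symbol J A z * symbol J B z)"
  have "(A o\<^sub>L B) - ?c = (((A - ?a) o\<^sub>L B) + (?a o\<^sub>L (B - ?b))) + ((?a o\<^sub>L ?b) - ?c)"
    by (simp add: blinfun_compose_simps)
  moreover have "\<dots> \<in> J"
    by (intro closed_idealD(3)[OF ideal] closed_idealD(4)[OF ideal a(2)] closed_idealD(5)[OF ideal b(2)]
        calc_mult[OF ideal defect] calc_algebra_subset_bounded_ops B calc_bounded_ops a(1) b(1))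
  ultimately have *: "(A o\<^sub>L B) - ?c \<in> J" by (simp only:)
  from calc_algebraI[OF circle_continuous_mult[OF a(1) b(1)] *] show "A o\<^sub>L B \<in> calc_algebra J" .
  from symbol_eqI[OF circle_continuous_mult[OF a(1) b(1)] *]
  show "symbol J (A o\<^sub>L B) = (\<lambda>z. symbol J A z * symbol J B z)" .
qed

lemma symbol_le_norm:
  assumes A: "A \<in> calc_algebra J" and z: "cmod z = 1" shows "cmod (symbol J A z) \<le> norm A"
  using calc_lower_bound[OF calc_algebraE(1)[OF A] closed_idealD(1)[OF ideal calc_algebraE(2)[OF A]] z] by simp

lemma calc_algebra_diff:
  assumes A: "A \<in> calc_algebra J" and B: "B \<in> calc_algebra J"
  shows "A - B \<in> calc_algebra J" "symbol J (A - B) = (\<lambda>z. symbol J A z - symbol J B z)"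
  using calc_algebra_add[OF A calc_algebra_scale(1)[OF B, of "-1"]] calc_algebra_scale[OF B, of "-1"] by simp_all

text \<open>Because the symbol is contractive, a norm-convergent sequence has uniformly Cauchy
  symbols. The calculus is continuous as well, so the remainders also converge, and their limit
  stays in the closed ideal.\<close>

lemma closed_calc_algebra: "closed (calc_algebra J)"
proof (rule closed_sequential_limits[THEN iffD2], intro allI impI, elim conjE)
  fix X L assume X: "\<forall>n. X n \<in> calc_algebra J" and L: "X \<longlonglongrightarrow> L"
  define f where "f n = symbol J (X n)" for n
  have f: "f n \<in> circle_continuous" "X n - calc (f n) \<in> J" for n
    using X calc_algebraE by (auto simp: f_def)
  have dist: "cmod (f m z - f n z) \<le> norm (X m - X n)" if "cmod z = 1" for m n z
    using symbol_le_norm[OF calc_algebra_diff(1) that, of "X m" "X n"] X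
    by (simp add: f_def calc_algebra_diff(2))
  have "uniformly_Cauchy_on (sphere 0 1) f"
  proof (rule uniformly_Cauchy_onI)
    fix d :: real assume "d > 0"
    then obtain M where "\<And>m n. m \<ge> M \<Longrightarrow> n \<ge> M \<Longrightarrow> norm (X m - X n) < d"
      using CauchyD[OF LIMSEQ_imp_Cauchy[OF L]] by blast
    then show "\<exists>M. \<forall>x\<in>sphere 0 1. \<forall>m\<ge>M. \<forall>n\<ge>M. dist (f m x) (f n x) < d"
      using dist by (intro exI[of _ M]) (metis dist_norm le_less_trans mem_sphere_0)
  qed
  then obtain g where g: "uniform_limit (sphere 0 1) f g sequentially"
    using Cauchy_uniformly_convergent unfolding uniformly_convergent_on_def by blast
  \<comment> \<open>The uniform limit is controlled on the circle only, whereas elements of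
    \<open>circle_continuous\<close> vanish off it.\<close>
  define h where "h z = (if z \<in> sphere 0 1 then g z else 0)" for z
  have lim: "uniform_limit (sphere 0 1) f h sequentially"
    using g by (rule uniform_limit_cong'[THEN iffD1, rotated -1]) (simp_all add: h_def)
  have "continuous_on (sphere 0 1) h"
    by (rule uniform_limit_theorem[OF _ lim]) (use f in \<open>auto simp: circle_continuous_def\<close>)
  then have h: "h \<in> circle_continuous" by (simp add: circle_continuous_def h_def)
  have "(\<lambda>n. calc (f n)) \<longlonglongrightarrow> calc h"
  proof (rule metric_LIMSEQ_I)
    fix d :: real assume "d > 0"
    then have "\<forall>\<^sub>F n in sequentially. \<forall>z\<in>sphere 0 1. dist (f n z) (h z) < d / 2"
      using uniform_limitD[OF lim] half_gt_zero by blast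
    then obtain N where N: "\<And>n z. n \<ge> N \<Longrightarrow> cmod z = 1 \<Longrightarrow> dist (f n z) (h z) < d / 2"
      unfolding eventually_sequentially by (metis mem_sphere_0)
    have "dist (calc (f n)) (calc h) < d" if "n \<ge> N" for n
    proof -
      have "norm (calc (\<lambda>z. f n z - h z)) \<le> d / 2"
        by (rule norm_calc_le[OF circle_continuous_diff[OF f(1) h]]) (use N[OF that] in \<open>auto simp: dist_norm intro: less_imp_le\<close>)
      then show ?thesis using \<open>d > 0\<close> by (simp add: dist_norm calc_diff f h)
    qed
    then show "\<exists>N. \<forall>n\<ge>N. dist (calc (f n)) (calc h) < d" by blast
  qed
  then have "(\<lambda>n. X n - calc (f n)) \<longlonglongrightarrow> L - calc h" by (intro tendsto_diff L)
  then have "L - calc h \<in> J" by (rule closed_sequentially[OF closed_idealD(7)[OF ideal] f(2)])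
  then show "L \<in> calc_algebra J" by (rule calc_algebraI[OF h])
qed

lemma ideal_subset_calc_algebra: "J \<subseteq> calc_algebra J"
  using calc_algebraI[OF circle_continuous_zero] by (auto simp: calc_zero)

lemma symbol_ideal: "K \<in> J \<Longrightarrow> symbol J K = (\<lambda>z. 0)"
  using symbol_eqI[OF circle_continuous_zero] by (simp add: calc_zero)

lemma cstar_calc_algebra: "cstar_subalgebra (calc_algebra J)"
  unfolding cstar_subalgebra_def
  using subsetD[OF ideal_subset_calc_algebra closed_idealD(2)[OF ideal]]
  by (auto intro: calc_algebra_add(1) calc_algebra_compose(1) calc_algebra_scale(1) calc_algebra_adj(1)
      closed_calc_algebra calc_algebra_subset_bounded_ops)

lemma T_in_calc_algebra: "T \<in> calc_algebra J" "symbol J T = circle_id"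
  using calc_in_calc_algebra[OF circle_id_continuous] symbol_calc[OF circle_id_continuous] by (simp_all add: calc_id)

lemma id_in_calc_algebra: "id_blinfun \<in> calc_algebra J" "symbol J id_blinfun = (\<lambda>z. if z \<in> sphere 0 1 then 1 else 0)"
  using calc_in_calc_algebra[OF circle_continuous_one] symbol_calc[OF circle_continuous_one] unfolding calc_one by blast+

lemma symbol_hom: "unital_star_hom (op_algebra (calc_algebra J)) circle_algebra (symbol J)"
  by (simp add: unital_star_hom_def op_algebra_def circle_algebra_def calc_algebraE(1) id_in_calc_algebra
      calc_algebra_add calc_algebra_compose calc_algebra_scale calc_algebra_adj)

lemma symbol_surj: "symbol J ` calc_algebra J = circle_continuous"
proof
  show "circle_continuous \<subseteq> symbol J ` calc_algebra J"
    using calc_in_calc_algebra symbol_calc by (metis image_eqI subsetI)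
qed (use calc_algebraE(1) in blast)

lemma symbol_kernel: "{A \<in> calc_algebra J. symbol J A = (\<lambda>z. 0)} = J"
proof -
  have "A \<in> J" if "A \<in> calc_algebra J" "symbol J A = (\<lambda>z. 0)" for A
    using calc_algebraE(2)[OF that(1)] that(2) by (simp add: calc_zero)
  then show ?thesis using ideal_subset_calc_algebra symbol_ideal by auto
qed

lemma calc_algebra_subset:
  assumes "cstar_subalgebra A" "T \<in> A" "id_blinfun \<in> A" "J \<subseteq> A" shows "calc_algebra J \<subseteq> A"
proof
  fix B assume B: "B \<in> calc_algebra J"
  have "(B - calc (symbol J B)) + calc (symbol J B) \<in> A"
    by (intro cstar_subalgebraD(3)[OF assms(1)] calc_in_cstar_subalgebra assms calc_algebraE[OF B]
        subsetD[OF assms(4)])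
  then show "B \<in> A" by simp
qed

lemma extension_calc_algebra:
  assumes "J = compact_ops" shows "extension_by_compacts (calc_algebra J) circle_algebra (symbol J)"
  unfolding extension_by_compacts_def
  using cstar_calc_algebra id_in_calc_algebra(1) ideal_subset_calc_algebra symbol_hom symbol_surj symbol_kernel assms
  by (simp add: circle_algebra_def)

text \<open>For unitary \<open>T\<close> multiplicativity can be taken modulo the ideal
  \<open>{0}\<close>, whatever \<open>J\<close> is. The calculus is then an exact homomorphism, and
  thereby the splitting.\<close>

lemma calc_hom:
  assumes unitary: "T o\<^sub>L adj T = id_blinfun"
  shows "unital_star_hom circle_algebra (op_algebra (calc_algebra J)) calc"
proof -
  have mult: "calc (\<lambda>z. f z * g z) = calc f o\<^sub>L calc g" if "f \<in> circle_continuous" "g \<in> circle_continuous" for f g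
    using calc_mult[OF closed_ideal_zero _ that] unitary by simp
  then show ?thesis
    by (simp add: unital_star_hom_def op_algebra_def circle_algebra_def calc_in_calc_algebra calc_add calc_scale
        calc_adj flip: calc_one)
qed

lemma split_extension_calc_algebra:
  assumes "J = compact_ops" and "T o\<^sub>L adj T = id_blinfun"
  shows "split_extension (calc_algebra J) (symbol J)"
  unfolding split_extension_def
  using extension_calc_algebra[OF assms(1)] calc_hom[OF assms(2)] symbol_calc by blast

text \<open>With \<open>J = compact_ops\<close> the Busby invariant becomes a full coset of the
  compact operators, described without reference to the algebra; unitary equivalences are checked on
  this form.\<close>

lemma busby_calc_algebra:
  assumes "f \<in> circle_continuous" shows "busby (calc_algebra J) (symbol J) f = {A. A - calc f \<in> J}"
  unfolding busby_def using assms calc_algebraE(2) calc_algebraI symbol_eqI by blast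

end

section \<open>Operators on square-summable families\<close>

lemma cinner_ket: "cinner (ket i) x = coeff x i"
proof -
  have "cinner (ket i) x = (\<Sum>\<^sub>\<infinity>j\<in>{i}. cnj (coeff (ket i) j) * coeff x j)"
    unfolding cinner_ell2.rep_eq by (rule infsum_cong_neutral) (auto simp: ket.rep_eq)
  then show ?thesis by (simp add: ket.rep_eq)
qed

lemma orthonormal_ket: "orthonormal_family ket"
  by (auto simp: orthonormal_family_def cinner_ket ket.rep_eq)

lemma total_ket: "total_family (ket :: 'i \<Rightarrow> 'i ell2)"
  unfolding total_family_def closure_approachable
proof (intro allI impI)
  fix x :: "'i ell2" and e :: real assume "e > 0"
  have "((\<lambda>i. (cmod (coeff x i))\<^sup>2) has_sum (norm x)\<^sup>2) UNIV"
    using summable_coeff[of x] by (simp add: norm_ell2_squared)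
  then have "\<forall>\<^sub>F F in finite_subsets_at_top UNIV. dist (\<Sum>i\<in>F. (cmod (coeff x i))\<^sup>2) ((norm x)\<^sup>2) < e\<^sup>2"
    unfolding has_sum_def using \<open>e > 0\<close> by (intro tendstoD) auto
  then obtain F where F: "finite F" "dist (\<Sum>i\<in>F. (cmod (coeff x i))\<^sup>2) ((norm x)\<^sup>2) < e\<^sup>2"
    unfolding eventually_finite_subsets_at_top by blast
  have "(norm (x - finite_proj ket F x))\<^sup>2 = (norm x)\<^sup>2 - (\<Sum>i\<in>F. (cmod (coeff x i))\<^sup>2)"
    using norm_finite_proj[OF orthonormal_ket F(1), of x] by (simp add: cinner_ket)
  also have "\<dots> < e\<^sup>2" using F(2) unfolding dist_real_def by linarith
  finally have "dist (finite_proj ket F x) x < e"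
    using \<open>e > 0\<close> by (simp add: dist_norm norm_minus_commute power2_less_imp_less)
  moreover have "finite_proj ket F x \<in> complex_vector.span (range ket)"
    unfolding finite_proj_def by (intro complex_vector.span_sum complex_vector.span_scale complex_vector.span_base) simp
  ultimately show "\<exists>y\<in>complex_vector.span (range ket). dist y x < e" by blast
qed

lemma ell2_eqI: "(\<And>i. coeff x i = coeff y i) \<Longrightarrow> x = y"
  by (simp add: coeff_inject[symmetric] fun_eq_iff)

lemma finite_rank_compact:
  fixes S :: "'i ell2 \<Rightarrow>\<^sub>L 'h::chilbert_space"
  assumes S: "S \<in> bounded_ops" and F: "finite F" and zero: "\<And>i. i \<notin> F \<Longrightarrow> S (ket i) = 0"
  shows "S \<in> compact_ops"
proof -
  let ?R = "\<Sum>i\<in>F. rank_one (S (ket i)) (ket i)"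
  have R: "?R \<in> compact_ops" using F
    by (induction F) (auto intro: compact_ops_add rank_one_compact)
  have "?R = S"
  proof (rule blinfun_eqI_total[OF compact_ops_bounded[OF R] S total_ket])
    fix j
    have "?R (ket j) = (\<Sum>i\<in>F. if i = j then S (ket j) else 0)"
      unfolding blinfun.sum_left by (intro sum.cong refl) (auto simp: rank_one_apply cinner_ket ket.rep_eq scaleC_one)
    also have "\<dots> = S (ket j)" using F zero by simp
    finally show "?R (ket j) = S (ket j)" .
  qed
  with R show ?thesis by simp
qed

text \<open>The zero branch keeps the definition total: when the map is not bijective, composing
  with \<open>inv\<close> may repeat one coefficient infinitely often.\<close>

lift_definition reindex :: "('i \<Rightarrow> 'j) \<Rightarrow> 'i ell2 \<Rightarrow> 'j ell2" is
  "\<lambda>\<pi> f j. if bij \<pi> then f (inv \<pi> j) else 0"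
proof -
  fix \<pi> :: "'i \<Rightarrow> 'j" and f :: "'i \<Rightarrow> complex" assume f: "square_summable f"
  show "square_summable (\<lambda>j. if bij \<pi> then f (inv \<pi> j) else 0)"
  proof (cases "bij \<pi>")
    case True
    then show ?thesis
      using f summable_on_reindex_bij_betw[OF bij_imp_bij_inv, of \<pi> "\<lambda>i. (cmod (f i))\<^sup>2"]
      by (simp add: square_summable_def)
  qed (simp add: square_summable_def)
qed

lemma cinner_reindex:
  assumes "bij \<pi>" shows "cinner (reindex \<pi> x) (reindex \<pi> y) = cinner x y"
  unfolding cinner_ell2.rep_eq reindex.rep_eq
  using assms infsum_reindex_bij_betw[OF bij_imp_bij_inv[OF assms], of "\<lambda>i. cnj (coeff x i) * coeff y i"] by simp

definition permutation_op :: "('i \<Rightarrow> 'j) \<Rightarrow> ('i ell2 \<Rightarrow>\<^sub>L 'j ell2)" where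
  "permutation_op \<pi> = Blinfun (reindex \<pi>)"

lemma permutation_op_apply:
  assumes "bij \<pi>" shows "permutation_op \<pi> x = reindex \<pi> x"
proof -
  have "bounded_linear (reindex \<pi>)"
  proof (rule bounded_linear_intro[of _ 1])
    show "norm (reindex \<pi> x) \<le> norm x * 1" for x
      using norm_eqI_cinner[OF cinner_reindex[OF assms], of x] by simp
  qed (auto intro!: ell2_eqI simp: reindex.rep_eq plus_ell2.rep_eq scaleR_ell2.rep_eq)
  then show ?thesis by (simp add: permutation_op_def bounded_linear_Blinfun_apply)
qed

lemma permutation_op_bounded:
  assumes "bij \<pi>" shows "permutation_op \<pi> \<in> bounded_ops"
  by (auto simp: bounded_ops_def permutation_op_apply[OF assms] reindex.rep_eq scaleC_ell2.rep_eq intro!: ell2_eqI)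

lemma permutation_op_ket:
  assumes "bij \<pi>" shows "permutation_op \<pi> (ket i) = ket (\<pi> i)"
  unfolding permutation_op_apply[OF assms]
proof (rule ell2_eqI)
  fix j
  have "inv \<pi> j = i \<longleftrightarrow> j = \<pi> i" by (metis assms bij_inv_eq_iff)
  then show "coeff (reindex \<pi> (ket i)) j = coeff (ket (\<pi> i)) j" using assms by (simp add: reindex.rep_eq ket.rep_eq)
qed

lemma unitary_permutation_op:
  assumes \<pi>: "bij \<pi>" shows "unitary_op (permutation_op \<pi>)"
proof -
  let ?U = "permutation_op \<pi>" and ?V = "permutation_op (inv \<pi>)"
  have \<pi>': "bij (inv \<pi>)" using \<pi> by (rule bij_imp_bij_inv)
  have b: "?U \<in> bounded_ops" "?V \<in> bounded_ops" using \<pi> \<pi>' by (simp_all add: permutation_op_bounded)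
  have UV: "?U o\<^sub>L ?V = id_blinfun"
    by (rule blinfun_eqI_total[OF bounded_ops_compose[OF b] bounded_ops_id total_ket])
      (simp add: permutation_op_ket \<pi> \<pi>' surj_f_inv_f bij_is_surj)
  have iso: "adj ?U o\<^sub>L ?U = id_blinfun"
    by (rule isometry_imp_adj_compose[OF b(1)]) (simp add: permutation_op_apply[OF \<pi>] cinner_reindex[OF \<pi>])
  have "adj ?U = adj ?U o\<^sub>L (?U o\<^sub>L ?V)" by (simp add: UV blinfun_compose_simps)
  also have "\<dots> = ?V" by (simp add: iso blinfun_compose_simps flip: blinfun_compose_assoc)
  finally show ?thesis using iso UV b by (simp add: unitary_op_def)
qed

text \<open>A point that never returns to itself makes \<open>ket i\<close> a wandering vector, and
  unitarity gives defect 0, which lies in every ideal.\<close>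

lemma toeplitz_system_permutation:
  assumes \<pi>: "bij \<pi>" and free: "\<And>n. (\<pi> ^^ Suc n) i \<noteq> i" and J: "closed_ideal J"
  shows "toeplitz_system (permutation_op \<pi>) (ket i) J"
proof -
  have U: "unitary_op (permutation_op \<pi>)" by (rule unitary_permutation_op[OF \<pi>])
  have pow: "(blinfun_apply (permutation_op \<pi>) ^^ n) (ket i) = ket ((\<pi> ^^ n) i)" for n
    by (induction n) (simp_all add: permutation_op_ket[OF \<pi>])
  show ?thesis
  proof unfold_locales
    have "complex_of_real ((norm (ket i))\<^sup>2) = 1" by (simp add: cinner_self[symmetric] cinner_ket ket.rep_eq del: of_real_power)
    then show "norm (ket i) = 1"
      using norm_ge_zero[of "ket i"] by (auto simp: power2_eq_1_iff simp flip: of_real_power)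
    show "cinner (ket i) ((blinfun_apply (permutation_op \<pi>) ^^ Suc n) (ket i)) = 0" for n
      unfolding pow cinner_ket ket.rep_eq using free[of n] by simp
  qed (use U J in \<open>auto simp: unitary_op_def closed_idealD(2)\<close>)
qed

section \<open>Partial translations\<close>

lemma partial_translation_bounded: "partial_translation n \<in> bounded_ops"
  by (auto simp: bounded_ops_def partial_translation.rep_eq translate.rep_eq scaleC_ell2.rep_eq intro!: ell2_eqI)

lemma inv_incl: "inv incl (incl x) = (x :: 'x::int_subset)"
  by (rule inv_f_f[OF inj_incl])

lemma partial_translation_ket_incl:
  "incl y = incl x + n \<Longrightarrow> partial_translation n (ket x) = ket (y :: 'x::int_subset)"
  unfolding partial_translation_ket by (metis inv_incl rangeI)

lemma partial_translation_ket_zero: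
  "incl x + n \<notin> range (incl :: 'x \<Rightarrow> int) \<Longrightarrow> partial_translation n (ket x) = (0 :: 'x::int_subset ell2)"
  unfolding partial_translation_ket by simp

lemma coeff_partial_translation_ket:
  "coeff (partial_translation n (ket x)) y = (if incl y = incl x + n then 1 else 0 :: complex)"
  for x y :: "'x::int_subset"
proof (cases "incl x + n \<in> range (incl :: 'x \<Rightarrow> int)")
  case True
  then obtain z :: 'x where z: "incl z = incl x + n" by (metis imageE)
  have "incl y = incl z \<longleftrightarrow> y = z" by (rule inj_eq[OF inj_incl])
  then show ?thesis by (simp add: partial_translation_ket_incl[OF z] ket.rep_eq flip: z)
next
  case False
  then have "incl y \<noteq> incl x + n" by (metis rangeI)
  then show ?thesis by (simp add: partial_translation_ket_zero[OF False] zero_ell2.rep_eq)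
qed

lemma adj_partial_translation:
  "adj (partial_translation n) = (partial_translation (- n) :: 'x::int_subset ell2 \<Rightarrow>\<^sub>L 'x ell2)"
proof (rule blinfun_eqI_total[OF adj_bounded_ops[OF partial_translation_bounded] partial_translation_bounded total_ket])
  fix j :: 'x
  show "adj (partial_translation n) (ket j) = partial_translation (- n) (ket j)"
  proof (rule ell2_eqI)
    fix i :: 'x
    have "coeff (adj (partial_translation n) (ket j)) i = cnj (cinner (ket j) (partial_translation n (ket i)))"
      unfolding cinner_ket[symmetric] cinner_adj'[OF partial_translation_bounded] by (rule cinner_commute)
    then show "coeff (adj (partial_translation n) (ket j)) i = coeff (partial_translation (- n) (ket j)) i"
      by (auto simp: cinner_ket coeff_partial_translation_ket)
  qed
qed

lemma partial_translation_0: "partial_translation 0 = id_blinfun"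
  by (rule blinfun_eqI_total[OF partial_translation_bounded bounded_ops_id total_ket])
    (simp add: partial_translation_ket_incl)

lemma cstar_partial_translation_algebra:
  "cstar_subalgebra (partial_translation_algebra :: ('x::int_subset ell2 \<Rightarrow>\<^sub>L 'x ell2) set)"
  "partial_translation n \<in> (partial_translation_algebra :: ('x ell2 \<Rightarrow>\<^sub>L 'x ell2) set)"
  using cstar_generated(1,2)[of "range partial_translation"] partial_translation_bounded
  unfolding partial_translation_algebra_def by blast+

lemma id_in_partial_translation_algebra: "id_blinfun \<in> partial_translation_algebra"
  using cstar_partial_translation_algebra(2)[of 0] by (simp add: partial_translation_0)

lemma partial_translation_algebra_subset:
  assumes "cstar_subalgebra A" "\<And>n. partial_translation (int n) \<in> A"
  shows "partial_translation_algebra \<subseteq> A"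
proof -
  have "partial_translation n \<in> A" for n
  proof (cases "0 \<le> n")
    case True
    then show ?thesis using assms(2)[of "nat n"] by simp
  next
    case False
    then show ?thesis
      using cstar_subalgebraD(6)[OF assms(1) assms(2)[of "nat (- n)"]] by (simp add: adj_partial_translation)
  qed
  then show ?thesis
    unfolding partial_translation_algebra_def
    using partial_translation_bounded by (intro cstar_generated(3) assms(1)) blast+
qed

subsection \<open>Translations of the integers\<close>

lemma translation_add:
  "partial_translation (m + n) = (partial_translation m o\<^sub>L partial_translation n :: int ell2 \<Rightarrow>\<^sub>L int ell2)"
  by (rule blinfun_eqI_total[OF partial_translation_bounded bounded_ops_compose total_ket])
    (simp_all add: partial_translation_bounded partial_translation_ket_incl[of "_ + _"] incl_int_def
      partial_translation_ket_incl[of "_ + n + m"] partial_translation_ket_incl[of "_ + (m + n)"] ac_simps)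

abbreviation (input) translation_one :: "int ell2 \<Rightarrow>\<^sub>L int ell2" where
  "translation_one \<equiv> partial_translation 1"

lemma toeplitz_system_translation: "toeplitz_system translation_one (ket 0) {0}"
proof -
  have eq: "translation_one = permutation_op (\<lambda>k. k + 1)"
  proof (rule blinfun_eqI_total[OF partial_translation_bounded permutation_op_bounded total_ket])
    show "bij (\<lambda>k :: int. k + 1)" by (rule bij_plus_right)
    then show "translation_one (ket i) = permutation_op (\<lambda>k. k + 1) (ket i)" for i
      by (simp add: permutation_op_ket partial_translation_ket_incl[of "i + 1"] incl_int_def)
  qed
  have "((\<lambda>k. k + 1) ^^ n) (0 :: int) = int n" for n by (induction n) auto
  then show ?thesis unfolding eq
    by (intro toeplitz_system_permutation closed_ideal_zero bij_plus_right) (simp del: funpow.simps)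
qed


lemma translation_unitary:
  "adj translation_one o\<^sub>L translation_one = id_blinfun" "translation_one o\<^sub>L adj translation_one = id_blinfun"
  unfolding adj_partial_translation translation_add[symmetric] by (simp_all add: partial_translation_0)

interpretation Z: toeplitz_system translation_one "ket 0" "{0}"
  by (rule toeplitz_system_translation)

lemma partial_translation_algebra_int: "partial_translation_algebra = Z.calc_algebra {0}"
proof (rule antisym)
  show "partial_translation_algebra \<subseteq> Z.calc_algebra {0}"
  proof (rule partial_translation_algebra_subset[OF Z.cstar_calc_algebra])
    show "partial_translation (int n) \<in> Z.calc_algebra {0}" for n
    proof (induction n)
      case 0
      then show ?case using Z.id_in_calc_algebra(1) by (simp add: partial_translation_0)
    next
      case (Suc n)
      have "partial_translation (int (Suc n)) = translation_one o\<^sub>L partial_translation (int n)"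
        unfolding translation_add[symmetric] by simp
      then show ?case using Z.calc_algebra_compose(1)[OF Z.T_in_calc_algebra(1) Suc] by simp
    qed
  qed
  show "Z.calc_algebra {0} \<subseteq> partial_translation_algebra"
    using cstar_subalgebraD(2)[OF cstar_partial_translation_algebra(1)]
    by (intro Z.calc_algebra_subset cstar_partial_translation_algebra id_in_partial_translation_algebra) auto
qed

subsection \<open>Partial translations of the nonzero integers\<close>

lemma range_incl_nonzero: "range (incl :: nonzero_int \<Rightarrow> int) = - {0}"
proof -
  have "k \<in> range Rep_nonzero_int" if "k \<noteq> 0" for k
    using that Abs_nonzero_int_inverse[of k] by (metis DiffI UNIV_I rangeI singletonD)
  then show ?thesis using Rep_nonzero_int by (auto simp: incl_nonzero_int_def)
qed

definition nz :: "int \<Rightarrow> nonzero_int" where "nz k = Abs_nonzero_int k"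

lemma incl_nz: "k \<noteq> 0 \<Longrightarrow> incl (nz k) = k"
  by (simp add: nz_def incl_nonzero_int_def Abs_nonzero_int_inverse)

lemma incl_nonzero: "incl (x :: nonzero_int) \<noteq> 0"
  using range_incl_nonzero by blast

lemma nz_eqI: "incl x = incl y \<Longrightarrow> x = (y :: nonzero_int)"
  by (rule injD[OF inj_incl])

lemma nonzero_partial_translation_ket:
  "partial_translation n (ket x) = (if incl x + n = 0 then 0 else ket (nz (incl x + n)))"
proof (cases "incl x + n = 0")
  case True
  then show ?thesis by (simp add: partial_translation_ket_zero range_incl_nonzero)
next
  case False
  then show ?thesis by (simp add: partial_translation_ket_incl[of "nz (incl x + n)"] incl_nz)
qed

text \<open>Closing the gap at \<open>0\<close> turns the translation by \<open>1\<close> into a bijection of the nonzero integers.\<close>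

definition gap_shift :: "nonzero_int \<Rightarrow> nonzero_int" where
  "gap_shift x = nz (if incl x = -1 then 1 else incl x + 1)"

lemma incl_gap_shift: "incl (gap_shift x) = (if incl x = -1 then 1 else incl x + 1)"
  unfolding gap_shift_def by (rule incl_nz) auto

lemma bij_gap_shift: "bij gap_shift"
proof (rule bijI)
  show "inj gap_shift"
  proof (rule injI)
    fix x y assume "gap_shift x = gap_shift y"
    then have "incl (gap_shift x) = incl (gap_shift y)" by simp
    then have "incl x = incl y"
      using incl_nonzero[of x] incl_nonzero[of y] by (simp add: incl_gap_shift split: if_splits)
    then show "x = y" by (rule nz_eqI)
  qed
  have "\<exists>x. gap_shift x = y" for y
  proof (rule exI[of _ "nz (if incl y = 1 then -1 else incl y - 1)"], rule nz_eqI)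
    show "incl (gap_shift (nz (if incl y = 1 then -1 else incl y - 1))) = incl y"
      using incl_nonzero[of y] by (auto simp: incl_gap_shift incl_nz)
  qed
  then show "surj gap_shift" by (metis surjI)
qed

lemma gap_shift_free: "(gap_shift ^^ Suc n) (nz 1) \<noteq> nz 1"
proof -
  have "incl ((gap_shift ^^ n) (nz 1)) = int n + 1" for n
    by (induction n) (simp_all add: incl_nz incl_gap_shift)
  then have "incl ((gap_shift ^^ Suc n) (nz 1)) \<noteq> incl (nz 1)" by (simp add: incl_nz del: funpow.simps)
  then show ?thesis by metis
qed

abbreviation (input) gap_shift_op :: "nonzero_int ell2 \<Rightarrow>\<^sub>L nonzero_int ell2" where
  "gap_shift_op \<equiv> permutation_op gap_shift"

interpretation X: toeplitz_system gap_shift_op "ket (nz 1)" compact_ops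
  by (rule toeplitz_system_permutation[OF bij_gap_shift gap_shift_free closed_ideal_compact_ops])

text \<open>The operators differ only at the point -1: partial translation kills its basis vector,
  while the gap shift sends it to that of 1.\<close>

lemma gap_shift_op_diff_compact: "partial_translation 1 - gap_shift_op \<in> compact_ops"
proof (rule finite_rank_compact[of _ "{nz (-1)}"])
  fix x assume "x \<notin> {nz (-1)}"
  then have "incl x \<noteq> -1" using nz_eqI[of x "nz (-1)"] by (auto simp: incl_nz)
  then show "(partial_translation 1 - gap_shift_op) (ket x) = 0"
    by (simp add: blinfun.bilinear_simps permutation_op_ket bij_gap_shift nonzero_partial_translation_ket gap_shift_def)
qed (simp_all add: bounded_ops_diff partial_translation_bounded permutation_op_bounded bij_gap_shift)

text \<open>Translating in two steps fails only from -n, where the intermediate point would be the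
  missing 0. For n = 0 there is no such point and \<open>nz 0\<close> is unspecified, but then the
  two operators agree on every basis vector.\<close>

lemma nonzero_partial_translation_Suc:
  "partial_translation (n + 1) - (partial_translation 1 o\<^sub>L partial_translation n :: nonzero_int ell2 \<Rightarrow>\<^sub>L _) \<in> compact_ops"
proof (rule finite_rank_compact[of _ "{nz (- n)}"])
  fix x assume "x \<notin> {nz (- n)}"
  then have "incl x + n \<noteq> 0" using nz_eqI[of x "nz (- n)"] incl_nonzero[of x] incl_nz[of "- n"] by force
  then show "(partial_translation (n + 1) - (partial_translation 1 o\<^sub>L partial_translation n)) (ket x) = 0"
    by (simp add: blinfun.bilinear_simps nonzero_partial_translation_ket incl_nz add.assoc)
qed (simp_all add: bounded_ops_diff bounded_ops_compose partial_translation_bounded)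

text \<open>Only from -1 does translation by 1 lead into the gap, so its defect on the initial side
  is the projection onto that basis vector. Translations by i + 1 and j + 1 carry -1 to i and j and
  yield all matrix units.\<close>

lemma compact_in_nonzero_algebra:
  "compact_ops \<subseteq> (partial_translation_algebra :: (nonzero_int ell2 \<Rightarrow>\<^sub>L nonzero_int ell2) set)"
proof (rule compact_ops_subset_if_rank_one[OF cstar_partial_translation_algebra(1) orthonormal_ket total_ket])
  fix i j :: nonzero_int
  let ?s = "partial_translation :: int \<Rightarrow> nonzero_int ell2 \<Rightarrow>\<^sub>L nonzero_int ell2"
  let ?u = "ket (nz (-1))"
  have "id_blinfun - (adj (?s 1) o\<^sub>L ?s 1) = rank_one ?u ?u"
  proof (rule blinfun_eqI_total[OF _ rank_one_bounded total_ket])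
    fix x
    show "(id_blinfun - (adj (?s 1) o\<^sub>L ?s 1)) (ket x) = rank_one ?u ?u (ket x)"
    proof (cases "x = nz (-1)")
      case True
      then show ?thesis
        by (simp add: rank_one_apply cinner_ket ket.rep_eq blinfun.bilinear_simps adj_partial_translation
            nonzero_partial_translation_ket incl_nz scaleC_one)
    next
      case False
      then have "incl x \<noteq> -1" using nz_eqI[of x "nz (-1)"] by (auto simp: incl_nz)
      moreover have "nz (incl x) = x" by (rule nz_eqI) (simp add: incl_nz incl_nonzero)
      ultimately show ?thesis using False
        by (simp add: rank_one_apply cinner_ket ket.rep_eq blinfun.bilinear_simps adj_partial_translation
            nonzero_partial_translation_ket incl_nz incl_nonzero)
    qed
  qed (intro bounded_ops_intros partial_translation_bounded)
  moreover have "id_blinfun - (adj (?s 1) o\<^sub>L ?s 1) \<in> partial_translation_algebra"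
    by (intro cstar_subalgebra_diff[OF cstar_partial_translation_algebra(1)] id_in_partial_translation_algebra
        cstar_subalgebraD(4,6)[OF cstar_partial_translation_algebra(1)] cstar_partial_translation_algebra(2))
  ultimately have u: "rank_one ?u ?u \<in> partial_translation_algebra" by simp
  have sk: "?s (incl k + 1) ?u = ket k" for k
    by (rule partial_translation_ket_incl) (simp add: incl_nz)
  have "(?s (incl i + 1) o\<^sub>L rank_one ?u ?u) o\<^sub>L adj (?s (incl j + 1)) = rank_one (ket i) (ket j)"
    by (simp add: compose_rank_one partial_translation_bounded sk)
  then show "rank_one (ket i) (ket j) \<in> partial_translation_algebra"
    using u by (metis cstar_subalgebraD(4,6) cstar_partial_translation_algebra)
qed

lemma partial_translation_in_calc_algebra:
  "partial_translation (int n) \<in> X.calc_algebra compact_ops"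
proof (induction n)
  case 0
  then show ?case using X.id_in_calc_algebra(1) by (simp add: partial_translation_0)
next
  case (Suc n)
  have 1: "partial_translation 1 \<in> X.calc_algebra compact_ops"
    by (rule X.calc_algebraI[OF circle_id_continuous]) (simp add: X.calc_id gap_shift_op_diff_compact)
  have "(partial_translation (int n + 1) - (partial_translation 1 o\<^sub>L partial_translation (int n))) +
      (partial_translation 1 o\<^sub>L partial_translation (int n)) \<in> X.calc_algebra compact_ops"
    by (intro X.calc_algebra_add(1) X.calc_algebra_compose(1) 1 Suc
        subsetD[OF X.ideal_subset_calc_algebra] nonzero_partial_translation_Suc)
  then show ?case by (simp add: add.commute)
qed

lemma partial_translation_algebra_nonzero: "partial_translation_algebra = X.calc_algebra compact_ops"
proof (rule antisym)
  show "partial_translation_algebra \<subseteq> X.calc_algebra compact_ops"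
    by (rule partial_translation_algebra_subset[OF X.cstar_calc_algebra partial_translation_in_calc_algebra])
  show "X.calc_algebra compact_ops \<subseteq> partial_translation_algebra"
  proof (rule X.calc_algebra_subset[OF cstar_partial_translation_algebra(1) _ id_in_partial_translation_algebra
        compact_in_nonzero_algebra])
    have "partial_translation 1 - (partial_translation 1 - gap_shift_op) \<in> partial_translation_algebra"
      by (intro cstar_subalgebra_diff cstar_partial_translation_algebra subsetD[OF compact_in_nonzero_algebra]
          gap_shift_op_diff_compact)
    then show "gap_shift_op \<in> partial_translation_algebra" by simp
  qed
qed


section \<open>The quotient map onto the translation algebra of the integers\<close>

definition nonzero_symbol :: "(nonzero_int ell2 \<Rightarrow>\<^sub>L nonzero_int ell2) \<Rightarrow> complex \<Rightarrow> complex" where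
  "nonzero_symbol = X.symbol compact_ops"

text \<open>On continuous functions \<open>Z.calc\<close> inverts \<open>translation_symbol\<close>,
  so this is the symbol read back as an operator on the integers.\<close>

definition nonzero_quotient :: "(nonzero_int ell2 \<Rightarrow>\<^sub>L nonzero_int ell2) \<Rightarrow> (int ell2 \<Rightarrow>\<^sub>L int ell2)" where
  "nonzero_quotient A = Z.calc (nonzero_symbol A)"

definition translation_symbol :: "(int ell2 \<Rightarrow>\<^sub>L int ell2) \<Rightarrow> complex \<Rightarrow> complex" where
  "translation_symbol = Z.symbol {0}"

lemma star_iso_translation_symbol:
  "star_iso (op_algebra partial_translation_algebra) circle_algebra translation_symbol"
proof -
  have "inj_on (Z.symbol {0}) (Z.calc_algebra {0})"
    by (rule inj_onI) (metis Z.calc_algebraE(2) singletonD eq_iff_diff_eq_0)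
  then have "bij_betw (Z.symbol {0}) (Z.calc_algebra {0}) circle_continuous"
    by (simp add: bij_betw_def Z.symbol_surj)
  then show ?thesis
    unfolding star_iso_def translation_symbol_def partial_translation_algebra_int
    using Z.symbol_hom by (simp add: op_algebra_def circle_algebra_def)
qed

lemma unital_star_hom_compose:
  "unital_star_hom A B \<phi> \<Longrightarrow> unital_star_hom B C \<psi> \<Longrightarrow> unital_star_hom A C (\<psi> \<circ> \<phi>)"
  by (auto simp: unital_star_hom_def)

lemma nonzero_quotient_hom:
  "unital_star_hom (op_algebra partial_translation_algebra) (op_algebra partial_translation_algebra) nonzero_quotient"
proof -
  have "nonzero_quotient = Z.calc \<circ> X.symbol compact_ops"
    by (simp add: fun_eq_iff nonzero_quotient_def nonzero_symbol_def)
  then show ?thesis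
    unfolding partial_translation_algebra_int partial_translation_algebra_nonzero
    using unital_star_hom_compose[OF X.symbol_hom Z.calc_hom[OF translation_unitary(2)]] by simp
qed

lemma extension_nonzero_quotient:
  "extension_by_compacts partial_translation_algebra (op_algebra partial_translation_algebra) nonzero_quotient"
proof -
  have "nonzero_quotient ` partial_translation_algebra = partial_translation_algebra"
  proof -
    have "nonzero_quotient ` partial_translation_algebra = Z.calc ` (X.symbol compact_ops ` X.calc_algebra compact_ops)"
      by (simp add: image_image nonzero_quotient_def nonzero_symbol_def partial_translation_algebra_nonzero)
    also have "\<dots> = Z.calc_algebra {0}"
      unfolding X.symbol_surj by (auto simp: Z.calc_algebra_def)
    finally show ?thesis by (simp add: partial_translation_algebra_int)
  qed
  moreover have "{T \<in> partial_translation_algebra. nonzero_quotient T = 0} = compact_ops"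
  proof -
    have "Z.calc f = 0 \<longleftrightarrow> f = (\<lambda>z. 0)" if "f \<in> circle_continuous" for f
      using Z.symbol_calc[OF that] Z.symbol_ideal[of 0] Z.calc_zero by auto
    then have "{T \<in> partial_translation_algebra. nonzero_quotient T = 0} =
        {T \<in> X.calc_algebra compact_ops. X.symbol compact_ops T = (\<lambda>z. 0)}"
      unfolding partial_translation_algebra_nonzero nonzero_quotient_def nonzero_symbol_def
      using X.calc_algebraE(1) by blast
    then show ?thesis by (simp only: X.symbol_kernel)
  qed
  ultimately show ?thesis
    unfolding extension_by_compacts_def
    using cstar_partial_translation_algebra(1) id_in_partial_translation_algebra compact_in_nonzero_algebra
      nonzero_quotient_hom by (simp add: op_algebra_def)
qed

lemma nonzero_quotient_simps:
  assumes "A \<in> partial_translation_algebra" "B \<in> partial_translation_algebra"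
  shows "nonzero_quotient (A + B) = nonzero_quotient A + nonzero_quotient B"
    "nonzero_quotient (A o\<^sub>L B) = nonzero_quotient A o\<^sub>L nonzero_quotient B"
    "nonzero_quotient (adj A) = adj (nonzero_quotient A)"
    "nonzero_quotient id_blinfun = id_blinfun"
  using nonzero_quotient_hom assms unfolding unital_star_hom_def by (simp_all add: op_algebra_def)

lemma nonzero_quotient_compact: "K \<in> compact_ops \<Longrightarrow> nonzero_quotient K = 0"
  using extension_nonzero_quotient unfolding extension_by_compacts_def by (auto simp: op_algebra_def)

text \<open>Translations of the integers compose exactly and those of the nonzero integers up to a
  compact operator, which the quotient map kills. This reduces n >= 0 to the translation by 1;
  adjoints give the negative ones.\<close>

lemma nonzero_quotient_translation: "nonzero_quotient (partial_translation n) = partial_translation n"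
proof -
  note mem = cstar_partial_translation_algebra(2)
  have eq_mod: "nonzero_quotient A = nonzero_quotient B"
    if "A - B \<in> compact_ops" "B \<in> partial_translation_algebra" for A B
    using nonzero_quotient_simps(1)[OF subsetD[OF compact_in_nonzero_algebra that(1)] that(2)]
      nonzero_quotient_compact[OF that(1)] by simp
  have "nonzero_symbol (partial_translation 1) = circle_id"
    unfolding nonzero_symbol_def
    by (rule X.symbol_eqI[OF circle_id_continuous]) (simp add: X.calc_id gap_shift_op_diff_compact)
  then have 1: "nonzero_quotient (partial_translation 1) = partial_translation 1"
    by (simp add: nonzero_quotient_def Z.calc_id)
  have nat: "nonzero_quotient (partial_translation (int n)) = partial_translation (int n)" for n
  proof (induction n)
    case 0
    then show ?case using nonzero_quotient_simps(4)[OF mem mem] by (simp add: partial_translation_0)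
  next
    case (Suc n)
    have "nonzero_quotient (partial_translation (int n + 1)) =
        nonzero_quotient (partial_translation 1 o\<^sub>L partial_translation (int n))"
      by (intro eq_mod nonzero_partial_translation_Suc cstar_subalgebraD(4)[OF cstar_partial_translation_algebra(1)] mem)
    also have "\<dots> = partial_translation 1 o\<^sub>L partial_translation (int n)"
      by (simp add: nonzero_quotient_simps(2)[OF mem mem] 1 Suc)
    also have "\<dots> = partial_translation (int n + 1)" unfolding translation_add[symmetric] by (simp add: add.commute)
    finally show ?case by (simp add: add.commute)
  qed
  show ?thesis
  proof (cases "0 \<le> n")
    case True
    then show ?thesis using nat[of "nat n"] by simp
  next
    case False
    then show ?thesis
      using nonzero_quotient_simps(3)[OF mem mem, of "int (nat (- n))"] nat[of "nat (- n)"]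
      by (simp add: adj_partial_translation)
  qed
qed

lemma translation_symbol_quotient:
  "A \<in> partial_translation_algebra \<Longrightarrow> (translation_symbol \<circ> nonzero_quotient) A = nonzero_symbol A"
  unfolding partial_translation_algebra_nonzero
  by (simp add: translation_symbol_def nonzero_quotient_def nonzero_symbol_def X.calc_algebraE(1))

lemma busby_nonzero:
  assumes "f \<in> circle_continuous"
  shows "busby partial_translation_algebra (translation_symbol \<circ> nonzero_quotient) f =
    {A. A - X.calc f \<in> compact_ops}"
proof -
  have "busby partial_translation_algebra (translation_symbol \<circ> nonzero_quotient) f =
      busby partial_translation_algebra nonzero_symbol f"
    unfolding busby_def using translation_symbol_quotient by auto
  then show ?thesis
    using X.busby_calc_algebra[OF assms] by (simp add: partial_translation_algebra_nonzero nonzero_symbol_def)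
qed

section \<open>The Toeplitz extension\<close>

abbreviation (input) unilateral_shift :: "hardy \<Rightarrow>\<^sub>L hardy" where
  "unilateral_shift \<equiv> toeplitz_op circle_id"

definition hardy_monomial :: "nat \<Rightarrow> hardy" where
  "hardy_monomial n = Abs_hardy (circle_monomial n)"

lemma Rep_hardy_monomial: "Rep_hardy (hardy_monomial n) = circle_monomial n"
proof -
  have "circle_monomial n \<in> hardy_subspace"
    unfolding hardy_subspace_def by (intro subsetD[OF closure_subset] complex_vector.span_base) simp
  then show ?thesis by (simp add: hardy_monomial_def Abs_hardy_inverse)
qed

lemma orthonormal_hardy_monomial: "orthonormal_family hardy_monomial"
proof -
  have "cinner (circle_monomial m) (circle_monomial n) = (if m = n then 1 else 0)" for m n
    by transfer (rule integral_circle_monomial)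
  then show ?thesis by (simp add: orthonormal_family_def cinner_hardy.rep_eq Rep_hardy_monomial)
qed

lemma total_hardy_monomial: "total_family hardy_monomial"
  unfolding total_family_def closure_approachable
proof (intro allI impI)
  fix x :: hardy and e :: real assume "e > 0"
  have span: "\<exists>y\<in>complex_vector.span (range hardy_monomial). Rep_hardy y = s"
    if "s \<in> complex_vector.span (range circle_monomial)" for s
    using that
  proof (induction rule: complex_vector.span_induct_alt)
    case base
    show ?case by (intro bexI[of _ 0]) (simp_all add: zero_hardy.rep_eq complex_vector.span_zero)
  next
    case (step c s t)
    then obtain n y where "s = circle_monomial n" "y \<in> complex_vector.span (range hardy_monomial)" "Rep_hardy y = t"
      by blast
    moreover have "c *\<^sub>C hardy_monomial n \<in> complex_vector.span (range hardy_monomial)"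
      by (intro complex_vector.span_scale complex_vector.span_base) simp
    ultimately show ?case
      by (intro bexI[of _ "c *\<^sub>C hardy_monomial n + y"] complex_vector.span_add)
        (simp_all add: plus_hardy.rep_eq scaleC_hardy.rep_eq Rep_hardy_monomial)
  qed
  have "Rep_hardy x \<in> closure (complex_vector.span (range circle_monomial))"
    using Rep_hardy[of x] by (simp add: hardy_subspace_def)
  then obtain s where "s \<in> complex_vector.span (range circle_monomial)" "dist s (Rep_hardy x) < e"
    unfolding closure_approachable using \<open>e > 0\<close> by blast
  then show "\<exists>y\<in>complex_vector.span (range hardy_monomial). dist y x < e"
    using span by (metis dist_hardy.rep_eq)
qed

lemma unilateral_shift_monomial: "unilateral_shift (hardy_monomial n) = hardy_monomial (Suc n)"
  by (simp add: Rep_hardy_inject[symmetric] toeplitz_op_circle_id Rep_hardy_monomial circle_mult_id(4))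

lemma unilateral_shift_isometry: "adj unilateral_shift o\<^sub>L unilateral_shift = id_blinfun"
  by (rule isometry_imp_adj_compose[OF toeplitz_op_circle_id_bounded])
    (simp add: cinner_hardy.rep_eq toeplitz_op_circle_id circle_mult_id(3))

lemma orthogonal_total_family:
  assumes b: "orthonormal_family b" "total_family b" and "\<And>i. cinner (b i) y = 0"
  shows "y = 0"
proof (rule ccontr)
  assume "y \<noteq> 0"
  then obtain F where "finite F" "\<And>G. F \<subseteq> G \<Longrightarrow> finite G \<Longrightarrow> norm (y - finite_proj b G y) < norm y"
    using finite_proj_approx[OF b, of "norm y" y] by auto
  moreover have "finite_proj b F y = 0" by (simp add: finite_proj_def assms(3))
  ultimately show False by fastforce
qed

lemma adj_unilateral_shift_monomial:
  "adj unilateral_shift (hardy_monomial (Suc n)) = hardy_monomial n"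
  "adj unilateral_shift (hardy_monomial 0) = 0"
proof -
  show "adj unilateral_shift (hardy_monomial (Suc n)) = hardy_monomial n"
    using arg_cong[OF unilateral_shift_isometry, of "\<lambda>A. blinfun_apply A (hardy_monomial n)"]
    by (simp add: unilateral_shift_monomial)
  show "adj unilateral_shift (hardy_monomial 0) = 0"
    by (rule orthogonal_total_family[OF orthonormal_hardy_monomial total_hardy_monomial])
      (use orthonormal_hardy_monomial in \<open>simp add: cinner_adj'[OF toeplitz_op_circle_id_bounded]
        unilateral_shift_monomial orthonormal_family_def\<close>)
qed

lemma unilateral_shift_defect:
  "id_blinfun - (unilateral_shift o\<^sub>L adj unilateral_shift) = rank_one (hardy_monomial 0) (hardy_monomial 0)"
proof (rule blinfun_eqI_total[OF _ rank_one_bounded total_hardy_monomial])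
  show "id_blinfun - (unilateral_shift o\<^sub>L adj unilateral_shift) \<in> bounded_ops"
    by (intro bounded_ops_intros toeplitz_op_circle_id_bounded)
  show "(id_blinfun - (unilateral_shift o\<^sub>L adj unilateral_shift)) (hardy_monomial n) =
      rank_one (hardy_monomial 0) (hardy_monomial 0) (hardy_monomial n)" for n
    using orthonormal_hardy_monomial
    by (cases n) (simp_all add: rank_one_apply blinfun.bilinear_simps adj_unilateral_shift_monomial
        unilateral_shift_monomial orthonormal_family_def scaleC_one)
qed

lemma unilateral_shift_iterate: "(blinfun_apply unilateral_shift ^^ n) (hardy_monomial 0) = hardy_monomial n"
  by (induction n) (simp_all add: unilateral_shift_monomial)

interpretation S: toeplitz_system unilateral_shift "hardy_monomial 0" compact_ops
proof unfold_locales
  have 1: "cinner (hardy_monomial 0) (hardy_monomial n) = (if n = 0 then 1 else 0)" for n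
    using orthonormal_hardy_monomial by (simp add: orthonormal_family_def)
  then have "(norm (hardy_monomial 0))\<^sup>2 = 1"
    using cinner_self[of "hardy_monomial 0"] of_real_eq_1_iff by metis
  then show "norm (hardy_monomial 0) = 1" using norm_ge_zero[of "hardy_monomial 0"] by (auto simp: power2_eq_1_iff)
  show "cinner (hardy_monomial 0) ((blinfun_apply unilateral_shift ^^ Suc n) (hardy_monomial 0)) = 0" for n
    unfolding unilateral_shift_iterate by (simp add: 1)
qed (simp_all add: toeplitz_op_circle_id_bounded unilateral_shift_isometry closed_ideal_compact_ops
    unilateral_shift_defect rank_one_compact)

lemma cstar_toeplitz_algebra: "cstar_subalgebra toeplitz_algebra" "unilateral_shift \<in> toeplitz_algebra"
  using cstar_generated(1,2)[of "{unilateral_shift}"] toeplitz_op_circle_id_bounded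
  unfolding toeplitz_algebra_def by auto

text \<open>The single generator S already yields the unit as \<open>adj S o\<^sub>L S\<close>, the
  projection onto the constants as its defect, and, by powers of S on both sides, all matrix units
  and hence the compact operators.\<close>

lemma toeplitz_algebra_eq: "toeplitz_algebra = S.calc_algebra compact_ops"
proof (rule antisym)
  show "toeplitz_algebra \<subseteq> S.calc_algebra compact_ops"
    unfolding toeplitz_algebra_def
    by (intro cstar_generated(3) S.cstar_calc_algebra)
      (simp_all add: toeplitz_op_circle_id_bounded S.T_in_calc_algebra(1))
  note A = cstar_subalgebraD[OF cstar_toeplitz_algebra(1)]
  have id: "id_blinfun \<in> toeplitz_algebra"
    unfolding unilateral_shift_isometry[symmetric] by (intro A(4,6) cstar_toeplitz_algebra(2))
  have pow: "op_poly unilateral_shift (monom 1 n) \<in> toeplitz_algebra" for n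
    by (induction n) (auto simp: op_poly_monom_Suc intro: A id cstar_toeplitz_algebra(2))
  have "id_blinfun - (unilateral_shift o\<^sub>L adj unilateral_shift) \<in> toeplitz_algebra"
    by (intro cstar_subalgebra_diff[OF cstar_toeplitz_algebra(1)] id A(4,6) cstar_toeplitz_algebra(2))
  then have u: "rank_one (hardy_monomial 0) (hardy_monomial 0) \<in> toeplitz_algebra"
    by (simp add: unilateral_shift_defect)
  have "compact_ops \<subseteq> toeplitz_algebra"
  proof (rule compact_ops_subset_if_rank_one[OF cstar_toeplitz_algebra(1) orthonormal_hardy_monomial total_hardy_monomial])
    fix i j
    let ?p = "\<lambda>n. op_poly unilateral_shift (monom 1 n)"
    have "(?p i o\<^sub>L rank_one (hardy_monomial 0) (hardy_monomial 0)) o\<^sub>L adj (?p j) =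
        rank_one (hardy_monomial i) (hardy_monomial j)"
      by (simp add: compose_rank_one op_poly_bounded_ops toeplitz_op_circle_id_bounded op_poly_monom_apply
          unilateral_shift_iterate)
    moreover have "(?p i o\<^sub>L rank_one (hardy_monomial 0) (hardy_monomial 0)) o\<^sub>L adj (?p j) \<in> toeplitz_algebra"
      by (intro A(4,6) u pow)
    ultimately show "rank_one (hardy_monomial i) (hardy_monomial j) \<in> toeplitz_algebra" by simp
  qed
  then show "S.calc_algebra compact_ops \<subseteq> toeplitz_algebra"
    by (rule S.calc_algebra_subset[OF cstar_toeplitz_algebra id])
qed

lemma toeplitz_extension_symbol: "toeplitz_extension (S.symbol compact_ops)"
  using S.extension_calc_algebra S.T_in_calc_algebra(2) by (simp add: toeplitz_extension_def toeplitz_algebra_eq)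

section \<open>Equivalence of extensions\<close>

text \<open>Unlike \<open>direct_sum_op\<close>, this allows different source and target spaces, as
  needed for the sum of a unitary between two Hilbert spaces and an identity.\<close>

definition prod_op ::
  "('a::real_normed_vector \<Rightarrow>\<^sub>L 'c::real_normed_vector) \<Rightarrow> ('b::real_normed_vector \<Rightarrow>\<^sub>L 'd::real_normed_vector)
    \<Rightarrow> (('a \<times> 'b) \<Rightarrow>\<^sub>L ('c \<times> 'd))" where
  "prod_op S T = Blinfun (\<lambda>p. (S (fst p), T (snd p)))"

lemma prod_op_apply: "prod_op S T p = (S (fst p), T (snd p))"
proof -
  have "bounded_linear (\<lambda>p. (blinfun_apply S (fst p), blinfun_apply T (snd p)))"
    by (intro bounded_linear_intros)
  then show ?thesis by (simp add: prod_op_def bounded_linear_Blinfun_apply)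
qed

lemma direct_sum_op_prod_op: "direct_sum_op S T = prod_op S T"
  by (simp add: direct_sum_op_def prod_op_def)

lemma prod_op_bounded: "S \<in> bounded_ops \<Longrightarrow> T \<in> bounded_ops \<Longrightarrow> prod_op S T \<in> bounded_ops"
  by (simp add: bounded_ops_def prod_op_apply scaleC_prod_def)

lemma prod_op_compose: "prod_op S T o\<^sub>L prod_op S' T' = prod_op (S o\<^sub>L S') (T o\<^sub>L T')"
  by (rule blinfun_eqI) (simp add: prod_op_apply)

lemma prod_op_diff: "prod_op S T - prod_op S' T' = prod_op (S - S') (T - T')"
  by (rule blinfun_eqI) (simp add: prod_op_apply blinfun.bilinear_simps)

lemma prod_op_id: "prod_op id_blinfun id_blinfun = id_blinfun"
  by (rule blinfun_eqI) (simp add: prod_op_apply)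

lemma adj_prod_op: "S \<in> bounded_ops \<Longrightarrow> T \<in> bounded_ops \<Longrightarrow> adj (prod_op S T) = prod_op (adj S) (adj T)"
  by (rule adj_eqI) (simp_all add: prod_op_bounded adj_bounded_ops prod_op_apply cinner_prod_def cinner_adj)

lemma unitary_op_id: "unitary_op id_blinfun"
  by (simp add: unitary_op_def blinfun_compose_simps)

lemma unitary_prod_op: "unitary_op S \<Longrightarrow> unitary_op T \<Longrightarrow> unitary_op (prod_op S T)"
  by (simp add: unitary_op_def adj_prod_op prod_op_bounded prod_op_compose prod_op_id)

lemma prod_op_compact:
  fixes K :: "'a::chilbert_space \<Rightarrow>\<^sub>L 'b::chilbert_space" and L :: "'c::chilbert_space \<Rightarrow>\<^sub>L 'd::chilbert_space"
  assumes "K \<in> compact_ops" "L \<in> compact_ops" shows "prod_op K L \<in> compact_ops"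
proof (rule compact_opsI)
  fix x :: "nat \<Rightarrow> 'a \<times> 'c" assume x: "\<And>n. norm (x n) \<le> 1"
  have fst: "norm (fst (x n)) \<le> 1" and snd: "norm (snd (x n)) \<le> 1" for n
    using norm_fst_le[of "fst (x n)" "snd (x n)"] norm_snd_le[of "snd (x n)" "fst (x n)"] x[of n] by auto
  obtain r a where r: "strict_mono r" "(\<lambda>n. K (fst (x (r n)))) \<longlonglongrightarrow> a"
    using compact_ops_subseq[where x = "\<lambda>n. fst (x n)", OF assms(1) fst] by blast
  obtain s b where s: "strict_mono s" "(\<lambda>n. L (snd (x (r (s n))))) \<longlonglongrightarrow> b"
    using compact_ops_subseq[where x = "\<lambda>n. snd (x (r n))", OF assms(2) snd] by blast
  have "(\<lambda>n. K (fst (x (r (s n))))) \<longlonglongrightarrow> a"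
    using LIMSEQ_subseq_LIMSEQ[OF r(2) s(1)] by (simp add: o_def)
  from tendsto_Pair[OF this s(2)] show "\<exists>r l. strict_mono r \<and> (\<lambda>n. prod_op K L (x (r n))) \<longlonglongrightarrow> l"
    using strict_mono_o[OF r(1) s(1)] by (auto simp: o_def prod_op_apply)
qed (use assms in \<open>auto intro: prod_op_bounded compact_ops_bounded\<close>)


text \<open>The equivalence is implemented by the direct sum of \<open>V\<close> and the identity;
  conjugation by it, in either direction, keeps the compact summand compact.\<close>

lemma unitarily_equivalent_busby_sum:
  fixes \<delta> :: "(complex \<Rightarrow> complex) \<Rightarrow> ('d::chilbert_space \<Rightarrow>\<^sub>L 'd) set"
    and V :: "'h::chilbert_space \<Rightarrow>\<^sub>L 'k::chilbert_space"
  assumes V: "unitary_op V"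
    and \<rho>: "\<And>f. f \<in> circle_continuous \<Longrightarrow> \<rho> f = (\<lambda>T. V o\<^sub>L T o\<^sub>L adj V) ` \<tau> f"
  shows "unitarily_equivalent (busby_sum \<tau> \<delta>) (busby_sum \<rho> \<delta>)"
  unfolding unitarily_equivalent_def
proof (intro exI conjI ballI)
  let ?W = "prod_op V (id_blinfun :: 'd \<Rightarrow>\<^sub>L 'd)"
  show W: "unitary_op ?W" by (intro unitary_prod_op V unitary_op_id)
  then have Wb: "?W \<in> bounded_ops" "adj ?W \<in> bounded_ops" by (auto simp: unitary_op_def adj_bounded_ops)
  have Vb: "V \<in> bounded_ops" using V by (simp add: unitary_op_def)
  have conj: "(?W o\<^sub>L (direct_sum_op S T + K)) o\<^sub>L adj ?W =
      direct_sum_op ((V o\<^sub>L S) o\<^sub>L adj V) T + ((?W o\<^sub>L K) o\<^sub>L adj ?W)" for S T K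
    by (simp add: direct_sum_op_prod_op blinfun_compose_simps adj_prod_op Vb prod_op_compose)
  fix f assume f: "f \<in> circle_continuous"
  show "busby_sum \<rho> \<delta> f = (\<lambda>T. ?W o\<^sub>L T o\<^sub>L adj ?W) ` busby_sum \<tau> \<delta> f"
  proof (intro antisym subsetI)
    fix A assume "A \<in> busby_sum \<rho> \<delta> f"
    then obtain S T K where A: "A = direct_sum_op ((V o\<^sub>L S) o\<^sub>L adj V) T + K" "S \<in> \<tau> f" "T \<in> \<delta> f" "K \<in> compact_ops"
      unfolding busby_sum_def \<rho>[OF f] by blast
    let ?K = "(adj ?W o\<^sub>L K) o\<^sub>L ?W"
    have "(?W o\<^sub>L ?K) o\<^sub>L adj ?W = ((?W o\<^sub>L adj ?W) o\<^sub>L K) o\<^sub>L (?W o\<^sub>L adj ?W)"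
      by (simp only: blinfun_compose_assoc)
    also have "\<dots> = K" using W by (simp add: unitary_op_def blinfun_compose_simps)
    finally have "A = (?W o\<^sub>L (direct_sum_op S T + ?K)) o\<^sub>L adj ?W" unfolding conj A by simp
    moreover have "?K \<in> compact_ops" by (intro compact_ops_compose_left compact_ops_compose_right A Wb)
    ultimately show "A \<in> (\<lambda>T. ?W o\<^sub>L T o\<^sub>L adj ?W) ` busby_sum \<tau> \<delta> f"
      unfolding busby_sum_def using A by blast
  next
    fix A assume "A \<in> (\<lambda>T. ?W o\<^sub>L T o\<^sub>L adj ?W) ` busby_sum \<tau> \<delta> f"
    then obtain S T K where A: "A = (?W o\<^sub>L (direct_sum_op S T + K)) o\<^sub>L adj ?W" "S \<in> \<tau> f" "T \<in> \<delta> f" "K \<in> compact_ops"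
      unfolding busby_sum_def by blast
    have "(?W o\<^sub>L K) o\<^sub>L adj ?W \<in> compact_ops" by (intro compact_ops_compose_left compact_ops_compose_right A Wb)
    then show "A \<in> busby_sum \<rho> \<delta> f" unfolding A conj busby_sum_def \<rho>[OF f] using A by blast
  qed
qed

text \<open>Intertwining passes from \<open>T\<close> and \<open>adj T\<close> to polynomials, to
  trigonometric polynomials and to limits, with the same approximating functions on both
  sides.\<close>

lemma calc_intertwine:
  fixes V :: "'h::chilbert_space \<Rightarrow>\<^sub>L 'k::chilbert_space"
  assumes T: "hilbert_isometry T" and T': "hilbert_isometry T'" and V: "V \<in> bounded_ops"
    and comm: "V o\<^sub>L T = T' o\<^sub>L V" "V o\<^sub>L adj T = adj T' o\<^sub>L V" and f: "f \<in> circle_continuous"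
  shows "V o\<^sub>L hilbert_isometry.calc T f = hilbert_isometry.calc T' f o\<^sub>L V"
proof -
  interpret A: hilbert_isometry T by fact
  interpret B: hilbert_isometry T' by fact
  have poly: "V o\<^sub>L op_poly R p = op_poly R' p o\<^sub>L V" if "V o\<^sub>L R = R' o\<^sub>L V" for R R' p
  proof (induction p)
    case (pCons a p)
    have "V o\<^sub>L (R o\<^sub>L op_poly R p) = R' o\<^sub>L (op_poly R' p o\<^sub>L V)"
      by (metis that pCons.IH blinfun_compose_assoc)
    then show ?case by (simp add: blinfun_compose_simps scaleC_op_compose V blinfun_compose_assoc)
  qed simp
  have trig: "V o\<^sub>L A.trig_op m p = B.trig_op m p o\<^sub>L V" for m p
    unfolding A.trig_op_def B.trig_op_def using poly[OF comm(1)] poly[OF comm(2)] by (metis blinfun_compose_assoc)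
  have ex: "\<exists>C. B.is_trig g C \<and> V o\<^sub>L A = C o\<^sub>L V" if "A.is_trig g A" for g A
    using that trig unfolding A.is_trig_def B.is_trig_def by metis
  obtain u X where u: "\<And>n. A.is_trig (u n) (X n)"
    "\<And>n z. cmod z = 1 \<Longrightarrow> cmod (f z - u n z) \<le> 1 / real (Suc n)" "X \<longlonglongrightarrow> A.calc f"
    using A.calc_sequence[OF f] by blast
  obtain Y where Y: "\<And>n. B.is_trig (u n) (Y n)" "\<And>n. V o\<^sub>L X n = Y n o\<^sub>L V" using ex[OF u(1)] by metis
  have "(\<lambda>n. V o\<^sub>L X n) \<longlonglongrightarrow> (V o\<^sub>L A.calc f)" by (intro tendsto_blinfun_compose tendsto_const u(3))
  moreover have "(\<lambda>n. Y n o\<^sub>L V) \<longlonglongrightarrow> (B.calc f o\<^sub>L V)"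
    by (intro tendsto_blinfun_compose tendsto_const B.calc_limit[OF f Y(1) u(2) tendsto_divide_Suc])
  ultimately show ?thesis unfolding Y(2) by (rule LIMSEQ_unique)
qed

lemma funpow_conjugate:
  assumes "bij \<beta>" shows "(\<beta> \<circ> \<pi> \<circ> inv \<beta>) ^^ n = \<beta> \<circ> (\<pi> ^^ n) \<circ> inv \<beta>"
proof (induction n)
  case (Suc n)
  then show ?case using assms by (simp add: fun_eq_iff bij_is_inj)
qed (use assms in \<open>simp add: fun_eq_iff surj_f_inv_f bij_is_surj\<close>)

text \<open>\<open>zero_ext_class\<close> asks for a split extension on \<open>nat ell2\<close>. An
  enumeration of the nonzero integers carries the gap shift there, and the permutation operator of
  the enumeration identifies the two Busby invariants. The copy serves both as the extension
  compared with and as the split summand on either side.\<close>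

lemma zero_ext_class_nonzero:
  "zero_ext_class partial_translation_algebra (translation_symbol \<circ> nonzero_quotient)"
proof -
  have "infinite (range (incl :: nonzero_int \<Rightarrow> int))"
    unfolding range_incl_nonzero using infinite_UNIV_int by (simp add: Compl_eq_Diff_UNIV)
  then have "infinite (UNIV :: nonzero_int set)" by blast
  moreover have "countable (UNIV :: nonzero_int set)" using countable_image_inj_on[OF _ inj_incl] by blast
  ultimately obtain \<beta> :: "nonzero_int \<Rightarrow> nat" where \<beta>: "bij \<beta>" using countableE_infinite by blast
  define \<pi> where "\<pi> = \<beta> \<circ> gap_shift \<circ> inv \<beta>"
  have \<pi>: "bij \<pi>" unfolding \<pi>_def by (intro bij_comp bij_gap_shift \<beta> bij_imp_bij_inv)
  have free: "(\<pi> ^^ Suc n) (\<beta> (nz 1)) \<noteq> \<beta> (nz 1)" for n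
    using gap_shift_free[of n] \<beta> unfolding \<pi>_def funpow_conjugate[OF \<beta>]
    by (simp add: bij_is_inj inj_eq del: funpow.simps)
  interpret N: toeplitz_system "permutation_op \<pi>" "ket (\<beta> (nz 1))" compact_ops
    by (rule toeplitz_system_permutation[OF \<pi> free closed_ideal_compact_ops])
  let ?V = "permutation_op \<beta>"
  have V: "unitary_op ?V" by (rule unitary_permutation_op[OF \<beta>])
  then have Vb: "?V \<in> bounded_ops" "adj ?V \<in> bounded_ops" and VV: "adj ?V o\<^sub>L ?V = id_blinfun" "?V o\<^sub>L adj ?V = id_blinfun"
    by (auto simp: unitary_op_def adj_bounded_ops)
  have uN: "unitary_op (permutation_op \<pi>)" and uX: "unitary_op gap_shift_op"
    by (rule unitary_permutation_op \<pi> bij_gap_shift)+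
  have comm: "?V o\<^sub>L gap_shift_op = permutation_op \<pi> o\<^sub>L ?V"
    by (rule blinfun_eqI_total[OF _ _ total_ket])
      (use \<beta> \<pi> in \<open>simp_all add: bounded_ops_compose permutation_op_bounded bij_gap_shift permutation_op_ket \<pi>_def bij_is_inj\<close>)
  have comm': "?V o\<^sub>L adj gap_shift_op = adj (permutation_op \<pi>) o\<^sub>L ?V"
  proof -
    have "?V o\<^sub>L adj gap_shift_op = (adj (permutation_op \<pi>) o\<^sub>L (permutation_op \<pi> o\<^sub>L ?V)) o\<^sub>L adj gap_shift_op"
      using uN by (simp add: unitary_op_def blinfun_compose_simps flip: blinfun_compose_assoc)
    also have "\<dots> = (adj (permutation_op \<pi>) o\<^sub>L ?V) o\<^sub>L (gap_shift_op o\<^sub>L adj gap_shift_op)"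
      unfolding comm[symmetric] by (simp only: blinfun_compose_assoc)
    finally show ?thesis using uX by (simp add: unitary_op_def blinfun_compose_simps)
  qed
  let ?D = "N.calc_algebra compact_ops" and ?d = "N.symbol compact_ops"
  have D: "split_extension ?D ?d"
    by (rule N.split_extension_calc_algebra) (use uN in \<open>simp_all add: unitary_op_def\<close>)
  have "unitarily_equivalent
      (busby_sum (busby partial_translation_algebra (translation_symbol \<circ> nonzero_quotient)) (busby ?D ?d))
      (busby_sum (busby ?D ?d) (busby ?D ?d))"
  proof (rule unitarily_equivalent_busby_sum[OF V])
    fix f assume f: "f \<in> circle_continuous"
    have "?V o\<^sub>L X.calc f = N.calc f o\<^sub>L ?V"
      by (rule calc_intertwine[OF X.hilbert_isometry_axioms N.hilbert_isometry_axioms Vb(1) comm comm' f])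
    then have calc: "(?V o\<^sub>L X.calc f) o\<^sub>L adj ?V = N.calc f"
      by (simp add: blinfun_compose_assoc VV blinfun_compose_simps)
    have "(\<lambda>T. ?V o\<^sub>L T o\<^sub>L adj ?V) ` {A. A - X.calc f \<in> compact_ops} = {A. A - N.calc f \<in> compact_ops}"
    proof (intro antisym subsetI)
      fix B assume "B \<in> (\<lambda>T. ?V o\<^sub>L T o\<^sub>L adj ?V) ` {A. A - X.calc f \<in> compact_ops}"
      then obtain A where A: "B = (?V o\<^sub>L A) o\<^sub>L adj ?V" "A - X.calc f \<in> compact_ops" by blast
      have "B - N.calc f = (?V o\<^sub>L (A - X.calc f)) o\<^sub>L adj ?V"
        unfolding A calc[symmetric] by (simp add: blinfun_compose_simps)
      moreover have "\<dots> \<in> compact_ops" by (intro compact_ops_compose_left compact_ops_compose_right A Vb)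
      ultimately show "B \<in> {A. A - N.calc f \<in> compact_ops}" by simp
    next
      fix B assume B: "B \<in> {A. A - N.calc f \<in> compact_ops}"
      let ?A = "(adj ?V o\<^sub>L B) o\<^sub>L ?V"
      have conj: "(?V o\<^sub>L ((adj ?V o\<^sub>L C) o\<^sub>L ?V)) o\<^sub>L adj ?V = C" "(adj ?V o\<^sub>L ((?V o\<^sub>L C') o\<^sub>L adj ?V)) o\<^sub>L ?V = C'" for C C'
      proof -
        have "(?V o\<^sub>L ((adj ?V o\<^sub>L C) o\<^sub>L ?V)) o\<^sub>L adj ?V = ((?V o\<^sub>L adj ?V) o\<^sub>L C) o\<^sub>L (?V o\<^sub>L adj ?V)"
          by (simp only: blinfun_compose_assoc)
        then show "(?V o\<^sub>L ((adj ?V o\<^sub>L C) o\<^sub>L ?V)) o\<^sub>L adj ?V = C" by (simp add: VV blinfun_compose_simps)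
        have "(adj ?V o\<^sub>L ((?V o\<^sub>L C') o\<^sub>L adj ?V)) o\<^sub>L ?V = ((adj ?V o\<^sub>L ?V) o\<^sub>L C') o\<^sub>L (adj ?V o\<^sub>L ?V)"
          by (simp only: blinfun_compose_assoc)
        then show "(adj ?V o\<^sub>L ((?V o\<^sub>L C') o\<^sub>L adj ?V)) o\<^sub>L ?V = C'" by (simp add: VV blinfun_compose_simps)
      qed
      have "(adj ?V o\<^sub>L (B - N.calc f)) o\<^sub>L ?V \<in> compact_ops"
        using B by (intro compact_ops_compose_left compact_ops_compose_right Vb) simp
      moreover have "?A - X.calc f = (adj ?V o\<^sub>L (B - N.calc f)) o\<^sub>L ?V"
        by (simp add: blinfun_compose_simps conj(2) flip: calc)
      ultimately show "B \<in> (\<lambda>T. ?V o\<^sub>L T o\<^sub>L adj ?V) ` {A. A - X.calc f \<in> compact_ops}"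
        by (intro image_eqI[of _ _ ?A]) (simp_all add: conj(1))
    qed
    then show "busby ?D ?d f = (\<lambda>T. ?V o\<^sub>L T o\<^sub>L adj ?V) `
        busby partial_translation_algebra (translation_symbol \<circ> nonzero_quotient) f"
      by (simp only: busby_nonzero[OF f] N.busby_calc_algebra[OF f])
  qed
  then show ?thesis unfolding zero_ext_class_def same_ext_class_def using D by blast
qed

section \<open>The index obstruction\<close>

text \<open>If \<open>B\<close> were a compact perturbation of a unitary \<open>W\<close>, then \<open>W\<^sup>* B\<close> would be a compact perturbation of
  the identity with a wandering vector, so both \<open>-1\<close> and \<open>1\<close> would be its values on the same approximate
  eigenvectors.\<close>

lemma isometry_not_compact_perturbation_of_unitary:
  fixes W :: "'h::chilbert_space \<Rightarrow>\<^sub>L 'h"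
  assumes W: "unitary_op W" and B: "B \<in> bounded_ops" "adj B o\<^sub>L B = id_blinfun"
    and K: "W - B \<in> compact_ops" and w: "\<And>x. cinner w (B x) = 0"
  shows "w = 0"
proof (rule ccontr)
  assume "w \<noteq> 0"
  define V where "V = adj W o\<^sub>L B"
  \<comment> \<open>As \<open>w\<close> is orthogonal to the range of \<open>B\<close>, its image
    under the unitary \<open>adj W\<close> is orthogonal to the range of \<open>V\<close>, in
    particular to its own later orbit.\<close>
  define e where "e = (1 / norm w) *\<^sub>R adj W w"
  have Wb: "W \<in> bounded_ops" "adj W \<in> bounded_ops" and WW: "adj W o\<^sub>L W = id_blinfun" "W o\<^sub>L adj W = id_blinfun"
    using W by (auto simp: unitary_op_def adj_bounded_ops)
  have iso: "cinner (adj W x) (adj W y) = cinner x y" for x y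
    using isometry_cinner[OF Wb(2)] WW(2) Wb(1) by simp
  interpret V: shift_isometry V e
  proof unfold_locales
    show Vb: "V \<in> bounded_ops" unfolding V_def by (intro bounded_ops_compose Wb B)
    show "adj V o\<^sub>L V = id_blinfun"
      by (rule isometry_imp_adj_compose[OF Vb]) (simp add: V_def iso isometry_cinner[OF B])
    show "norm e = 1" using \<open>w \<noteq> 0\<close> norm_eqI_cinner[OF iso, of w] by (simp add: e_def)
    show "cinner e ((blinfun_apply V ^^ Suc n) e) = 0" for n
      by (simp add: e_def V_def iso w cinner_scaleR_left)
  qed
  have "adj W o\<^sub>L (W - B) \<in> compact_ops" by (rule compact_ops_compose_left[OF K Wb(2)])
  then have "V.approx_eigenvalue (-1) (adj W o\<^sub>L (W - B)) 0"
    by (intro V.approx_eigenvalue_compact) auto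
  from V.approx_eigenvalue_add[OF V.approx_eigenvalue_add[OF this V.approx_eigenvalue_T[of "-1"]]
      V.approx_eigenvalue_const[of _ "-1"]]
  have "V.approx_eigenvalue (-1) ((adj W o\<^sub>L (W - B)) + V + scaleC_op (-1) id_blinfun) (0 + (-1) + (-1))" by simp
  \<comment> \<open>The summands have the values 0, -1 and -1 on the test vectors for -1, although
    they add up to the zero operator.\<close>
  moreover have "(adj W o\<^sub>L (W - B)) + V + scaleC_op (-1) id_blinfun = 0"
    by (simp add: V_def blinfun_compose_simps WW)
  ultimately have "cmod (0 + (-1) + (-1)) \<le> norm (0 :: 'h \<Rightarrow>\<^sub>L 'h)"
    using V.approx_eigenvalue_le_norm[of "-1"] by (metis norm_minus_cancel norm_one)
  then show False by simp
qed

lemma extension_diff_compact: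
  assumes "extension_by_compacts E circle_algebra q" "A \<in> E" "B \<in> E" "q A = q B"
  shows "A - B \<in> compact_ops"
proof -
  have E: "cstar_subalgebra E" and hom: "unital_star_hom (op_algebra E) circle_algebra q"
    and ker: "{T \<in> E. q T = (\<lambda>z. 0)} = compact_ops"
    using assms(1) by (simp_all add: extension_by_compacts_def circle_algebra_def)
  have "q (A + scaleC_op (-1) B) = (\<lambda>z. q A z + (-1) * q B z)"
    using hom assms(2,3) cstar_subalgebraD(5)[OF E assms(3), of "-1"]
    by (simp add: unital_star_hom_def op_algebra_def circle_algebra_def del: scaleC_op_simps)
  then have "q (A - B) = (\<lambda>z. 0)" by (simp add: assms(4))
  then show ?thesis using cstar_subalgebra_diff[OF E assms(2,3)] ker by blast
qed

text \<open>A unital splitting preserves the relations z (cnj z) = 1 = (cnj z) z, so it lifts z to a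
  genuine unitary and not just to one modulo compact operators.\<close>

lemma split_extension_unitary:
  assumes "split_extension E q" obtains u where "unitary_op u" "u \<in> busby E q circle_id"
proof -
  obtain \<sigma> where hom: "unital_star_hom circle_algebra (op_algebra E) \<sigma>"
    and q: "\<And>f. f \<in> circle_continuous \<Longrightarrow> q (\<sigma> f) = f"
    using assms unfolding split_extension_def by blast
  have E: "cstar_subalgebra E" using assms by (simp add: split_extension_def extension_by_compacts_def)
  let ?c = "\<lambda>z. cnj (circle_id z)" and ?one = "\<lambda>z :: complex. if z \<in> sphere 0 1 then 1 else 0 :: complex"
  note C = circle_id_continuous circle_continuous_cnj[OF circle_id_continuous]
  have u: "\<sigma> circle_id \<in> E" and star: "\<sigma> ?c = adj (\<sigma> circle_id)" and one: "\<sigma> ?one = id_blinfun"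
    and mult: "\<sigma> (\<lambda>z. circle_id z * ?c z) = \<sigma> circle_id o\<^sub>L \<sigma> ?c" "\<sigma> (\<lambda>z. ?c z * circle_id z) = \<sigma> ?c o\<^sub>L \<sigma> circle_id"
    using hom C unfolding unital_star_hom_def by (simp_all add: circle_algebra_def op_algebra_def)
  have eq: "(\<lambda>z. circle_id z * ?c z) = ?one" "(\<lambda>z. ?c z * circle_id z) = ?one"
    by (auto simp: circle_id_def fun_eq_iff mult.commute[of "cnj _"] simp flip: complex_norm_square)
  show ?thesis
  proof (rule that)
    show "unitary_op (\<sigma> circle_id)"
      using mult cstar_subalgebraD(1)[OF E u] unfolding eq star one by (simp add: unitary_op_def)
    show "\<sigma> circle_id \<in> busby E q circle_id" using u q[OF C(1)] by (simp add: busby_def)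
  qed
qed

text \<open>Only the Busby invariants at z matter. On the split side they contain a unitary, the sum
  of two unitary lifts; on the Toeplitz side every element is a compact perturbation of the shift
  plus a unitary. A unitary equivalence would make the first a compact perturbation of the
  second.\<close>

lemma split_extension_not_toeplitz:
  assumes E: "split_extension E q" and p: "toeplitz_extension p"
  shows "\<not> same_ext_class E q toeplitz_algebra p"
proof
  assume "same_ext_class E q toeplitz_algebra p"
  then obtain D :: "(nat ell2 \<Rightarrow>\<^sub>L nat ell2) set" and d and D' :: "(nat ell2 \<Rightarrow>\<^sub>L nat ell2) set" and d'
    where D: "split_extension D d" and D': "split_extension D' d'"
      and eq: "unitarily_equivalent (busby_sum (busby E q) (busby D d))
        (busby_sum (busby toeplitz_algebra p) (busby D' d'))"
    unfolding same_ext_class_def by blast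
  obtain U where U: "unitary_op U" and sum: "busby_sum (busby toeplitz_algebra p) (busby D' d') circle_id =
      (\<lambda>T. U o\<^sub>L T o\<^sub>L adj U) ` busby_sum (busby E q) (busby D d) circle_id"
    using eq circle_id_continuous unfolding unitarily_equivalent_def by blast
  obtain u where u: "unitary_op u" "u \<in> busby E q circle_id" using split_extension_unitary[OF E] .
  obtain v where v: "unitary_op v" "v \<in> busby D d circle_id" using split_extension_unitary[OF D] .
  obtain v' where v': "unitary_op v'" "v' \<in> busby D' d' circle_id" using split_extension_unitary[OF D'] .
  let ?A = "prod_op u v"
  define W where "W = (U o\<^sub>L ?A) o\<^sub>L adj U"
  have A: "unitary_op ?A" by (rule unitary_prod_op[OF u(1) v(1)])
  have Ub: "U \<in> bounded_ops" "adj U \<in> bounded_ops" "?A \<in> bounded_ops" "adj ?A \<in> bounded_ops"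
    using U A by (auto simp: unitary_op_def adj_bounded_ops)
  have adjW: "adj W = (U o\<^sub>L adj ?A) o\<^sub>L adj U"
    unfolding W_def by (simp add: adj_compose bounded_ops_compose Ub blinfun_compose_assoc)
  have W: "unitary_op W"
  proof -
    have cancel: "((U o\<^sub>L R) o\<^sub>L adj U) o\<^sub>L ((U o\<^sub>L R') o\<^sub>L adj U) = (U o\<^sub>L (R o\<^sub>L R')) o\<^sub>L adj U" for R R'
    proof -
      have "((U o\<^sub>L R) o\<^sub>L adj U) o\<^sub>L ((U o\<^sub>L R') o\<^sub>L adj U) = ((U o\<^sub>L R) o\<^sub>L ((adj U o\<^sub>L U) o\<^sub>L R')) o\<^sub>L adj U"
        by (simp only: blinfun_compose_assoc)
      also have "adj U o\<^sub>L U = id_blinfun" using U by (simp add: unitary_op_def)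
      finally show ?thesis by (simp add: blinfun_compose_simps blinfun_compose_assoc)
    qed
    have "W \<in> bounded_ops" unfolding W_def by (intro bounded_ops_compose Ub)
    then show ?thesis
      using U A unfolding unitary_op_def adjW unfolding W_def cancel by (simp add: blinfun_compose_simps)
  qed
  have "direct_sum_op u v + 0 \<in> busby_sum (busby E q) (busby D d) circle_id"
    unfolding busby_sum_def using u(2) v(2) compact_ops_zero by blast
  then have "W \<in> busby_sum (busby toeplitz_algebra p) (busby D' d') circle_id"
    unfolding sum W_def by (intro image_eqI) (simp_all add: direct_sum_op_prod_op)
  then obtain R T K where R: "W = direct_sum_op R T + K" "R \<in> busby toeplitz_algebra p circle_id"
    "T \<in> busby D' d' circle_id" "K \<in> compact_ops"
    unfolding busby_sum_def by blast
  have 1: "R - unilateral_shift \<in> compact_ops"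
    using p R(2) cstar_toeplitz_algebra(2) by (intro extension_diff_compact[of toeplitz_algebra p]) (auto simp: toeplitz_extension_def busby_def)
  have 2: "T - v' \<in> compact_ops"
    using D' R(3) v'(2) by (intro extension_diff_compact[of D' d']) (auto simp: split_extension_def busby_def)
  let ?B = "prod_op unilateral_shift v'"
  have v'b: "v' \<in> bounded_ops" "adj v' o\<^sub>L v' = id_blinfun" using v'(1) by (auto simp: unitary_op_def)
  have "W - ?B = prod_op (R - unilateral_shift) (T - v') + K"
    unfolding R(1) direct_sum_op_prod_op prod_op_diff[symmetric] by simp
  then have WB: "W - ?B \<in> compact_ops" using 1 2 R(4) by (simp add: compact_ops_add prod_op_compact)
  \<comment> \<open>The constant function 1 is orthogonal to the range of the shift, so this nonzero
    vector is orthogonal to the range of the isometry \<open>?B\<close>.\<close>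
  have "(hardy_monomial 0, 0 :: nat ell2) = 0"
  proof (rule isometry_not_compact_perturbation_of_unitary[OF W _ _ WB])
    show "?B \<in> bounded_ops" by (intro prod_op_bounded toeplitz_op_circle_id_bounded v'b)
    show "adj ?B o\<^sub>L ?B = id_blinfun"
      by (simp add: adj_prod_op toeplitz_op_circle_id_bounded v'b prod_op_compose unilateral_shift_isometry prod_op_id)
    have "cinner (hardy_monomial 0) (unilateral_shift x) = 0" for x
      using cinner_adj[OF toeplitz_op_circle_id_bounded, of "hardy_monomial 0" x]
      by (simp add: adj_unilateral_shift_monomial)
    then show "cinner (hardy_monomial 0, 0 :: nat ell2) (?B x) = 0" for x
      by (simp add: cinner_prod_def prod_op_apply)
  qed
  then show False using S.norm_e by (simp add: zero_prod_def)
qed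

text \<open>The splitting is the calculus of the gap shift, a homomorphism because that shift is
  unitary. The extension property is transferred from \<open>X.symbol\<close>, with which the
  composite quotient map is known to agree on the algebra.\<close>

lemma split_extension_nonzero:
  "split_extension partial_translation_algebra (translation_symbol \<circ> nonzero_quotient)"
  unfolding split_extension_def
proof (intro conjI)
  have "unital_star_hom (op_algebra partial_translation_algebra) circle_algebra (translation_symbol \<circ> nonzero_quotient)"
    using nonzero_quotient_hom star_iso_translation_symbol unital_star_hom_compose unfolding star_iso_def by blast
  moreover have agree: "(translation_symbol \<circ> nonzero_quotient) A = X.symbol compact_ops A"
    if "A \<in> X.calc_algebra compact_ops" for A
    using translation_symbol_quotient[of A] that
    by (simp add: partial_translation_algebra_nonzero nonzero_symbol_def)
  moreover have "(translation_symbol \<circ> nonzero_quotient) ` X.calc_algebra compact_ops = circle_continuous"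
    unfolding X.symbol_surj[symmetric] by (rule image_cong[OF refl agree])
  moreover have "{A \<in> X.calc_algebra compact_ops. (translation_symbol \<circ> nonzero_quotient) A = (\<lambda>z. 0)} = compact_ops"
  proof -
    have "{A \<in> X.calc_algebra compact_ops. (translation_symbol \<circ> nonzero_quotient) A = (\<lambda>z. 0)} =
        {A \<in> X.calc_algebra compact_ops. X.symbol compact_ops A = (\<lambda>z. 0)}"
      by (rule Collect_cong) (metis agree)
    then show ?thesis by (simp only: X.symbol_kernel)
  qed
  ultimately show "extension_by_compacts partial_translation_algebra circle_algebra (translation_symbol \<circ> nonzero_quotient)"
    using X.extension_calc_algebra[OF refl]
    by (simp add: extension_by_compacts_def partial_translation_algebra_nonzero circle_algebra_def)
  have "unital_star_hom circle_algebra (op_algebra partial_translation_algebra) X.calc"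
    unfolding partial_translation_algebra_nonzero
    by (rule X.calc_hom) (use unitary_permutation_op[OF bij_gap_shift] in \<open>simp add: unitary_op_def\<close>)
  then show "\<exists>\<sigma>. unital_star_hom circle_algebra (op_algebra partial_translation_algebra) \<sigma> \<and>
      (\<forall>f\<in>circle_continuous. (translation_symbol \<circ> nonzero_quotient) (\<sigma> f) = f)"
    using agree[OF X.calc_in_calc_algebra] by (intro exI[of _ X.calc]) simp
qed

theorem theorem2:
  shows "\<exists>(q :: (nonzero_int ell2 \<Rightarrow>\<^sub>L nonzero_int ell2) \<Rightarrow> (int ell2 \<Rightarrow>\<^sub>L int ell2))
          (\<Phi> :: (int ell2 \<Rightarrow>\<^sub>L int ell2) \<Rightarrow> complex \<Rightarrow> complex).
    extension_by_compacts partial_translation_algebra (op_algebra partial_translation_algebra) q \<and>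
    (\<forall>n. q (partial_translation n) = partial_translation n) \<and>
    star_iso (op_algebra partial_translation_algebra) circle_algebra \<Phi> \<and>
    \<Phi> (partial_translation 1) = circle_id \<and>
    zero_ext_class partial_translation_algebra (\<Phi> \<circ> q) \<and>
    (\<exists>p. toeplitz_extension p) \<and>
    (\<forall>p. toeplitz_extension p \<longrightarrow>
       \<not> same_ext_class partial_translation_algebra (\<Phi> \<circ> q) toeplitz_algebra p)"
proof (intro exI[of _ nonzero_quotient] exI[of _ translation_symbol] conjI allI impI)
  show "translation_symbol (partial_translation 1) = circle_id"
    unfolding translation_symbol_def by (rule Z.T_in_calc_algebra(2))
  show "\<exists>p. toeplitz_extension p" using toeplitz_extension_symbol by blast
qed (simp_all only: extension_nonzero_quotient nonzero_quotient_translation star_iso_translation_symbol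
    zero_ext_class_nonzero split_extension_not_toeplitz[OF split_extension_nonzero] not_False_eq_True)

end
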